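(* Let $p\in(2,\infty)$ and $s\in(0,\frac{p-2}{p}]$. Then, for any locally bounded, local weak solution $u\in W^{s,p}_{\rm loc}(\Omega)\cap L^{p-1}_{sp}(\mathbb{R}^N)$ of $(-\Delta_p)^s u=0$ in $\Omega$, we have $$u\in C^{0,\gamma}_{\rm loc}(\Omega)\qquad\text{for any }\gamma\in\big(0,\tfrac{sp}{p-2}\big).$$ Moreover, for every such $\gamma$ there exists a constant $C=C(N,p,s,\gamma)\ge1$ (depending only on these parameters) such that for any ball $B_R\equiv B_R(x_o)\Subset\Omega$ we have $$[u]_{C^{0,\gamma}(B_{\frac12R})}\le\frac{C}{R^{\gamma}}\Big[R^{s-\frac Np}[u]_{W^{s,p}(B_R)}+\|u\|_{L^\infty(B_R)}+\mathrm{Tail}(u;R)\Big].$$ The constant $C$ blows up as $\gamma\uparrow\frac{sp}{p-2}$.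
   Context: $N\ge2$ and $\Omega\subset\mathbb{R}^N$ is a bounded open set. $B_R(x_o)$ is the ball of radius $R$ and center $x_o$; balls written without center are concentric with center $x_o$. $B_R(x_o)\Subset\Omega$ means that the closure of the ball is contained in $\Omega$. $[w]_{C^{0,\gamma}(B)}:=\sup_{x\neq y\in B}\frac{|w(x)-w(y)|}{|x-y|^\gamma}$, and $w\in C^{0,\gamma}_{\rm loc}(\Omega)$ means $w\in C^{0,\gamma}(\overline B)$ for every ball $B\Subset\Omega$ (after modification on a null set). For $q\in[1,\infty)$, $\gamma\in(0,1)$ and an open set $E$, $W^{\gamma,q}(E)$ is the space of measurable $w:E\to\mathbb{R}$ with $\|w\|_{L^q(E)}+[w]_{W^{\gamma,q}(E)}<\infty$, where $[w]_{W^{\gamma,q}(E)}:=\big[\iint_{E\times E}\frac{|w(x)-w(y)|^q}{|x-y|^{N+\gamma q}}\,dx\,dy\big]^{1/q}$; $w\in W^{\gamma,q}_{\rm loc}(\Omega)$ means $w\in W^{\gamma,q}(B)$ for every ball $B\Subset\Omega$. $L^{p-1}_{sp}(\mathbb{R}^N)$ is the set of $w\in L^{p-1}_{\rm loc}(\mathbb{R}^N)$ with $\int_{\mathbb{R}^N}\frac{|w(x)|^{p-1}}{(1+|x|)^{N+sp}}\,dx<\infty$. The tail is $\mathrm{Tail}(u;R)\equiv\mathrm{Tail}(u;x_o,R):=\big[R^{sp}\int_{\mathbb{R}^N\setminus B_R(x_o)}\frac{|u(x)|^{p-1}}{|x-x_o|^{N+sp}}\,dx\big]^{\frac1{p-1}}$,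 where $x_o$ is the center of the ball under consideration. A function $u\in W^{s,p}_{\rm loc}(\Omega)\cap L^{p-1}_{sp}(\mathbb{R}^N)$ is a local weak solution of $(-\Delta_p)^su=0$ in $\Omega$ if $\iint_{\mathbb{R}^N\times\mathbb{R}^N}\frac{|u(x)-u(y)|^{p-2}(u(x)-u(y))(\varphi(x)-\varphi(y))}{|x-y|^{N+sp}}\,dx\,dy=0$ for every $\varphi\in W^{s,p}(\Omega)$ compactly supported in $\Omega$ and extended by $0$ outside $\Omega$. "Locally bounded" means $u\in L^\infty_{\rm loc}(\Omega)$. Saying that a constant "blows up" refers to the admissible constant provided by the result (it is not asserted to stay bounded in the indicated limit); no lower bound on the optimal constant is meant. *)

theory Defs
  imports "HOL-Analysis.Analysis" "HOL-Probability.Essential_Supremum"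
begin

text \<open>
  All norms, seminorms and tails take values in \<^typ>\<open>ennreal\<close>, so that an infinite quantity is
  really infinite and membership in a space is finiteness. Functions are Lebesgue measurable
  functions on the whole space; elements of the function spaces are represented by functions,
  not by classes modulo null sets.
\<close>

text \<open>Power with a positive exponent, extended by \<open>top powr a = top\<close>.\<close>

definition epowr :: "ennreal \<Rightarrow> real \<Rightarrow> ennreal" where
  "epowr x a = (if x = top then top else ennreal (enn2real x powr a))"

definition holder_seminorm :: "real \<Rightarrow> (real^'n) set \<Rightarrow> (real^'n \<Rightarrow> real) \<Rightarrow> ennreal" where
  "holder_seminorm \<gamma> B w =
     (SUP (x, y) \<in> {(x, y). x \<in> B \<and> y \<in> B \<and> x \<noteq> y}. ennreal (\<bar>w x - w y\<bar> / norm (x - y) powr \<gamma>))"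

text \<open>\<open>v\<close> is the representative of \<open>w\<close> that is continuous in \<open>\<Omega>\<close> (unique in \<open>\<Omega>\<close> if it exists).\<close>

definition continuous_rep :: "(real^'n) set \<Rightarrow> (real^'n \<Rightarrow> real) \<Rightarrow> (real^'n \<Rightarrow> real) \<Rightarrow> bool" where
  "continuous_rep \<Omega> w v \<longleftrightarrow> continuous_on \<Omega> v \<and> (AE x in lebesgue. x \<in> \<Omega> \<longrightarrow> v x = w x)"

text \<open>On closed balls a finite Hoelder seminorm already makes the function bounded and continuous.\<close>

definition holder_loc :: "real \<Rightarrow> (real^'n) set \<Rightarrow> (real^'n \<Rightarrow> real) set" where
  "holder_loc \<gamma> \<Omega> =
     {w. \<exists>v. (AE x in lebesgue. x \<in> \<Omega> \<longrightarrow> v x = w x) \<and>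
             (\<forall>x r. 0 < r \<and> cball x r \<subseteq> \<Omega> \<longrightarrow> holder_seminorm \<gamma> (cball x r) v < top)}"

definition Linf_norm :: "(real^'n) set \<Rightarrow> (real^'n \<Rightarrow> real) \<Rightarrow> ennreal" where
  "Linf_norm E w = esssup (lebesgue_on E) (\<lambda>x. ennreal \<bar>w x\<bar>)"

definition Linf_loc :: "(real^'n) set \<Rightarrow> (real^'n \<Rightarrow> real) set" where
  "Linf_loc \<Omega> =
     {w. w \<in> borel_measurable (lebesgue_on \<Omega>) \<and>
         (\<forall>x r. 0 < r \<and> cball x r \<subseteq> \<Omega> \<longrightarrow> Linf_norm (ball x r) w < top)}"

definition Lq_norm :: "real \<Rightarrow> (real^'n) set \<Rightarrow> (real^'n \<Rightarrow> real) \<Rightarrow> ennreal" where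
  "Lq_norm q E w = epowr (\<integral>\<^sup>+ x. ennreal (\<bar>w x\<bar> powr q) \<partial>lebesgue_on E) (1 / q)"

definition frac_seminorm :: "real \<Rightarrow> real \<Rightarrow> (real^'n) set \<Rightarrow> (real^'n \<Rightarrow> real) \<Rightarrow> ennreal" where
  "frac_seminorm \<gamma> q E w =
     epowr (\<integral>\<^sup>+ (x, y). ennreal (\<bar>w x - w y\<bar> powr q / norm (x - y) powr (real CARD('n) + \<gamma> * q))
              \<partial>(lebesgue_on E \<Otimes>\<^sub>M lebesgue_on E)) (1 / q)"

definition frac_Sobolev :: "real \<Rightarrow> real \<Rightarrow> (real^'n) set \<Rightarrow> (real^'n \<Rightarrow> real) set" where
  "frac_Sobolev \<gamma> q E =
     {w. w \<in> borel_measurable (lebesgue_on E) \<and> Lq_norm q E w + frac_seminorm \<gamma> q E w < top}"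

definition frac_Sobolev_loc :: "real \<Rightarrow> real \<Rightarrow> (real^'n) set \<Rightarrow> (real^'n \<Rightarrow> real) set" where
  "frac_Sobolev_loc \<gamma> q \<Omega> =
     {w. \<forall>x r. 0 < r \<and> cball x r \<subseteq> \<Omega> \<longrightarrow> w \<in> frac_Sobolev \<gamma> q (ball x r)}"

text \<open>The space \<open>L\<^sup>p\<^sup>-\<^sup>1\<^sub>s\<^sub>p\<close> on the whole space.\<close>

definition tail_space :: "real \<Rightarrow> real \<Rightarrow> (real^'n \<Rightarrow> real) set" where
  "tail_space s p =
     {w. w \<in> borel_measurable lebesgue \<and>
         (\<forall>K. compact K \<longrightarrow> (\<integral>\<^sup>+ x. ennreal (\<bar>w x\<bar> powr (p - 1)) \<partial>lebesgue_on K) < top) \<and>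
         (\<integral>\<^sup>+ x. ennreal (\<bar>w x\<bar> powr (p - 1) / (1 + norm x) powr (real CARD('n) + s * p)) \<partial>lebesgue) < top}"

definition Tail :: "real \<Rightarrow> real \<Rightarrow> (real^'n \<Rightarrow> real) \<Rightarrow> real^'n \<Rightarrow> real \<Rightarrow> ennreal" where
  "Tail s p u x\<^sub>o R =
     epowr (ennreal (R powr (s * p)) *
            (\<integral>\<^sup>+ x. ennreal (\<bar>u x\<bar> powr (p - 1) / norm (x - x\<^sub>o) powr (real CARD('n) + s * p))
               \<partial>lebesgue_on (- ball x\<^sub>o R)))
       (1 / (p - 1))"

text \<open>
  In the weak formulation the vanishing of the integral is stated with
  \<^const>\<open>has_bochner_integral\<close>, since \<^const>\<open>lebesgue_integral\<close> is \<open>0\<close> for every non-integrable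
  function. The absolute convergence is no additional restriction: it follows from the
  integrability of \<open>u\<close> and \<open>\<phi>\<close> by Hoelder's inequality near the diagonal and by the tail bound
  away from it.
\<close>

definition local_weak_solution :: "real \<Rightarrow> real \<Rightarrow> (real^'n) set \<Rightarrow> (real^'n \<Rightarrow> real) \<Rightarrow> bool" where
  "local_weak_solution s p \<Omega> u \<longleftrightarrow>
     u \<in> frac_Sobolev_loc s p \<Omega> \<inter> tail_space s p \<and>
     (\<forall>\<phi>. \<phi> \<in> frac_Sobolev s p \<Omega> \<and> (\<exists>K. compact K \<and> K \<subseteq> \<Omega> \<and> (\<forall>x. x \<notin> K \<longrightarrow> \<phi> x = 0)) \<longrightarrow>
        has_bochner_integral (lebesgue \<Otimes>\<^sub>M lebesgue)
          (\<lambda>(x, y). \<bar>u x - u y\<bar> powr (p - 2) * (u x - u y) * (\<phi> x - \<phi> y)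
                      / norm (x - y) powr (real CARD('n) + s * p)) 0)"

end

theory Submission
  imports Defs
begin

text \<open>
  The proof is a regularity iteration for first differences \<open>w = u (\<cdot> + h) - u\<close> in \<open>L\<^sup>q\<close>. Write
  \<open>J t = \<bar>t\<bar>\<^sup>p\<^sup>-\<^sup>2 t\<close>. Subtracting the equation from its translate shows that \<open>w\<close> solves a linear
  equation whose kernel \<open>(J a - J b) / (a - b) \<cdot> \<bar>x - y\<bar>\<^sup>-\<^sup>N\<^sup>-\<^sup>s\<^sup>p\<close> is symmetric and nonnegative, where \<open>a\<close>
  and \<open>b\<close> are the differences of the translate and of \<open>u\<close> between \<open>x\<close> and \<open>y\<close>. Testing with
  \<open>\<bar>w\<bar>\<^sup>\<delta>\<^sup>-\<^sup>1 w \<eta>\<^sup>2\<close>, \<open>\<delta> = q - p + 1\<close>, and using \<open>(J a - J b) / (a - b) \<ge> c \<bar>a - b\<bar>\<^sup>p\<^sup>-\<^sup>2\<close> controls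
  \<open>\<bar>w x - w y\<bar>\<^sup>q\<close> against the kernel, hence \<open>\<bar>h\<bar>\<^sup>-\<^sup>s\<^sup>p\<close> times the \<open>q\<close>-th power of the \<open>L\<^sup>q\<close> norm of the
  second difference. On the right stands \<open>(\<bar>a\<bar> + \<bar>b\<bar>)\<^sup>p\<^sup>-\<^sup>2 \<bar>w\<bar>\<^sup>\<delta>\<^sup>+\<^sup>1 \<bar>x - y\<bar>\<^sup>2\<^sup>-\<^sup>N\<^sup>-\<^sup>s\<^sup>p\<close>, because the
  cut-off contributes \<open>\<bar>x - y\<bar>\<^sup>2\<close>. If all first differences are \<open>O(\<bar>h\<bar>\<^sup>\<sigma>)\<close> in \<open>L\<^sup>q\<close>, this is
  \<open>O(\<bar>h\<bar>\<^sup>\<sigma>\<^sup>(\<^sup>\<delta>\<^sup>+\<^sup>1\<^sup>))\<close> as soon as \<open>\<sigma> (p - 2) > s p - 2\<close>. So \<open>\<sigma>\<close> improves to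
  \<open>(s p + \<sigma> (q - p + 2)) / q\<close>, a contraction with fixed point \<open>s p / (p - 2)\<close>
  (\<open>nikolskii_gain\<close>, \<open>nikolskii_saturate\<close>). The hypothesis \<open>s \<le> (p - 2) / p\<close> says that this fixed
  point is at most \<open>1\<close>, and below order \<open>1\<close> bounds on second differences give the same bounds on
  first differences (\<open>nikolskii_from_second_differences\<close>).

  The exponent would degrade to \<open>s p / (p - 1)\<close> if the interaction with far away points were
  estimated by its size alone. Therefore the kernel is split into a singular part of short
  range and a bounded Lipschitz part. The Lipschitz part acts as a source whose increment is
  \<open>O(\<bar>w\<bar> + \<bar>h\<bar>)\<close> (\<open>difference_equation\<close>); after multiplication with the test function this has the
  same order as the error term.

  The iteration starts from \<open>q = p\<close> and \<open>\<sigma> = s\<close>, the order of regularity contained in the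
  seminorm of \<open>u\<close>. Since \<open>u\<close> is bounded, integrability \<open>q\<close> may be raised to \<open>\<theta> q\<close> at the cost of
  lowering \<open>\<sigma>\<close> to \<open>\<sigma> / \<theta>\<close>. For the fixed factor \<open>\<theta> = (s p + 2) / (s p + 1)\<close> and \<open>\<sigma>\<close> close to the fixed
  point the requirement \<open>\<sigma> (p - 2) > s p - 2\<close> survives this loss, so \<open>\<sigma>\<close> can be driven back up
  (\<open>nikolskii_all_exponents\<close>). Thus every \<open>\<sigma> < s p / (p - 2)\<close> is available with arbitrarily large
  \<open>q\<close>, and comparing averages over balls gives Hoelder exponent \<open>\<sigma> - N / q\<close>
  (\<open>nikolskii_imp_holder\<close>).

  All estimates are made for functions normalized on the unit ball, with constants that depend
  on the class only. The general statement follows by rescaling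
  (\<open>normalized_rescaling\<close>), with the bracket on the right-hand side of the estimate as the
  normalizing factor.
\<close>


section \<open>Signed powers and the pointwise Caccioppoli inequality\<close>

definition spow :: "real \<Rightarrow> real \<Rightarrow> real" where
  "spow m t = sgn t * \<bar>t\<bar> powr m"

lemma abs_spow: "\<bar>spow m t\<bar> = \<bar>t\<bar> powr m"
  by (simp add: spow_def abs_mult abs_sgn_eq)

lemma spow_minus [simp]: "spow m (- t) = - spow m t"
  by (simp add: spow_def sgn_minus)

lemma spow_zero [simp]: "spow m 0 = 0"
  by (simp add: spow_def)

lemma spow_borel [measurable]: "spow m \<in> borel_measurable borel"
  unfolding spow_def by measurable

lemma powr_pred_mult:
  fixes x :: real
  assumes "0 \<le> x" shows "x powr (m - 1) * x = x powr m"
proof (cases "x = 0")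
  case False
  then have "x powr m = x powr (m - 1) * x powr 1" unfolding powr_add[symmetric] by simp
  then show ?thesis using assms False by simp
qed auto

lemma spow_alt: "spow m t = \<bar>t\<bar> powr (m - 1) * t"
proof -
  have "spow m t = sgn t * (\<bar>t\<bar> powr (m - 1) * \<bar>t\<bar>)" by (simp add: spow_def powr_pred_mult)
  also have "\<dots> = \<bar>t\<bar> powr (m - 1) * t" by (simp add: sgn_if)
  finally show ?thesis .
qed

text \<open>
  Strong monotonicity of the signed power. For arguments of equal sign \<open>x\<^sup>m - y\<^sup>m \<ge> x\<^sup>m\<^sup>-\<^sup>1 (x - y)\<close> when
  \<open>x \<ge> y \<ge> 0\<close>; for opposite signs the larger of the two powers already dominates.
\<close>

lemma spow_diff_lower:
  fixes a b :: real
  assumes "1 \<le> m"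
  shows "2 powr (-m) * (\<bar>a\<bar> + \<bar>b\<bar>) powr (m - 1) * (a - b)\<^sup>2 \<le> (spow m a - spow m b) * (a - b)"
proof -
  define c where "c = (2::real) powr (-m)"
  define S where "S = \<bar>a\<bar> + \<bar>b\<bar>"
  have cS: "c * S powr (m - 1) \<le> (S / 2) powr (m - 1)" if "0 \<le> S" for S :: real
  proof -
    have "2 * c = 2 powr (- (m - 1))" by (simp add: c_def powr_mult_base)
    also have "\<dots> = 1 / 2 powr (m - 1)" by (rule powr_minus_divide)
    finally have "(S / 2) powr (m - 1) = 2 * c * S powr (m - 1)"
      using that by (simp add: powr_divide)
    moreover have "0 \<le> c * S powr (m - 1)" by (simp add: c_def)
    ultimately show ?thesis by simp
  qed
  have same: "c * (x + y) powr (m - 1) * (x - y) \<le> x powr m - y powr m" if "0 \<le> y" "y \<le> x" for x y :: real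
  proof -
    have "c * (x + y) powr (m - 1) \<le> ((x + y) / 2) powr (m - 1)" using that by (intro cS) auto
    also have "\<dots> \<le> x powr (m - 1)" using that assms by (intro powr_mono2) auto
    finally have "c * (x + y) powr (m - 1) * (x - y) \<le> x powr (m - 1) * (x - y)"
      using that by (intro mult_right_mono) auto
    also have "\<dots> = x powr m - x powr (m - 1) * y"
      using that by (simp add: right_diff_distrib powr_pred_mult)
    also have "\<dots> \<le> x powr m - y powr (m - 1) * y"
      using that assms by (simp add: mult_right_mono powr_mono2)
    also have "\<dots> = x powr m - y powr m" using that by (simp add: powr_pred_mult)
    finally show ?thesis .
  qed
  have opp: "c * (x + y) powr (m - 1) * (x + y) \<le> x powr m + y powr m" if "0 \<le> y" "0 \<le> x" for x y :: real
  proof -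
    have "c * (x + y) powr (m - 1) * (x + y) = c * (x + y) powr m"
      using that by (simp add: powr_pred_mult mult.assoc)
    also have "\<dots> = ((x + y) / 2) powr m"
      using that by (simp add: c_def powr_divide powr_minus field_simps)
    also have "\<dots> \<le> (max x y) powr m" using that assms by (intro powr_mono2) auto
    also have "\<dots> \<le> x powr m + y powr m" by (auto simp: max_def)
    finally show ?thesis .
  qed
  have main: "c * S powr (m - 1) * (a - b) \<le> spow m a - spow m b" if "S = \<bar>a\<bar> + \<bar>b\<bar>" "b \<le> a" for a b S
  proof -
    consider "0 \<le> b" | "b < 0" "0 \<le> a" | "a < 0" using that by linarith
    then show ?thesis
    proof cases
      case 1 then show ?thesis using same[of b a] that by (auto simp: spow_def sgn_if)
    next
      case 2 then show ?thesis using opp[of "-b" a] that by (auto simp: spow_def sgn_if)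
    next
      case 3 then show ?thesis using same[of "-a" "-b"] that by (auto simp: spow_def sgn_if add.commute)
    qed
  qed
  show ?thesis
  proof (cases "b \<le> a")
    case True
    then have "c * S powr (m - 1) * (a - b) * (a - b) \<le> (spow m a - spow m b) * (a - b)"
      using main[OF S_def] by (intro mult_right_mono) auto
    then show ?thesis by (simp add: c_def S_def power2_eq_square mult.assoc)
  next
    case False
    then have "c * S powr (m - 1) * (b - a) * (b - a) \<le> (spow m b - spow m a) * (b - a)"
      using main[of S b a] by (intro mult_right_mono) (auto simp: S_def)
    then show ?thesis by (simp add: c_def S_def power2_eq_square algebra_simps)
  qed
qed

text \<open>
  The matching local Lipschitz bound, from the mean value theorem for equal signs and from
  monotonicity of powers for opposite signs.
\<close>

lemma spow_diff_upper:
  fixes a b :: real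
  assumes "1 \<le> m"
  shows "\<bar>spow m a - spow m b\<bar> \<le> m * (\<bar>a\<bar> + \<bar>b\<bar>) powr (m - 1) * \<bar>a - b\<bar>"
proof -
  have same: "x powr m - y powr m \<le> m * (x + y) powr (m - 1) * (x - y)" if "0 \<le> y" "y \<le> x" for x y :: real
  proof -
    have *: "x powr m - y powr m \<le> m * x powr (m - 1) * (x - y)"
    proof (cases "y = 0 \<or> y = x")
      case False
      then have yx: "y < x" "0 < y" using that by auto
      have "\<exists>z. y < z \<and> z < x \<and> x powr m - y powr m = (x - y) * (m * z powr (m - 1))"
        by (rule MVT2[OF yx(1)]) (use yx in \<open>auto intro!: derivative_eq_intros\<close>)
      then obtain z where z: "y < z" "z < x" "x powr m - y powr m = (x - y) * (m * z powr (m - 1))" by blast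
      have "z powr (m - 1) \<le> x powr (m - 1)" using z yx assms by (intro powr_mono2) auto
      then have "(x - y) * (m * z powr (m - 1)) \<le> (x - y) * (m * x powr (m - 1))"
        using yx assms by (intro mult_left_mono) auto
      then show ?thesis using z by (simp add: mult_ac)
    next
      case True
      have "x powr m \<le> m * (x powr (m - 1) * x)"
        using that assms by (simp add: powr_pred_mult mult_le_cancel_right1)
      then show ?thesis using True that by auto
    qed
    also have "\<dots> \<le> m * (x + y) powr (m - 1) * (x - y)"
      using that assms by (intro mult_right_mono mult_left_mono powr_mono2) auto
    finally show ?thesis .
  qed
  have opp: "x powr m + y powr m \<le> m * (x + y) powr (m - 1) * (x + y)" if "0 \<le> y" "0 \<le> x" for x y :: real
  proof -
    have "x powr (m - 1) * x \<le> (x + y) powr (m - 1) * x" "y powr (m - 1) * y \<le> (x + y) powr (m - 1) * y"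
      using that assms by (intro mult_right_mono powr_mono2; simp)+
    then have "x powr m + y powr m \<le> (x + y) powr (m - 1) * (x + y)"
      using that by (simp add: powr_pred_mult distrib_left)
    also have "\<dots> \<le> m * (x + y) powr (m - 1) * (x + y)"
      using that assms by (intro mult_right_mono) (auto simp: mult_le_cancel_right1)
    finally show ?thesis .
  qed
  have main: "\<bar>spow m a - spow m b\<bar> \<le> m * (\<bar>a\<bar> + \<bar>b\<bar>) powr (m - 1) * \<bar>a - b\<bar>" if "b \<le> a" for a b
  proof -
    have mono: "x powr m \<le> y powr m" if "0 \<le> x" "x \<le> y" for x y :: real
      using that assms by (intro powr_mono2) auto
    consider "0 \<le> b" | "b < 0" "0 \<le> a" | "a < 0" using that by linarith
    then show ?thesis
    proof cases
      case 1 then show ?thesis using same[of b a] mono[of b a] that by (auto simp: spow_def sgn_if)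
    next
      case 2 then show ?thesis using opp[of "-b" a] that by (auto simp: spow_def sgn_if)
    next
      case 3 then show ?thesis using same[of "-a" "-b"] mono[of "-a" "-b"] that
        by (auto simp: spow_def sgn_if add.commute)
    qed
  qed
  show ?thesis
    using main[of b a] main[of a b] by (cases "b \<le> a") (auto simp: abs_minus_commute add.commute)
qed

text \<open>
  The algebraic core of the energy estimate. Both signed powers are strictly monotone, so
  \<open>spow (p - 1) a - spow (p - 1) b = A (W - V)\<close> and \<open>spow \<delta> W - spow \<delta> V = B (W - V)\<close> with positive
  factors \<open>A\<close>, \<open>B\<close> comparable to powers of \<open>\<bar>a\<bar> + \<bar>b\<bar>\<close> and \<open>\<bar>W\<bar> + \<bar>V\<bar>\<close>. Splitting the difference of the
  test function into its symmetric and antisymmetric part in the cut-off values, the first part is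
  coercive and Young's inequality absorbs half of it into the second. Both sums of absolute
  values dominate \<open>\<bar>W - V\<bar>\<close>, which turns the remaining coercive term into a pure power.
\<close>

lemma caccioppoli_pointwise:
  fixes p \<delta> :: real
  assumes "2 \<le> p" "1 \<le> \<delta>"
  obtains c C :: real where "0 < c" "0 < C"
    "\<And>a b W V \<eta> \<zeta>. a - b = W - V \<Longrightarrow> 0 \<le> \<eta> \<Longrightarrow> 0 \<le> \<zeta> \<Longrightarrow>
       c * \<bar>W - V\<bar> powr (p - 1 + \<delta>) * (\<eta>\<^sup>2 + \<zeta>\<^sup>2)
       \<le> (spow (p - 1) a - spow (p - 1) b) * (spow \<delta> W * \<eta>\<^sup>2 - spow \<delta> V * \<zeta>\<^sup>2)
          + C * (\<bar>a\<bar> + \<bar>b\<bar>) powr (p - 2) * (\<bar>W\<bar> + \<bar>V\<bar>) powr (\<delta> + 1) * (\<eta> - \<zeta>)\<^sup>2"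
proof -
  define c1 where "c1 = (2::real) powr (- (p - 1))"
  define c2 where "c2 = (2::real) powr (- \<delta>)"
  have c1: "0 < c1" and c2: "0 < c2" by (auto simp: c1_def c2_def)
  show thesis
  proof (rule that[of "c1 * c2 / 4" "2 * (p - 1) / c2"])
    show "0 < c1 * c2 / 4" "0 < 2 * (p - 1) / c2" using c1 c2 assms by auto
  next
    fix a b W V \<eta> \<zeta> :: real
    assume ab: "a - b = W - V" and "0 \<le> \<eta>" "0 \<le> \<zeta>"
    define S where "S = \<bar>a\<bar> + \<bar>b\<bar>"
    define T where "T = \<bar>W\<bar> + \<bar>V\<bar>"
    define d where "d = W - V"
    define X where "X = spow (p - 1) a - spow (p - 1) b"
    define Y where "Y = spow \<delta> W - spow \<delta> V"
    define Q where "Q = spow \<delta> W + spow \<delta> V"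
    define P where "P = T powr (\<delta> - 1)"
    have T0: "0 \<le> T" and S0: "0 \<le> S" by (auto simp: T_def S_def)
    have P0: "0 \<le> P" by (simp add: P_def)
    have dT: "\<bar>d\<bar> \<le> T" "\<bar>d\<bar> \<le> S" using ab by (auto simp: T_def d_def S_def)
    show "c1 * c2 / 4 * \<bar>W - V\<bar> powr (p - 1 + \<delta>) * (\<eta>\<^sup>2 + \<zeta>\<^sup>2)
       \<le> (spow (p - 1) a - spow (p - 1) b) * (spow \<delta> W * \<eta>\<^sup>2 - spow \<delta> V * \<zeta>\<^sup>2)
          + 2 * (p - 1) / c2 * (\<bar>a\<bar> + \<bar>b\<bar>) powr (p - 2) * (\<bar>W\<bar> + \<bar>V\<bar>) powr (\<delta> + 1) * (\<eta> - \<zeta>)\<^sup>2"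
    proof (cases "d = 0")
      case True
      then have "a = b" "W = V" using ab by (auto simp: d_def)
      then show ?thesis using assms c2 by simp
    next
      case False
      define A where "A = X / d"
      define B where "B = Y / d"
      have XA: "X = A * d" and YB: "Y = B * d" using False by (auto simp: A_def B_def)
      have d2: "0 < d\<^sup>2" using False by simp
      have "c1 * S powr (p - 2) * d\<^sup>2 \<le> A * d\<^sup>2"
        using spow_diff_lower[of "p - 1" a b] assms ab
        by (simp add: XA[symmetric] X_def S_def c1_def d_def power2_eq_square mult_ac)
           (simp add: XA mult_ac X_def[symmetric] d_def)
      then have A_lo: "c1 * S powr (p - 2) \<le> A" using d2 by (simp add: mult_le_cancel_right)
      have "c2 * P * d\<^sup>2 \<le> Y * d"
        using spow_diff_lower[of \<delta> W V] assms by (simp add: Y_def c2_def P_def T_def d_def)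
      then have "c2 * P * d\<^sup>2 \<le> B * d\<^sup>2" by (simp add: YB power2_eq_square mult_ac)
      then have B_lo: "c2 * P \<le> B" using d2 by (simp add: mult_le_cancel_right)
      have A0: "0 \<le> A" using A_lo c1 by (meson less_imp_le mult_nonneg_nonneg order_trans powr_ge_zero)
      have "\<bar>X\<bar> \<le> (p - 1) * S powr (p - 2) * \<bar>d\<bar>"
        using spow_diff_upper[of "p - 1" a b] assms ab by (simp add: X_def S_def d_def)
      then have A_up: "A \<le> (p - 1) * S powr (p - 2)"
        using False A0 by (simp add: XA abs_mult mult_le_cancel_right)
      have TT: "T powr \<delta> = P * T" "T powr (\<delta> + 1) = P * T\<^sup>2"
        using powr_pred_mult[OF T0, of \<delta>] powr_pred_mult[OF T0, of "\<delta> + 1"]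
        by (simp_all add: P_def power2_eq_square mult.assoc[symmetric])
      have "\<bar>Q\<bar> \<le> \<bar>W\<bar> powr \<delta> + \<bar>V\<bar> powr \<delta>"
        unfolding Q_def using abs_triangle_ineq[of "spow \<delta> W" "spow \<delta> V"] by (simp add: abs_spow)
      also have "\<dots> \<le> T powr \<delta> + T powr \<delta>"
        using assms by (intro add_mono powr_mono2) (auto simp: T_def)
      finally have Q: "\<bar>Q\<bar> \<le> 2 * (P * T)" by (simp add: TT)
      define z where "z = \<bar>d\<bar> * (\<eta> + \<zeta>)"
      define y where "y = T * \<bar>\<eta> - \<zeta>\<bar>"
      have young: "z * y \<le> c2 / 8 * z\<^sup>2 + 2 / c2 * y\<^sup>2"
      proof -
        have "0 \<le> (c2 / 8) * (z - 4 / c2 * y)\<^sup>2" using c2 by simp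
        also have "\<dots> = c2 / 8 * z\<^sup>2 + 2 / c2 * y\<^sup>2 - z * y"
          using c2 by (simp add: power2_eq_square field_simps)
        finally show ?thesis by simp
      qed
      have z2: "z\<^sup>2 \<le> 2 * d\<^sup>2 * (\<eta>\<^sup>2 + \<zeta>\<^sup>2)"
      proof -
        have "(\<eta> + \<zeta>)\<^sup>2 \<le> 2 * (\<eta>\<^sup>2 + \<zeta>\<^sup>2)" using sum_squares_bound[of \<eta> \<zeta>] by (simp add: power2_sum)
        then have "d\<^sup>2 * (\<eta> + \<zeta>)\<^sup>2 \<le> d\<^sup>2 * (2 * (\<eta>\<^sup>2 + \<zeta>\<^sup>2))" by (intro mult_left_mono) auto
        then show ?thesis by (simp only: z_def power_mult_distrib power2_abs mult_ac)
      qed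
      \<comment> \<open>the first half is coercive, the second one carries the difference of the cut-off\<close>
      have split: "spow \<delta> W * \<eta>\<^sup>2 - spow \<delta> V * \<zeta>\<^sup>2 = Y * (\<eta>\<^sup>2 + \<zeta>\<^sup>2) / 2 + Q * ((\<eta> - \<zeta>) * (\<eta> + \<zeta>)) / 2"
        by (simp add: Y_def Q_def power2_eq_square field_simps)
      have "\<bar>d * (Q * ((\<eta> - \<zeta>) * (\<eta> + \<zeta>)) / 2)\<bar> = \<bar>Q\<bar> * (\<bar>d\<bar> * \<bar>\<eta> - \<zeta>\<bar> * (\<eta> + \<zeta>)) / 2"
        using \<open>0 \<le> \<eta>\<close> \<open>0 \<le> \<zeta>\<close> by (simp add: abs_mult)
      also have "\<dots> \<le> (2 * (P * T)) * (\<bar>d\<bar> * \<bar>\<eta> - \<zeta>\<bar> * (\<eta> + \<zeta>)) / 2"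
        using Q \<open>0 \<le> \<eta>\<close> \<open>0 \<le> \<zeta>\<close> by (intro divide_right_mono mult_right_mono) auto
      also have "\<dots> = P * (z * y)" by (simp add: z_def y_def)
      also have "\<dots> \<le> P * (c2 / 8 * z\<^sup>2 + 2 / c2 * y\<^sup>2)" using young P0 by (rule mult_left_mono)
      also have "\<dots> \<le> P * (c2 / 8 * (2 * d\<^sup>2 * (\<eta>\<^sup>2 + \<zeta>\<^sup>2)) + 2 / c2 * y\<^sup>2)"
        using z2 c2 P0 by (intro mult_left_mono add_mono) auto
      also have "\<dots> = c2 / 4 * P * d\<^sup>2 * (\<eta>\<^sup>2 + \<zeta>\<^sup>2) + 2 / c2 * P * y\<^sup>2"
        using c2 by (simp add: field_simps)
      finally have cross: "\<bar>d * (Q * ((\<eta> - \<zeta>) * (\<eta> + \<zeta>)) / 2)\<bar>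
          \<le> c2 / 4 * P * d\<^sup>2 * (\<eta>\<^sup>2 + \<zeta>\<^sup>2) + 2 / c2 * P * y\<^sup>2" .
      have "d * (Y * (\<eta>\<^sup>2 + \<zeta>\<^sup>2) / 2) = B * (d\<^sup>2 * (\<eta>\<^sup>2 + \<zeta>\<^sup>2) / 2)" by (simp add: YB power2_eq_square)
      also have "\<dots> \<ge> c2 * P * (d\<^sup>2 * (\<eta>\<^sup>2 + \<zeta>\<^sup>2) / 2)" using B_lo by (intro mult_right_mono) auto
      finally have dY: "c2 * P * (d\<^sup>2 * (\<eta>\<^sup>2 + \<zeta>\<^sup>2) / 2) \<le> d * (Y * (\<eta>\<^sup>2 + \<zeta>\<^sup>2) / 2)" .
      define G where "G = spow \<delta> W * \<eta>\<^sup>2 - spow \<delta> V * \<zeta>\<^sup>2"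
      have "c2 / 4 * P * d\<^sup>2 * (\<eta>\<^sup>2 + \<zeta>\<^sup>2) \<le> d * G + 2 / c2 * P * y\<^sup>2"
      proof -
        have G: "d * G = d * (Y * (\<eta>\<^sup>2 + \<zeta>\<^sup>2) / 2) + d * (Q * ((\<eta> - \<zeta>) * (\<eta> + \<zeta>)) / 2)"
          by (simp only: G_def split distrib_left)
        have half: "c2 * P * (d\<^sup>2 * (\<eta>\<^sup>2 + \<zeta>\<^sup>2) / 2) = 2 * (c2 / 4 * P * d\<^sup>2 * (\<eta>\<^sup>2 + \<zeta>\<^sup>2))" by simp
        have arith: "e \<le> g + r" if "2 * e \<le> x" "\<bar>y\<bar> \<le> e + r" "g = x + y" for e g r x y :: real
          using that by linarith
        show ?thesis by (rule arith[OF dY[unfolded half] cross G])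
      qed
      then have "A * (c2 / 4 * P * d\<^sup>2 * (\<eta>\<^sup>2 + \<zeta>\<^sup>2)) \<le> A * (d * G + 2 / c2 * P * y\<^sup>2)"
        using A0 by (rule mult_left_mono)
      also have "\<dots> = X * G + A * (2 / c2 * P * y\<^sup>2)" by (simp add: XA algebra_simps)
      also have "\<dots> \<le> X * G + ((p - 1) * S powr (p - 2)) * (2 / c2 * P * y\<^sup>2)"
        using A_up c2 P0 by (intro add_left_mono mult_right_mono) auto
      also have "\<dots> = X * G + 2 * (p - 1) / c2 * S powr (p - 2) * T powr (\<delta> + 1) * (\<eta> - \<zeta>)\<^sup>2"
        by (simp add: TT y_def power_mult_distrib)
      finally have up: "A * (c2 / 4 * P * d\<^sup>2 * (\<eta>\<^sup>2 + \<zeta>\<^sup>2))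
          \<le> X * G + 2 * (p - 1) / c2 * S powr (p - 2) * T powr (\<delta> + 1) * (\<eta> - \<zeta>)\<^sup>2" .
      have "\<bar>d\<bar> powr (p - 1 + \<delta>) = \<bar>d\<bar> powr (p - 2) * \<bar>d\<bar> powr (\<delta> - 1) * \<bar>d\<bar> powr 2"
        unfolding powr_add[symmetric] by (simp add: algebra_simps)
      also have "\<dots> = \<bar>d\<bar> powr (p - 2) * \<bar>d\<bar> powr (\<delta> - 1) * d\<^sup>2"
        using False by (simp add: powr_numeral)
      also have "\<dots> \<le> S powr (p - 2) * P * d\<^sup>2"
        unfolding P_def using dT assms by (intro mult_mono powr_mono2) auto
      finally have "c1 * c2 / 4 * \<bar>d\<bar> powr (p - 1 + \<delta>) * (\<eta>\<^sup>2 + \<zeta>\<^sup>2)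
          \<le> c1 * c2 / 4 * (S powr (p - 2) * P * d\<^sup>2) * (\<eta>\<^sup>2 + \<zeta>\<^sup>2)"
        using c1 c2 by (intro mult_right_mono mult_left_mono) auto
      also have "\<dots> = (c1 * S powr (p - 2)) * (c2 / 4 * P * d\<^sup>2 * (\<eta>\<^sup>2 + \<zeta>\<^sup>2))" by simp
      also have "\<dots> \<le> A * (c2 / 4 * P * d\<^sup>2 * (\<eta>\<^sup>2 + \<zeta>\<^sup>2))"
        using A_lo c2 P0 by (intro mult_right_mono) auto
      also note up
      finally show ?thesis by (simp add: X_def G_def S_def T_def d_def)
    qed
  qed
qed

lemma powr_add_le:
  fixes x y :: real
  assumes "0 \<le> q"
  shows "\<bar>x + y\<bar> powr q \<le> 2 powr q * (\<bar>x\<bar> powr q + \<bar>y\<bar> powr q)"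
proof -
  have "\<bar>x + y\<bar> powr q \<le> (2 * max \<bar>x\<bar> \<bar>y\<bar>) powr q" using assms by (intro powr_mono2) auto
  also have "\<dots> = 2 powr q * max \<bar>x\<bar> \<bar>y\<bar> powr q" by (simp add: powr_mult)
  also have "\<dots> \<le> 2 powr q * (\<bar>x\<bar> powr q + \<bar>y\<bar> powr q)" by (intro mult_left_mono) (auto simp: max_def)
  finally show ?thesis .
qed

text \<open>
  The constant in front of one summand may be taken arbitrarily close to \<open>1\<close>, since the summand \<open>b\<close>
  is either negligible against \<open>a\<close> or dominates it up to a constant.
\<close>

lemma powr_add_le_eps:
  fixes q \<epsilon> :: real
  assumes "0 < q" "0 < \<epsilon>"
  obtains C where "0 < C" "\<And>a b. \<bar>a + b\<bar> powr q \<le> (1 + \<epsilon>) * \<bar>a\<bar> powr q + C * \<bar>b\<bar> powr q"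
proof -
  define \<kappa> where "\<kappa> = (1 + \<epsilon>) powr (1 / q) - 1"
  have "1 < (1 + \<epsilon>) powr (1 / q)" using assms by simp
  then have k: "0 < \<kappa>" by (simp add: \<kappa>_def)
  have kq: "(1 + \<kappa>) powr q = 1 + \<epsilon>" using assms by (simp add: \<kappa>_def powr_powr)
  show thesis
  proof (rule that[of "(1 / \<kappa> + 1) powr q"])
    have "0 < 1 / \<kappa> + 1" using k by (simp add: add_pos_pos)
    then show "0 < (1 / \<kappa> + 1) powr q" by simp
    fix a b :: real
    show "\<bar>a + b\<bar> powr q \<le> (1 + \<epsilon>) * \<bar>a\<bar> powr q + (1 / \<kappa> + 1) powr q * \<bar>b\<bar> powr q"
    proof (cases "\<bar>b\<bar> \<le> \<kappa> * \<bar>a\<bar>")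
      case True
      then have "\<bar>a + b\<bar> powr q \<le> ((1 + \<kappa>) * \<bar>a\<bar>) powr q"
        using assms abs_triangle_ineq[of a b] by (intro powr_mono2) (auto simp: algebra_simps)
      also have "\<dots> = (1 + \<epsilon>) * \<bar>a\<bar> powr q" using k by (simp add: powr_mult kq)
      finally show ?thesis by (simp add: add_increasing2)
    next
      case False
      then have "\<bar>a\<bar> \<le> \<bar>b\<bar> / \<kappa>" using k by (simp add: field_simps)
      then have "\<bar>a + b\<bar> powr q \<le> ((1 / \<kappa> + 1) * \<bar>b\<bar>) powr q"
        using assms abs_triangle_ineq[of a b] by (intro powr_mono2) (auto simp: algebra_simps)
      also have "\<dots> = (1 / \<kappa> + 1) powr q * \<bar>b\<bar> powr q" using k by (simp add: powr_mult)
      finally show ?thesis using assms by (simp add: add_increasing)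
    qed
  qed
qed

section \<open>Translations, dilations and radial powers\<close>

lemma nn_integral_shift:
  fixes f :: "'a::euclidean_space \<Rightarrow> ennreal"
  assumes [measurable]: "f \<in> borel_measurable borel"
  shows "(\<integral>\<^sup>+x. f (x + h) \<partial>lborel) = (\<integral>\<^sup>+x. f x \<partial>lborel)"
proof -
  have "(\<integral>\<^sup>+x. f x \<partial>lborel) = (\<integral>\<^sup>+x. f x \<partial>distr lborel borel ((+) h))"
    by (simp add: lborel_distr_plus)
  also have "\<dots> = (\<integral>\<^sup>+x. f (x + h) \<partial>lborel)"
    by (subst nn_integral_distr) (auto simp: add.commute)
  finally show ?thesis ..
qed

lemma nn_integral_affine:
  fixes f :: "'a::euclidean_space \<Rightarrow> ennreal"
  assumes [measurable]: "f \<in> borel_measurable borel" and c: "0 < c"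
  shows "(\<integral>\<^sup>+x. f x \<partial>lborel) = ennreal (c ^ DIM('a)) * (\<integral>\<^sup>+x. f (t + c *\<^sub>R x) \<partial>lborel)"
  by (subst lborel_affine[of c t])
     (use c in \<open>auto simp: nn_integral_density nn_integral_distr nn_integral_cmult\<close>)

lemma integral_shift:
  fixes f :: "'a::euclidean_space \<Rightarrow> real"
  assumes "integrable lborel f"
  shows "integrable lborel (\<lambda>x. f (x + h))" "(\<integral>x. f (x + h) \<partial>lborel) = (\<integral>x. f x \<partial>lborel)"
proof -
  have [measurable]: "f \<in> borel_measurable borel" using borel_measurable_integrable[OF assms] by simp
  have "integrable (distr lborel borel ((+) h)) f" using assms by (simp add: lborel_distr_plus)
  then show "integrable lborel (\<lambda>x. f (x + h))"
    by (subst (asm) integrable_distr_eq) (auto simp: add.commute)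
  have "(\<integral>x. f x \<partial>lborel) = (\<integral>x. f x \<partial>distr lborel borel ((+) h))" by (simp add: lborel_distr_plus)
  also have "\<dots> = (\<integral>x. f (x + h) \<partial>lborel)" by (subst integral_distr) (auto simp: add.commute)
  finally show "(\<integral>x. f (x + h) \<partial>lborel) = (\<integral>x. f x \<partial>lborel)" ..
qed

lemma nn_integral_pair:
  fixes f :: "'a::euclidean_space \<times> 'b::euclidean_space \<Rightarrow> ennreal"
  assumes "f \<in> borel_measurable borel"
  shows "(\<integral>\<^sup>+z. f z \<partial>lborel) = (\<integral>\<^sup>+x. \<integral>\<^sup>+y. f (x, y) \<partial>lborel \<partial>lborel)"
    and "(\<integral>\<^sup>+z. f z \<partial>lborel) = (\<integral>\<^sup>+y. \<integral>\<^sup>+x. f (x, y) \<partial>lborel \<partial>lborel)"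
proof -
  have f: "f \<in> borel_measurable (lborel \<Otimes>\<^sub>M lborel)"
    using assms by (simp add: lborel_prod)
  show "(\<integral>\<^sup>+z. f z \<partial>lborel) = (\<integral>\<^sup>+x. \<integral>\<^sup>+y. f (x, y) \<partial>lborel \<partial>lborel)"
    using lborel.nn_integral_fst[OF f] by (simp add: lborel_prod)
  show "(\<integral>\<^sup>+z. f z \<partial>lborel) = (\<integral>\<^sup>+y. \<integral>\<^sup>+x. f (x, y) \<partial>lborel \<partial>lborel)"
    using lborel_pair.nn_integral_snd[OF f] by (simp add: lborel_prod)
qed

text \<open>
  The coordinates \<open>(x, z)\<close> with \<open>y = x + z\<close> turn double integrals of difference quotients into
  integrals over \<open>z\<close> of the size of \<open>u (x + z) - u x\<close>.
\<close>

lemma nn_integral_pair_diff: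
  fixes f :: "'a::euclidean_space \<times> 'a \<Rightarrow> ennreal"
  assumes [measurable]: "f \<in> borel_measurable borel"
  shows "(\<integral>\<^sup>+z. f z \<partial>lborel) = (\<integral>\<^sup>+z. \<integral>\<^sup>+x. f (x, x + z) \<partial>lborel \<partial>lborel)"
proof -
  have [measurable]: "(\<lambda>y. f (x, y)) \<in> borel_measurable borel" for x
    by (rule measurable_compose[OF _ assms]) (auto simp: borel_prod[symmetric])
  have m: "(\<lambda>z. f (fst z, fst z + snd z)) \<in> borel_measurable (borel :: ('a \<times> 'a) measure)"
    by (rule measurable_compose[OF _ assms]) (auto simp: borel_prod[symmetric])
  have "(\<integral>\<^sup>+z. f z \<partial>lborel) = (\<integral>\<^sup>+x. \<integral>\<^sup>+y. f (x, y) \<partial>lborel \<partial>lborel)"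
    by (rule nn_integral_pair) fact
  also have "\<dots> = (\<integral>\<^sup>+x. \<integral>\<^sup>+z. f (x, z + x) \<partial>lborel \<partial>lborel)"
    by (subst nn_integral_shift) auto
  also have "\<dots> = (\<integral>\<^sup>+z. f (fst z, fst z + snd z) \<partial>lborel)"
    using nn_integral_pair(1)[OF m] by (simp add: add.commute)
  also have "\<dots> = (\<integral>\<^sup>+z. \<integral>\<^sup>+x. f (x, x + z) \<partial>lborel \<partial>lborel)"
    using nn_integral_pair(2)[OF m] by simp
  finally show ?thesis .
qed

lemma emeasure_ball_dim:
  fixes c :: "real^'n"
  assumes "0 \<le> r"
  shows "emeasure lborel (ball c r) = ennreal (unit_ball_vol CARD('n) * r powr CARD('n))"
  using emeasure_ball[OF assms, of c] assms by (simp add: powr_realpow')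

lemma dyadic_shell:
  fixes t :: real
  assumes "0 < t" "t \<le> 1"
  obtains k where "t \<le> 2 powr (- real k)" "2 powr (- real k) < 2 * t"
proof
  define k where "k = nat \<lfloor>- log 2 t\<rfloor>"
  have "0 \<le> - log 2 t" using assms by simp
  then have k: "real k \<le> - log 2 t" "- log 2 t < real k + 1" unfolding k_def by linarith+
  have t: "t = 2 powr (log 2 t)" using assms by simp
  show "t \<le> 2 powr (- real k)" by (subst t) (use k in simp)
  have "2 powr (- real k) < 2 powr (log 2 t + 1)" using k by (simp add: )
  also have "\<dots> = 2 * t" using assms by (simp add: powr_add)
  finally show "2 powr (- real k) < 2 * t" .
qed

text \<open>
  Shell by shell: on the part of \<open>A\<close> belonging to \<open>k\<close> the integral is at most \<open>b k\<close> times the volume of a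
  ball of radius \<open>\<rho> k\<close>.
\<close>

lemma nn_integral_shells:
  fixes f :: "real^'n \<Rightarrow> real" and b \<rho> :: "nat \<Rightarrow> real"
  assumes "\<And>z. z \<in> A \<Longrightarrow> f z \<noteq> 0 \<Longrightarrow> \<exists>k. f z \<le> b k \<and> norm z < \<rho> k"
    and b0: "\<And>k. 0 \<le> b k" and r0: "\<And>k. 0 \<le> \<rho> k"
    and sm: "summable (\<lambda>k. b k * \<rho> k powr CARD('n))"
  shows "(\<integral>\<^sup>+z\<in>A. ennreal (f z) \<partial>lborel) < \<infinity>"
proof -
  define V where "V = unit_ball_vol CARD('n)"
  have V0: "0 \<le> V" by (simp add: V_def)
  let ?f = "\<lambda>k (z::real^'n). ennreal (b k) * indicator (ball 0 (\<rho> k)) z"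
  have [measurable]: "ball (0::real^'n) (\<rho> k) \<in> sets borel" for k by simp
  have one: "g k \<le> (\<Sum>k. g k)" for g :: "nat \<Rightarrow> ennreal" and k
    using sum_le_suminf[of g "{k}"] by simp
  have le: "ennreal (f z) * indicator A z \<le> (\<Sum>k. ?f k z)" for z
  proof (cases "z \<in> A \<and> f z \<noteq> 0")
    case True
    then obtain k where k: "f z \<le> b k" "norm z < \<rho> k" using assms by blast
    then have "ennreal (f z) * indicator A z \<le> ?f k z" by (auto simp: indicator_def ennreal_leI)
    also have "\<dots> \<le> (\<Sum>k. ?f k z)" by (rule one)
    finally show ?thesis .
  qed (auto simp: indicator_def)
  have "(\<integral>\<^sup>+z\<in>A. ennreal (f z) \<partial>lborel) \<le> (\<integral>\<^sup>+z. (\<Sum>k. ?f k z) \<partial>lborel)"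
    by (rule nn_integral_mono) (rule le)
  also have "\<dots> = (\<Sum>k. \<integral>\<^sup>+z. ?f k z \<partial>lborel)" by (rule nn_integral_suminf) measurable
  also have "\<dots> = (\<Sum>k. ennreal (V * (b k * \<rho> k powr CARD('n))))"
  proof (rule suminf_cong)
    fix k
    have "(\<integral>\<^sup>+z. ?f k z \<partial>lborel) = ennreal (b k) * emeasure lborel (ball (0::real^'n) (\<rho> k))"
      by (rule nn_integral_cmult_indicator) simp
    also have "\<dots> = ennreal (b k) * ennreal (V * \<rho> k powr CARD('n))"
      by (simp only: emeasure_ball_dim[OF r0] V_def)
    also have "\<dots> = ennreal (b k * (V * \<rho> k powr CARD('n)))" using b0 by (simp only: ennreal_mult')
    finally show "(\<integral>\<^sup>+z. ?f k z \<partial>lborel) = ennreal (V * (b k * \<rho> k powr CARD('n)))" by (simp only: mult_ac)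
  qed
  also have "\<dots> < \<infinity>"
    unfolding infinity_ennreal_def less_top[symmetric]
    by (rule ennreal_suminf_neq_top[OF summable_mult[OF sm]]) (use b0 V0 in simp)
  finally show ?thesis .
qed

lemma summable_two_powr_neg:
  fixes \<epsilon> C :: real
  assumes "0 < \<epsilon>"
  shows "summable (\<lambda>k::nat. C * 2 powr (- real k * \<epsilon>))"
proof -
  have "summable (\<lambda>k::nat. C * (2 powr (- \<epsilon>)) ^ k)"
    using assms by (intro summable_mult summable_geometric) (simp add: powr_less_one)
  moreover have "(2 powr (- \<epsilon>)) ^ k = (2::real) powr (- real k * \<epsilon>)" for k :: nat
    by (simp add: powr_powr[symmetric] powr_realpow[symmetric] powr_powr mult.commute)
  ultimately show ?thesis by simp
qed

text \<open>
  On the shell \<open>\<bar>z\<bar> \<approx> 2\<^sup>-\<^sup>k\<close> the integrand is comparable to \<open>2\<^sup>-\<^sup>k\<^sup>(\<^sup>\<epsilon>\<^sup>-\<^sup>N\<^sup>)\<close> and the volume to \<open>2\<^sup>-\<^sup>k\<^sup>N\<close>.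
\<close>

lemma nn_integral_norm_powr_ball:
  fixes \<epsilon> :: real
  assumes e: "0 < \<epsilon>"
  shows "(\<integral>\<^sup>+z\<in>ball (0::real^'n) 1. ennreal (norm z powr (\<epsilon> - CARD('n))) \<partial>lborel) < \<infinity>"
proof -
  define N where "N = real CARD('n)"
  define c where "c = (2::real) powr \<bar>\<epsilon> - N\<bar>"
  define b where "b k = c * 2 powr (- real k * (\<epsilon> - N))" for k :: nat
  have bb: "b k * (2 * 2 powr (- real k)) powr N = (c * 2 powr N) * 2 powr (- real k * \<epsilon>)" for k
    by (simp add: b_def powr_mult powr_powr powr_add[symmetric] algebra_simps)
  show ?thesis unfolding N_def[symmetric]
  proof (rule nn_integral_shells[where b=b and \<rho>="\<lambda>k. 2 * 2 powr (- real k)"])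
    fix z :: "real^'n" assume "z \<in> ball 0 1" "norm z powr (\<epsilon> - N) \<noteq> 0"
    then have z: "0 < norm z" "norm z \<le> 1" by auto
    obtain k where k: "norm z \<le> 2 powr (- real k)" "2 powr (- real k) < 2 * norm z"
      by (rule dyadic_shell[OF z])
    define y where "y = (2::real) powr (- real k)"
    have y: "0 < y" by (simp add: y_def)
    have q: "norm z / y \<le> 1" "1/2 \<le> norm z / y" using k y by (auto simp: y_def[symmetric] divide_simps)
    have "(norm z / y) powr (\<epsilon> - N) \<le> c"
    proof (cases "0 \<le> \<epsilon> - N")
      case True
      have "(norm z / y) powr (\<epsilon> - N) \<le> 1 powr (\<epsilon> - N)" using q y True by (intro powr_mono2) auto
      also have "\<dots> \<le> c" by (simp add: c_def ge_one_powr_ge_zero)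
      finally show ?thesis .
    next
      case False
      have "(norm z / y) powr (\<epsilon> - N) \<le> (1/2) powr (\<epsilon> - N)" using q y False by (intro powr_mono2') auto
      also have "\<dots> = c" using False by (simp add: c_def powr_divide powr_minus_divide[symmetric])
      finally show ?thesis .
    qed
    then have "norm z powr (\<epsilon> - N) \<le> c * y powr (\<epsilon> - N)"
      using z y by (simp add: powr_divide divide_le_eq)
    then have "norm z powr (\<epsilon> - N) \<le> b k" by (simp add: b_def y_def powr_powr)
    moreover have "norm z < 2 * y" using k y by (simp add: y_def)
    ultimately show "\<exists>k. norm z powr (\<epsilon> - N) \<le> b k \<and> norm z < 2 * 2 powr (- real k)"
      unfolding y_def by blast
  next
    show "0 \<le> b k" "0 \<le> 2 * 2 powr (- real k)" for k by (simp_all add: b_def c_def)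
    show "summable (\<lambda>k. b k * (2 * 2 powr (- real k)) powr real CARD('n))"
      unfolding N_def[symmetric] bb by (rule summable_two_powr_neg[OF e])
  qed
qed

lemma nn_integral_norm_powr_outside_ball:
  fixes \<epsilon> :: real
  assumes e: "0 < \<epsilon>"
  shows "(\<integral>\<^sup>+z\<in>- ball (0::real^'n) 1. ennreal (norm z powr (- (CARD('n) + \<epsilon>))) \<partial>lborel) < \<infinity>"
proof -
  define N where "N = real CARD('n)"
  have N: "0 \<le> N" by (simp add: N_def)
  define b where "b k = (2::real) powr (real k * (- (N + \<epsilon>)))" for k :: nat
  have bb: "b k * (2 * 2 powr real k) powr N = 2 powr N * 2 powr (- real k * \<epsilon>)" for k
    by (simp add: b_def powr_mult powr_powr powr_add[symmetric] algebra_simps)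
  show ?thesis unfolding N_def[symmetric]
  proof (rule nn_integral_shells[where b=b and \<rho>="\<lambda>k. 2 * 2 powr (real k)"])
    fix z :: "real^'n" assume "z \<in> - ball 0 1"
    then have "1 \<le> norm z" by auto
    then have z: "0 < 1 / norm z" "1 / norm z \<le> 1" "0 < norm z" by (auto simp: divide_simps)
    obtain k where k: "1 / norm z \<le> 2 powr (- real k)" "2 powr (- real k) < 2 * (1 / norm z)"
      by (rule dyadic_shell[OF z(1,2)])
    have k': "2 powr real k \<le> norm z" "norm z < 2 * 2 powr real k"
      using k z by (auto simp: powr_minus divide_simps)
    have "norm z powr (- (N + \<epsilon>)) \<le> (2 powr real k) powr (- (N + \<epsilon>))"
      using k' e N by (intro powr_mono2') auto
    then show "\<exists>k. norm z powr (- (N + \<epsilon>)) \<le> b k \<and> norm z < 2 * 2 powr (real k)"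
      using k' by (auto simp: b_def powr_powr)
  next
    show "0 \<le> b k" "0 \<le> 2 * 2 powr real k" for k by (simp_all add: b_def)
    show "summable (\<lambda>k. b k * (2 * 2 powr real k) powr real CARD('n))"
      unfolding N_def[symmetric] bb by (rule summable_two_powr_neg[OF e])
  qed
qed

section \<open>The kernel, its splitting, and normalized solutions\<close>

lemma fst_borel [measurable]: "fst \<in> borel_measurable (borel :: ('a::euclidean_space \<times> 'b::euclidean_space) measure)"
  by (intro borel_measurable_continuous_onI continuous_intros)

lemma snd_borel [measurable]: "snd \<in> borel_measurable (borel :: ('a::euclidean_space \<times> 'b::euclidean_space) measure)"
  by (intro borel_measurable_continuous_onI continuous_intros)

lemma ball_borel [measurable]:
  fixes c :: "'a::euclidean_space"
  shows "ball c r \<in> sets borel" "- ball c r \<in> sets borel"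
  by auto

text \<open>
  The value at the origin is \<open>0\<close>, since \<open>0 powr a = 0\<close>. In the double integrals this concerns only the
  diagonal, where the difference of the test function vanishes as well.
\<close>

definition kern :: "real \<Rightarrow> real \<Rightarrow> real^'n \<Rightarrow> real" where
  "kern s p z = norm z powr (- (real CARD('n) + s * p))"

text \<open>
  The kernel truncated from above at height \<open>\<rho>\<^sup>-\<^sup>N\<^sup>-\<^sup>s\<^sup>p\<close>. Truncating the height rather than cutting off the
  ball of radius \<open>\<rho>\<close> keeps this part Lipschitz, which is what makes its increments small.
\<close>

definition far_kern :: "real \<Rightarrow> real \<Rightarrow> real \<Rightarrow> real^'n \<Rightarrow> real" where
  "far_kern s p \<rho> z = max (norm z) \<rho> powr (- (real CARD('n) + s * p))"

text \<open>
  The remaining singular part, supported in the ball of radius \<open>\<rho>\<close>. The maximum matters only at the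
  origin, where the full kernel is \<open>0\<close>.
\<close>

definition near_kern :: "real \<Rightarrow> real \<Rightarrow> real \<Rightarrow> real^'n \<Rightarrow> real" where
  "near_kern s p \<rho> z = max 0 (kern s p z - far_kern s p \<rho> z)"

definition gagliardo :: "real \<Rightarrow> real \<Rightarrow> (real^'n) set \<Rightarrow> (real^'n \<Rightarrow> real) \<Rightarrow> ennreal" where
  "gagliardo s p A u =
     (\<integral>\<^sup>+z\<in>A \<times> A. ennreal (\<bar>u (fst z) - u (snd z)\<bar> powr p * kern s p (fst z - snd z)) \<partial>lborel)"

text \<open>
  Finiteness of the seminorm is required only on a ball slightly larger than the support:
  pairs of points with one point in the support and the other outside that ball have a distance bounded
  from below.
\<close>

definition admissible :: "real \<Rightarrow> real \<Rightarrow> (real^'n \<Rightarrow> real) \<Rightarrow> bool" where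
  "admissible s p \<phi> \<longleftrightarrow> \<phi> \<in> borel_measurable borel \<and> (\<exists>B. \<forall>x. \<bar>\<phi> x\<bar> \<le> B) \<and>
     (\<exists>t t'. 0 < t \<and> t < t' \<and> t' < 1 \<and> (\<forall>x. t < norm x \<longrightarrow> \<phi> x = 0) \<and> gagliardo s p (ball 0 t') \<phi> < \<infinity>)"

definition weak_integrand :: "real \<Rightarrow> (real^'n \<Rightarrow> real) \<Rightarrow> (real^'n \<Rightarrow> real) \<Rightarrow> (real^'n \<Rightarrow> real) \<Rightarrow> (real^'n) \<times> (real^'n) \<Rightarrow> real" where
  "weak_integrand p k u \<phi> z =
     spow (p - 1) (u (fst z) - u (snd z)) * (\<phi> (fst z) - \<phi> (snd z)) * k (fst z - snd z)"

text \<open>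
  Solutions in the unit ball with all quantities on the right-hand side of the estimate normalized
  to \<open>1\<close>. Borel measurability and pointwise bounds are requested instead of their Lebesgue and
  almost-everywhere versions, so that translations and product measurability cause no
  trouble.
\<close>

definition normalized :: "real \<Rightarrow> real \<Rightarrow> (real^'n \<Rightarrow> real) \<Rightarrow> bool" where
  "normalized s p u \<longleftrightarrow> u \<in> borel_measurable borel \<and> (\<forall>x\<in>ball 0 1. \<bar>u x\<bar> \<le> 1) \<and>
     gagliardo s p (ball 0 1) u \<le> 1 \<and>
     (\<integral>\<^sup>+y\<in>- ball 0 1. ennreal (\<bar>u y\<bar> powr (p - 1) * kern s p y) \<partial>lborel) \<le> 1 \<and>
     (\<forall>\<phi>. admissible s p \<phi> \<longrightarrow> has_bochner_integral lborel (weak_integrand p (kern s p) u \<phi>) 0)"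

lemma kern_borel [measurable]: "kern s p \<in> borel_measurable borel"
  unfolding kern_def[abs_def] by measurable

lemma far_kern_borel [measurable]: "far_kern s p \<rho> \<in> borel_measurable borel"
  unfolding far_kern_def[abs_def] by measurable

lemma near_kern_borel [measurable]: "near_kern s p \<rho> \<in> borel_measurable borel"
  unfolding near_kern_def[abs_def] by measurable

lemma weak_integrand_borel [measurable]:
  assumes [measurable]: "k \<in> borel_measurable borel" "u \<in> borel_measurable borel" "\<phi> \<in> borel_measurable borel"
  shows "weak_integrand p k u \<phi> \<in> borel_measurable borel"
  unfolding weak_integrand_def[abs_def] by measurable

lemma kern_nonneg [simp]: "0 \<le> kern s p z" by (simp add: kern_def)
lemma far_kern_nonneg [simp]: "0 \<le> far_kern s p \<rho> z" by (simp add: far_kern_def)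
lemma near_kern_nonneg [simp]: "0 \<le> near_kern s p \<rho> z" by (simp add: near_kern_def)
lemma kern_minus [simp]: "kern s p (- z) = kern s p z" by (simp add: kern_def)
lemma far_kern_minus [simp]: "far_kern s p \<rho> (- z) = far_kern s p \<rho> z" by (simp add: far_kern_def)
lemma near_kern_minus [simp]: "near_kern s p \<rho> (- z) = near_kern s p \<rho> z" by (simp add: near_kern_def)

lemma far_kern_le_kern:
  assumes "0 < s * p" "z \<noteq> 0" shows "far_kern s p \<rho> z \<le> kern s p z"
  unfolding far_kern_def kern_def using assms by (intro powr_mono2') auto

lemma near_plus_far:
  assumes "0 < s * p" "z \<noteq> 0" shows "near_kern s p \<rho> z + far_kern s p \<rho> z = kern s p z"
  using far_kern_le_kern[OF assms, of \<rho>] by (simp add: near_kern_def)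

lemma near_kern_le_kern: "near_kern s p \<rho> z \<le> kern s p z"
  by (simp add: near_kern_def)

lemma near_kern_eq_0:
  assumes "\<rho> \<le> norm z" shows "near_kern s p \<rho> z = 0"
  using assms by (simp add: near_kern_def far_kern_def kern_def max_def)

lemma near_kern_ge_half_kern:
  fixes z :: "real^'n"
  assumes "0 < s * p" "norm z \<le> \<rho> / 2"
  shows "kern s p z / 2 \<le> near_kern s p \<rho> z"
proof (cases "z = 0")
  case True then show ?thesis by (simp add: kern_def)
next
  case False
  define m where "m = real CARD('n) + s * p"
  have m: "1 \<le> m" using assms by (simp add: m_def add_increasing2 Suc_leI)
  have "far_kern s p \<rho> z \<le> (2 * norm z) powr (- m)"
    unfolding far_kern_def m_def[symmetric] using assms m False by (intro powr_mono2') auto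
  also have "\<dots> = 2 powr (- m) * norm z powr (- m)" by (simp add: powr_mult)
  also have "\<dots> \<le> 1 / 2 * norm z powr (- m)"
    using powr_mono[of "- m" "-1" "2::real"] m by (intro mult_right_mono) (auto simp: powr_minus)
  finally have "far_kern s p \<rho> z \<le> 1 / 2 * norm z powr (- m)" .
  then have "norm z powr (- m) / 2 \<le> norm z powr (- m) - far_kern s p \<rho> z" by linarith
  then show ?thesis unfolding near_kern_def kern_def m_def[symmetric] by (rule max.coboundedI2)
qed

text \<open>
  The truncated kernel is a negative power of \<open>max \<bar>z\<bar> \<rho>\<close>, which is \<open>1\<close>-Lipschitz in \<open>z\<close> and changes at
  most by the factor \<open>2\<close> under shifts of length at most \<open>\<rho> / 2\<close>.
\<close>

lemma far_kern_shift:
  fixes z h :: "real^'n"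
  assumes sp: "0 < s * p" and \<rho>: "0 < \<rho>" and h: "norm h \<le> \<rho> / 2"
  defines "m \<equiv> real CARD('n) + s * p"
  shows "far_kern s p \<rho> (z + h) \<le> 2 powr m * far_kern s p \<rho> z"
    and "\<bar>far_kern s p \<rho> (z + h) - far_kern s p \<rho> z\<bar> \<le> m * 2 powr m / \<rho> * norm h * far_kern s p \<rho> z"
proof -
  have m: "0 < m" using sp by (simp add: m_def add_nonneg_pos)
  define a where "a = max (norm z) \<rho>"
  define b where "b = max (norm (z + h)) \<rho>"
  have far: "far_kern s p \<rho> z = a powr (- m)" "far_kern s p \<rho> (z + h) = b powr (- m)"
    by (auto simp: far_kern_def a_def b_def m_def)
  have ab: "\<rho> \<le> a" "\<rho> \<le> b" "0 < a" "0 < b" using \<rho> by (auto simp: a_def b_def)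
  have "norm (z + h) \<le> norm z + norm h" "norm z \<le> norm (z + h) + norm h"
    using norm_triangle_ineq[of z h] norm_triangle_ineq4[of "z + h" h] by auto
  then have d: "\<bar>a - b\<bar> \<le> norm h" unfolding a_def b_def by linarith
  define c where "c = min a b"
  have c: "0 < c" "\<rho> \<le> c" "a / 2 \<le> c" using ab d h by (auto simp: c_def)
  have cm: "c powr (- m) \<le> 2 powr m * a powr (- m)"
  proof -
    have "c powr (- m) \<le> (a / 2) powr (- m)" using c ab m by (intro powr_mono2') auto
    also have "\<dots> = 2 powr m * a powr (- m)" using ab by (simp add: powr_divide powr_minus field_simps)
    finally show ?thesis .
  qed
  show "far_kern s p \<rho> (z + h) \<le> 2 powr m * far_kern s p \<rho> z"
  proof -
    have "b powr (- m) \<le> c powr (- m)" using c ab m by (intro powr_mono2') (auto simp: c_def)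
    with cm show ?thesis by (simp add: far)
  qed
  have mvt: "\<bar>x powr (- m) - y powr (- m)\<bar> \<le> m * x powr (- m) / x * (y - x)" if "0 < x" "x \<le> y" for x y :: real
  proof (cases "x = y")
    case False
    then have xy: "x < y" using that by simp
    have "\<exists>t. x < t \<and> t < y \<and> y powr (- m) - x powr (- m) = (y - x) * (- m * t powr (- m - 1))"
      by (rule MVT2[OF xy]) (use that in \<open>auto intro!: derivative_eq_intros\<close>)
    then obtain t where t: "x < t" "t < y" "y powr (- m) - x powr (- m) = (y - x) * (- m * t powr (- m - 1))" by blast
    have "\<bar>x powr (- m) - y powr (- m)\<bar> = (y - x) * (m * t powr (- m - 1))"
      using t xy m by (simp add: abs_minus_commute[of "x powr (- m)"] abs_mult)
    also have "\<dots> \<le> (y - x) * (m * x powr (- m - 1))"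
      using t that m xy by (intro mult_left_mono powr_mono2') auto
    also have "\<dots> = m * x powr (- m) / x * (y - x)" using that by (simp add: powr_diff)
    finally show ?thesis .
  qed simp
  have "\<bar>a powr (- m) - b powr (- m)\<bar> \<le> m * c powr (- m) / c * \<bar>a - b\<bar>"
    using mvt[of a b] mvt[of b a] ab by (cases "a \<le> b") (auto simp: c_def min_def abs_minus_commute)
  also have "\<dots> \<le> m * (2 powr m * a powr (- m)) / \<rho> * norm h"
    using d c cm m \<rho> by (intro mult_mono frac_le) auto
  finally show "\<bar>far_kern s p \<rho> (z + h) - far_kern s p \<rho> z\<bar> \<le> m * 2 powr m / \<rho> * norm h * far_kern s p \<rho> z"
    by (simp add: far abs_minus_commute mult_ac)
qed

lemma normalizedD:
  assumes "normalized s p u"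
  shows "u \<in> borel_measurable borel" "norm x < 1 \<Longrightarrow> \<bar>u x\<bar> \<le> 1" "gagliardo s p (ball 0 1) u \<le> 1"
    "(\<integral>\<^sup>+y\<in>- ball 0 1. ennreal (\<bar>u y\<bar> powr (p - 1) * kern s p y) \<partial>lborel) \<le> 1"
    "admissible s p \<phi> \<Longrightarrow> has_bochner_integral lborel (weak_integrand p (kern s p) u \<phi>) 0"
  using assms by (auto simp: normalized_def)

text \<open>
  For \<open>\<bar>x\<bar> \<le> 1 - \<rho>\<close> and \<open>y\<close> outside the unit ball \<open>\<bar>x - y\<bar> \<ge> \<rho> \<bar>y\<bar>\<close>, so there the integral is controlled by
  the tail of \<open>u\<close>; inside the unit ball both factors are bounded.
\<close>

lemma far_tail_bound:
  fixes s p \<rho> :: real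
  assumes sp: "0 < s * p" and p: "2 < p" and \<rho>: "0 < \<rho>" "\<rho> < 1"
  obtains C where "0 < C"
    "\<And>(u :: real^'n \<Rightarrow> real) x. normalized s p u \<Longrightarrow> norm x \<le> 1 - \<rho> \<Longrightarrow>
       (\<integral>\<^sup>+y. ennreal ((1 + \<bar>u y\<bar>) powr (p - 1) * far_kern s p \<rho> (x - y)) \<partial>lborel) \<le> ennreal C"
proof -
  define N where "N = real CARD('n)"
  define m where "m = N + s * p"
  have m: "0 < m" using sp by (simp add: m_def N_def add_nonneg_pos)
  define I where "I = (\<integral>\<^sup>+y\<in>- ball (0::real^'n) 1. ennreal (kern s p y) \<partial>lborel)"
  have I: "I < \<infinity>" unfolding I_def kern_def using nn_integral_norm_powr_outside_ball[OF sp, where 'n='n] .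
  define V where "V = emeasure lborel (ball (0::real^'n) 1)"
  have V: "V < \<infinity>" unfolding V_def by (simp add: emeasure_ball_dim)
  define K where "K = ennreal (2 powr (p - 1) * \<rho> powr (- m)) * V + ennreal (2 powr (p - 1) * \<rho> powr (- m)) * (I + 1)"
  have K: "K < \<infinity>" using I V by (auto simp: K_def ennreal_mult_less_top)
  have main: "(\<integral>\<^sup>+y. ennreal ((1 + \<bar>u y\<bar>) powr (p - 1) * far_kern s p \<rho> (x - y)) \<partial>lborel) \<le> K"
    if u: "normalized s p u" and x: "norm x \<le> 1 - \<rho>" for u :: "real^'n \<Rightarrow> real" and x
  proof -
    note [measurable] = normalizedD(1)[OF u]
    let ?c = "2 powr (p - 1) * \<rho> powr (- m)"
    have pt: "ennreal ((1 + \<bar>u y\<bar>) powr (p - 1) * far_kern s p \<rho> (x - y))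
      \<le> ennreal ?c * indicator (ball 0 1) y +
         ennreal ?c * (ennreal (kern s p y) * indicator (- ball 0 1) y
             + ennreal (\<bar>u y\<bar> powr (p - 1) * kern s p y) * indicator (- ball 0 1) y)" for y
    proof (cases "y \<in> ball 0 1")
      case True
      then have "\<bar>u y\<bar> \<le> 1" using normalizedD(2)[OF u] by auto
      then have "(1 + \<bar>u y\<bar>) powr (p - 1) \<le> 2 powr (p - 1)" using p by (intro powr_mono2) auto
      moreover have "far_kern s p \<rho> (x - y) \<le> \<rho> powr (- m)"
        unfolding far_kern_def m_def[symmetric] N_def[symmetric] using m \<rho> by (intro powr_mono2') auto
      ultimately show ?thesis using True by (auto intro!: ennreal_leI mult_mono)
    next
      case False
      then have y: "1 \<le> norm y" by auto
      have \<rho>y: "0 < \<rho> * norm y" using \<rho> y by (intro mult_pos_pos) linarith+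
      have "\<rho> * norm y \<le> norm y - (1 - \<rho>)" using mult_left_mono[OF y, of "1 - \<rho>"] \<rho> by (simp add: algebra_simps)
      also have "\<dots> \<le> norm (x - y)" using x norm_triangle_ineq2[of y x] by (simp add: norm_minus_commute)
      also have "\<dots> \<le> max (norm (x - y)) \<rho>" by simp
      finally have "far_kern s p \<rho> (x - y) \<le> (\<rho> * norm y) powr (- m)"
        unfolding far_kern_def m_def[symmetric] N_def[symmetric] using m \<rho>y by (intro powr_mono2') auto
      also have "\<dots> = \<rho> powr (- m) * kern s p y"
        using \<rho> by (simp add: powr_mult kern_def m_def N_def)
      finally have far: "far_kern s p \<rho> (x - y) \<le> \<rho> powr (- m) * kern s p y" .
      have "(1 + \<bar>u y\<bar>) powr (p - 1) \<le> 2 powr (p - 1) * (1 + \<bar>u y\<bar> powr (p - 1))"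
        using powr_add_le[of "p - 1" 1 "\<bar>u y\<bar>"] p by simp
      then have "(1 + \<bar>u y\<bar>) powr (p - 1) * far_kern s p \<rho> (x - y)
          \<le> (2 powr (p - 1) * (1 + \<bar>u y\<bar> powr (p - 1))) * (\<rho> powr (- m) * kern s p y)"
        using far by (intro mult_mono) auto
      also have "\<dots> = ?c * (kern s p y + \<bar>u y\<bar> powr (p - 1) * kern s p y)" by (simp add: algebra_simps)
      finally show ?thesis using False y
        by (simp add: ennreal_leI ennreal_mult[symmetric] flip: ennreal_plus)
    qed
    have "(\<integral>\<^sup>+y. ennreal ((1 + \<bar>u y\<bar>) powr (p - 1) * far_kern s p \<rho> (x - y)) \<partial>lborel)
      \<le> (\<integral>\<^sup>+y. ennreal ?c * indicator (ball 0 1) y +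
         ennreal ?c * (ennreal (kern s p y) * indicator (- ball 0 1) y
             + ennreal (\<bar>u y\<bar> powr (p - 1) * kern s p y) * indicator (- ball 0 1) y) \<partial>lborel)"
      by (rule nn_integral_mono) (rule pt)
    also have "\<dots> = (\<integral>\<^sup>+y. ennreal ?c * indicator (ball (0::real^'n) 1) y \<partial>lborel) +
         (\<integral>\<^sup>+y. ennreal ?c * (ennreal (kern s p y) * indicator (- ball 0 1) y
             + ennreal (\<bar>u y\<bar> powr (p - 1) * kern s p y) * indicator (- ball 0 1) y) \<partial>lborel)"
      by (rule nn_integral_add) measurable
    also have "(\<integral>\<^sup>+y. ennreal ?c * indicator (ball (0::real^'n) 1) y \<partial>lborel) = ennreal ?c * V"
      unfolding V_def by (rule nn_integral_cmult_indicator) simp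
    also have "(\<integral>\<^sup>+y. ennreal ?c * (ennreal (kern s p y) * indicator (- ball 0 1) y
             + ennreal (\<bar>u y\<bar> powr (p - 1) * kern s p y) * indicator (- ball 0 1) y) \<partial>lborel)
         = ennreal ?c * (\<integral>\<^sup>+y. ennreal (kern s p y) * indicator (- ball 0 1) y
             + ennreal (\<bar>u y\<bar> powr (p - 1) * kern s p y) * indicator (- ball 0 1) y \<partial>lborel)"
      by (rule nn_integral_cmult) measurable
    also have "(\<integral>\<^sup>+y. ennreal (kern s p y) * indicator (- ball 0 1) y
             + ennreal (\<bar>u y\<bar> powr (p - 1) * kern s p y) * indicator (- ball 0 1) y \<partial>lborel)
        = I + (\<integral>\<^sup>+y\<in>- ball 0 1. ennreal (\<bar>u y\<bar> powr (p - 1) * kern s p y) \<partial>lborel)"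
      unfolding I_def by (rule nn_integral_add) measurable
    also have "ennreal ?c * V + ennreal ?c * (I + (\<integral>\<^sup>+y\<in>- ball 0 1. ennreal (\<bar>u y\<bar> powr (p - 1) * kern s p y) \<partial>lborel)) \<le> K" unfolding K_def
      using normalizedD(4)[OF u] by (intro add_mono mult_left_mono) auto
    finally show ?thesis .
  qed
  show thesis
  proof (rule that[of "enn2real K + 1"])
    show "0 < enn2real K + 1" by (simp add: add_nonneg_pos)
    fix u :: "real^'n \<Rightarrow> real" and x :: "real^'n" assume "normalized s p u" "norm x \<le> 1 - \<rho>"
    then have "(\<integral>\<^sup>+y. ennreal ((1 + \<bar>u y\<bar>) powr (p - 1) * far_kern s p \<rho> (x - y)) \<partial>lborel) \<le> K" by (rule main)
    also have "\<dots> = ennreal (enn2real K)" using K by simp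
    also have "\<dots> \<le> ennreal (enn2real K + 1)" by (intro ennreal_leI) simp
    finally show "(\<integral>\<^sup>+y. ennreal ((1 + \<bar>u y\<bar>) powr (p - 1) * far_kern s p \<rho> (x - y)) \<partial>lborel) \<le> ennreal (enn2real K + 1)" .
  qed
qed


lemma nn_integral_far_weight:
  fixes g :: "real^'n \<Rightarrow> real"
  assumes [measurable]: "u \<in> borel_measurable borel" "g \<in> borel_measurable borel"
    and g0: "\<And>x. 0 \<le> g x" and g: "\<And>x. 1 - \<rho> < norm x \<Longrightarrow> g x = 0"
    and C: "0 \<le> C" "\<And>x. norm x \<le> 1 - \<rho> \<Longrightarrow>
       (\<integral>\<^sup>+y. ennreal ((1 + \<bar>u y\<bar>) powr (p - 1) * far_kern s p \<rho> (x - y)) \<partial>lborel) \<le> ennreal C"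
  shows "(\<integral>\<^sup>+z. ennreal (g (fst z) * ((1 + \<bar>u (snd z)\<bar>) powr (p - 1) * far_kern s p \<rho> (fst z - snd z))) \<partial>lborel)
     \<le> ennreal C * (\<integral>\<^sup>+x. ennreal (g x) \<partial>lborel)"
proof -
  have "(\<integral>\<^sup>+z. ennreal (g (fst z) * ((1 + \<bar>u (snd z)\<bar>) powr (p - 1) * far_kern s p \<rho> (fst z - snd z))) \<partial>lborel)
     = (\<integral>\<^sup>+x. \<integral>\<^sup>+y. ennreal (g x * ((1 + \<bar>u y\<bar>) powr (p - 1) * far_kern s p \<rho> (x - y))) \<partial>lborel \<partial>lborel)"
    by (subst nn_integral_pair) auto
  also have "\<dots> = (\<integral>\<^sup>+x. ennreal (g x) * (\<integral>\<^sup>+y. ennreal ((1 + \<bar>u y\<bar>) powr (p - 1) * far_kern s p \<rho> (x - y)) \<partial>lborel) \<partial>lborel)"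
    by (simp add: ennreal_mult' g0 nn_integral_cmult)
  also have "\<dots> \<le> (\<integral>\<^sup>+x. ennreal C * ennreal (g x) \<partial>lborel)"
  proof (rule nn_integral_mono)
    fix x
    show "ennreal (g x) * (\<integral>\<^sup>+y. ennreal ((1 + \<bar>u y\<bar>) powr (p - 1) * far_kern s p \<rho> (x - y)) \<partial>lborel) \<le> ennreal C * ennreal (g x)"
    proof (cases "norm x \<le> 1 - \<rho>")
      case True
      then show ?thesis by (subst mult.commute) (intro mult_right_mono C(2) zero_le)
    qed (use g[of x] in simp)
  qed
  also have "\<dots> = ennreal C * (\<integral>\<^sup>+x. ennreal (g x) \<partial>lborel)" by (simp add: nn_integral_cmult)
  finally show ?thesis .
qed

lemma far_part_integrable:
  fixes u \<psi> :: "real^'n \<Rightarrow> real"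
  assumes u: "normalized s p u" and sp: "0 < s * p" and p: "2 < p" and \<rho>: "0 < \<rho>" "\<rho> < 1"
    and [measurable]: "\<psi> \<in> borel_measurable borel" and B: "\<And>x. \<bar>\<psi> x\<bar> \<le> B"
    and supp: "\<And>x. 1 - \<rho> < norm x \<Longrightarrow> \<psi> x = 0"
  shows "integrable lborel (\<lambda>z. spow (p - 1) (u (fst z) - u (snd z)) * \<psi> (fst z) * far_kern s p \<rho> (fst z - snd z))"
proof -
  note [measurable] = normalizedD(1)[OF u]
  obtain C where C: "0 < C"
    "\<And>(u :: real^'n \<Rightarrow> real) x. normalized s p u \<Longrightarrow> norm x \<le> 1 - \<rho> \<Longrightarrow>
       (\<integral>\<^sup>+y. ennreal ((1 + \<bar>u y\<bar>) powr (p - 1) * far_kern s p \<rho> (x - y)) \<partial>lborel) \<le> ennreal C"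
    by (rule far_tail_bound[OF sp p \<rho>, where 'n='n]) (rule that)
  have "(\<integral>\<^sup>+x. ennreal \<bar>\<psi> x\<bar> \<partial>lborel) \<le> (\<integral>\<^sup>+x. ennreal B * indicator (ball (0::real^'n) 1) x \<partial>lborel)"
  proof (rule nn_integral_mono)
    fix x show "ennreal \<bar>\<psi> x\<bar> \<le> ennreal B * indicator (ball (0::real^'n) 1) x"
      using supp[of x] B[of x] \<rho> by (cases "norm x < 1") (auto simp: ennreal_leI)
  qed
  also have "\<dots> = ennreal B * emeasure lborel (ball (0::real^'n) 1)"
    by (rule nn_integral_cmult_indicator) simp
  also have "\<dots> < top" by (simp add: emeasure_ball_dim ennreal_mult_less_top)
  finally have \<psi>1: "(\<integral>\<^sup>+x. ennreal \<bar>\<psi> x\<bar> \<partial>lborel) < top" .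
  show ?thesis
  proof (rule integrableI_bounded)
    have "(\<integral>\<^sup>+z. ennreal (norm (spow (p - 1) (u (fst z) - u (snd z)) * \<psi> (fst z) * far_kern s p \<rho> (fst z - snd z))) \<partial>lborel)
      \<le> (\<integral>\<^sup>+z. ennreal (\<bar>\<psi> (fst z)\<bar> * ((1 + \<bar>u (snd z)\<bar>) powr (p - 1) * far_kern s p \<rho> (fst z - snd z))) \<partial>lborel)"
    proof (intro nn_integral_mono ennreal_leI)
      fix z :: "(real^'n) \<times> (real^'n)"
      show "norm (spow (p - 1) (u (fst z) - u (snd z)) * \<psi> (fst z) * far_kern s p \<rho> (fst z - snd z))
        \<le> \<bar>\<psi> (fst z)\<bar> * ((1 + \<bar>u (snd z)\<bar>) powr (p - 1) * far_kern s p \<rho> (fst z - snd z))"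
      proof (cases "norm (fst z) \<le> 1 - \<rho>")
        case True
        then have "\<bar>u (fst z)\<bar> \<le> 1" using normalizedD(2)[OF u] \<rho> by simp
        then have "\<bar>u (fst z) - u (snd z)\<bar> powr (p - 1) \<le> (1 + \<bar>u (snd z)\<bar>) powr (p - 1)"
          using p by (intro powr_mono2) auto
        then have "\<bar>\<psi> (fst z)\<bar> * (\<bar>u (fst z) - u (snd z)\<bar> powr (p - 1) * far_kern s p \<rho> (fst z - snd z))
            \<le> \<bar>\<psi> (fst z)\<bar> * ((1 + \<bar>u (snd z)\<bar>) powr (p - 1) * far_kern s p \<rho> (fst z - snd z))"
          by (intro mult_left_mono mult_right_mono) auto
        then show ?thesis by (simp add: abs_mult abs_spow mult_ac)
      qed (use supp in simp)
    qed
    also have "\<dots> \<le> ennreal C * (\<integral>\<^sup>+x. ennreal \<bar>\<psi> x\<bar> \<partial>lborel)"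
    proof (rule nn_integral_far_weight)
      show "\<bar>\<psi> x\<bar> = 0" if "1 - \<rho> < norm x" for x using supp[OF that] by simp
      show "0 \<le> C" using C(1) by simp
      show "(\<integral>\<^sup>+y. ennreal ((1 + \<bar>u y\<bar>) powr (p - 1) * far_kern s p \<rho> (x - y)) \<partial>lborel) \<le> ennreal C"
        if "norm x \<le> 1 - \<rho>" for x using C(2)[OF u that] .
    qed measurable
    also have "\<dots> < \<infinity>" using \<psi>1 by (simp add: ennreal_mult_less_top)
    finally show "(\<integral>\<^sup>+z. ennreal (norm (spow (p - 1) (u (fst z) - u (snd z)) * \<psi> (fst z) * far_kern s p \<rho> (fst z - snd z))) \<partial>lborel) < \<infinity>" .
  qed measurable
qed

lemma integral_swap_pair:
  fixes f :: "'a::euclidean_space \<times> 'a \<Rightarrow> real"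
  assumes "integrable lborel f"
  shows "integrable lborel (\<lambda>z. f (snd z, fst z))" "(\<integral>z. f (snd z, fst z) \<partial>lborel) = (\<integral>z. f z \<partial>lborel)"
proof -
  have f: "integrable (lborel \<Otimes>\<^sub>M lborel) f" using assms by (simp add: lborel_prod)
  show "integrable lborel (\<lambda>z. f (snd z, fst z))"
    using lborel_pair.integrable_product_swap[OF f] by (simp only: lborel_prod case_prod_beta')
  show "(\<integral>z. f (snd z, fst z) \<partial>lborel) = (\<integral>z. f z \<partial>lborel)"
    using lborel_pair.integral_product_swap[OF borel_measurable_integrable[OF f]]
    by (simp only: lborel_prod case_prod_beta')
qed

text \<open>
  By antisymmetry in \<open>x\<close> and \<open>y\<close> the bounded part of the kernel acts on the test function itself and
  not on its differences: it is a source term for the equation with the short-range kernel.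
  The short-range integrand is integrable since \<open>0 \<le> near_kern \<le> kern\<close>, the source because of
  the tail bound.
\<close>

lemma near_part_equation:
  fixes u \<psi> :: "real^'n \<Rightarrow> real"
  assumes u: "normalized s p u" and sp: "0 < s * p" and p: "2 < p" and \<rho>: "0 < \<rho>" "\<rho> < 1"
    and \<psi>: "admissible s p \<psi>" and supp: "\<And>x. 1 - \<rho> < norm x \<Longrightarrow> \<psi> x = 0"
  shows "integrable lborel (weak_integrand p (near_kern s p \<rho>) u \<psi>)"
    and "(\<integral>z. weak_integrand p (near_kern s p \<rho>) u \<psi> z \<partial>lborel) =
      - 2 * (\<integral>z. spow (p - 1) (u (fst z) - u (snd z)) * \<psi> (fst z) * far_kern s p \<rho> (fst z - snd z) \<partial>lborel)"
proof -
  note [measurable] = normalizedD(1)[OF u]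
  have [measurable]: "\<psi> \<in> borel_measurable borel" using \<psi> by (simp add: admissible_def)
  obtain B where B: "\<And>x. \<bar>\<psi> x\<bar> \<le> B" using \<psi> unfolding admissible_def by blast
  define F where "F z = spow (p - 1) (u (fst z) - u (snd z)) * \<psi> (fst z) * far_kern s p \<rho> (fst z - snd z)" for z
  have F: "integrable lborel F"
    unfolding F_def by (rule far_part_integrable[OF u sp p \<rho> _ B supp]) measurable
  note F' = integral_swap_pair[OF F]
  have full: "integrable lborel (weak_integrand p (kern s p) u \<psi>)" "(\<integral>z. weak_integrand p (kern s p) u \<psi> z \<partial>lborel) = 0"
    using normalizedD(5)[OF u \<psi>] by (auto simp: has_bochner_integral_iff)
  show int: "integrable lborel (weak_integrand p (near_kern s p \<rho>) u \<psi>)"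
  proof (rule Bochner_Integration.integrable_bound[OF full(1)])
    show "AE z in lborel. norm (weak_integrand p (near_kern s p \<rho>) u \<psi> z) \<le> norm (weak_integrand p (kern s p) u \<psi> z)"
      by (intro AE_I2) (simp add: weak_integrand_def abs_mult mult_left_mono near_kern_le_kern)
  qed simp
  have "weak_integrand p (kern s p) u \<psi> z = weak_integrand p (near_kern s p \<rho>) u \<psi> z + (F z + F (snd z, fst z))" for z
  proof (cases "fst z = snd z")
    case False
    have "u (snd z) - u (fst z) = - (u (fst z) - u (snd z))" by simp
    then have sw: "spow (p - 1) (u (snd z) - u (fst z)) = - spow (p - 1) (u (fst z) - u (snd z))"
      by (simp only: spow_minus)
    have far: "far_kern s p \<rho> (snd z - fst z) = far_kern s p \<rho> (fst z - snd z)"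
      using far_kern_minus[of s p \<rho> "fst z - snd z"] by simp
    have kk: "kern s p (fst z - snd z) = near_kern s p \<rho> (fst z - snd z) + far_kern s p \<rho> (fst z - snd z)"
      using near_plus_far[OF sp, of "fst z - snd z" \<rho>] False by simp
    have alg: "a * (b - c) * (k + l) = a * (b - c) * k + (a * b * l + (- a) * c * l)" for a b c k l :: real
      by (simp add: algebra_simps)
    show ?thesis unfolding weak_integrand_def F_def fst_conv snd_conv sw far kk by (rule alg)
  qed (simp add: weak_integrand_def F_def)
  then have "(\<integral>z. weak_integrand p (kern s p) u \<psi> z \<partial>lborel)
     = (\<integral>z. weak_integrand p (near_kern s p \<rho>) u \<psi> z + (F z + F (snd z, fst z)) \<partial>lborel)" by presburger
  also have "\<dots> = (\<integral>z. weak_integrand p (near_kern s p \<rho>) u \<psi> z \<partial>lborel) + ((\<integral>z. F z \<partial>lborel) + (\<integral>z. F (snd z, fst z) \<partial>lborel))"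
    using int F F' by simp
  finally show "(\<integral>z. weak_integrand p (near_kern s p \<rho>) u \<psi> z \<partial>lborel) = - 2 * (\<integral>z. F z \<partial>lborel)"
    using full F' by simp
qed

section \<open>The equation satisfied by a first difference\<close>

definition difference_integrand :: "real \<Rightarrow> (real^'n \<Rightarrow> real) \<Rightarrow> (real^'n \<Rightarrow> real) \<Rightarrow> real^'n \<Rightarrow> (real^'n \<Rightarrow> real) \<Rightarrow> (real^'n) \<times> (real^'n) \<Rightarrow> real" where
  "difference_integrand p k u h \<phi> z =
     (spow (p - 1) (u (fst z + h) - u (snd z + h)) - spow (p - 1) (u (fst z) - u (snd z)))
       * (\<phi> (fst z) - \<phi> (snd z)) * k (fst z - snd z)"

text \<open>
  The equation for \<open>\<phi>\<close> is subtracted from the one for \<open>\<phi> (\<cdot> - h)\<close>. In the short-range part both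
  variables are translated by \<open>h\<close>, which leaves the kernel unchanged. In the source term only the
  first variable is translated, so that the uncontrolled values \<open>u y\<close> for \<open>y\<close> far away are the same in
  both terms. The difference then comes from \<open>u (x + h) - u x\<close> and from the increment of
  the Lipschitz kernel, whence the factor \<open>\<bar>u (x + h) - u x\<bar> + \<bar>h\<bar>\<close>.
\<close>

lemma difference_equation:
  fixes s p \<rho> :: real
  assumes sp: "0 < s * p" and p: "2 < p" and \<rho>: "0 < \<rho>" "\<rho> < 1"
  obtains C where "0 < C"
    "\<And>(u :: real^'n \<Rightarrow> real) h \<phi>. normalized s p u \<Longrightarrow> norm h \<le> \<rho> / 2 \<Longrightarrow>
       admissible s p \<phi> \<Longrightarrow> admissible s p (\<lambda>x. \<phi> (x - h)) \<Longrightarrow> (\<forall>x. 1 - 2 * \<rho> < norm x \<longrightarrow> \<phi> x = 0) \<Longrightarrow>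
       integrable lborel (difference_integrand p (near_kern s p \<rho>) u h \<phi>) \<and>
       ennreal \<bar>\<integral>z. difference_integrand p (near_kern s p \<rho>) u h \<phi> z \<partial>lborel\<bar>
       \<le> ennreal C * (\<integral>\<^sup>+x. ennreal (\<bar>\<phi> x\<bar> * (\<bar>u (x + h) - u x\<bar> + norm h)) \<partial>lborel)"
proof -
  define m where "m = real CARD('n) + s * p"
  define K where "K = (p - 1) * 2 powr (p - 2) * 2 powr m + m * 2 powr m / \<rho>"
  have m: "0 < m" using sp by (simp add: m_def add_nonneg_pos)
  have K0: "0 < K" using m p \<rho> by (simp add: K_def add_pos_pos)
  obtain T where T: "0 < T"
    "\<And>(u :: real^'n \<Rightarrow> real) x. normalized s p u \<Longrightarrow> norm x \<le> 1 - \<rho> \<Longrightarrow>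
       (\<integral>\<^sup>+y. ennreal ((1 + \<bar>u y\<bar>) powr (p - 1) * far_kern s p \<rho> (x - y)) \<partial>lborel) \<le> ennreal T"
    by (rule far_tail_bound[OF sp p \<rho>, where 'n='n]) (rule that)
  show thesis
  proof (rule that[of "2 * (T * K)"])
    show "0 < 2 * (T * K)" using T K0 by simp
    fix u \<phi> :: "real^'n \<Rightarrow> real" and h :: "real^'n"
    assume u: "normalized s p u" and h: "norm h \<le> \<rho> / 2" and \<phi>: "admissible s p \<phi>" "admissible s p (\<lambda>x. \<phi> (x - h))"
      and supp0: "\<forall>x. 1 - 2 * \<rho> < norm x \<longrightarrow> \<phi> x = 0"
    have supp: "\<phi> x = 0" if "1 - 2 * \<rho> < norm x" for x using supp0 that by simp
    note [measurable] = normalizedD(1)[OF u]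
    have [measurable]: "\<phi> \<in> borel_measurable borel" using \<phi> by (simp add: admissible_def)
    obtain B where B: "\<And>x. \<bar>\<phi> x\<bar> \<le> B" using \<phi>(1) unfolding admissible_def by blast
    define \<psi> where "\<psi> x = \<phi> (x - h)" for x
    have [measurable]: "\<psi> \<in> borel_measurable borel" unfolding \<psi>_def[abs_def] by measurable
    have \<psi>: "admissible s p \<psi>" using \<phi>(2) by (simp add: \<psi>_def[abs_def])
    have supp1: "1 - \<rho> < norm x \<Longrightarrow> \<phi> x = 0" for x using supp[of x] \<rho> by auto
    have supp2: "\<psi> x = 0" if "1 - \<rho> < norm x" for x
    proof -
      have "norm x - norm h \<le> norm (x - h)" by (rule norm_triangle_ineq2)
      then have "1 - 2 * \<rho> < norm (x - h)" using that h \<rho> by linarith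
      then show ?thesis unfolding \<psi>_def by (rule supp)
    qed
    define W where "W = weak_integrand p (near_kern s p \<rho>) u"
    define F where "F f z = spow (p - 1) (u (fst z) - u (snd z)) * f (fst z) * far_kern s p \<rho> (fst z - snd z)" for f z
    have W: "integrable lborel (W \<phi>)" "integrable lborel (W \<psi>)"
      "(\<integral>z. W \<phi> z \<partial>lborel) = - 2 * (\<integral>z. F \<phi> z \<partial>lborel)" "(\<integral>z. W \<psi> z \<partial>lborel) = - 2 * (\<integral>z. F \<psi> z \<partial>lborel)"
      unfolding W_def F_def
      using near_part_equation[OF u sp p \<rho> \<phi>(1) supp1] near_part_equation[OF u sp p \<rho> \<psi> supp2] by auto
    have B': "\<bar>\<psi> x\<bar> \<le> B" for x by (simp add: \<psi>_def B)
    have F: "integrable lborel (F \<phi>)" "integrable lborel (F \<psi>)"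
      unfolding F_def[abs_def]
      by (rule far_part_integrable[OF u sp p \<rho> _ B supp1], measurable)
         (rule far_part_integrable[OF u sp p \<rho> _ B' supp2], measurable)
    define G where "G = difference_integrand p (near_kern s p \<rho>) u h \<phi>"
    have G: "G z = W \<psi> (z + (h, h)) - W \<phi> z" for z
      by (simp add: G_def difference_integrand_def W_def weak_integrand_def \<psi>_def left_diff_distrib)
    note Wh = integral_shift[OF W(2), of "(h, h)"]
    have "integrable lborel G" unfolding G[abs_def] using Wh W by simp
    \<comment> \<open>translating only the first variable keeps the far values \<open>u y\<close> unchanged\<close>
    define D where "D z = F \<psi> (z + (h, 0)) - F \<phi> z" for z
    note Fh = integral_shift[OF F(2), of "(h, 0)"]
    have D: "integrable lborel D" unfolding D_def[abs_def] using Fh F by simp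
    have "(\<integral>z. G z \<partial>lborel) = (\<integral>z. W \<psi> z \<partial>lborel) - (\<integral>z. W \<phi> z \<partial>lborel)"
      unfolding G[abs_def] using Wh W by simp
    also have "\<dots> = - 2 * ((\<integral>z. F \<psi> z \<partial>lborel) - (\<integral>z. F \<phi> z \<partial>lborel))" using W by simp
    also have "(\<integral>z. F \<psi> z \<partial>lborel) - (\<integral>z. F \<phi> z \<partial>lborel) = (\<integral>z. D z \<partial>lborel)"
      unfolding D_def[abs_def] using Fh F by simp
    finally have GD: "(\<integral>z. G z \<partial>lborel) = - 2 * (\<integral>z. D z \<partial>lborel)" .
    define g where "g x = K * (\<bar>\<phi> x\<bar> * (\<bar>u (x + h) - u x\<bar> + norm h))" for x
    have [measurable]: "g \<in> borel_measurable borel" unfolding g_def[abs_def] by measurable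
    have pt: "ennreal \<bar>D z\<bar> \<le> ennreal (g (fst z) * ((1 + \<bar>u (snd z)\<bar>) powr (p - 1) * far_kern s p \<rho> (fst z - snd z)))" for z
    proof (rule ennreal_leI)
      define x y where "x = fst z" and "y = snd z"
      define k k' where "k = far_kern s p \<rho> (x - y)" and "k' = far_kern s p \<rho> (x - y + h)"
      define J J' where "J = spow (p - 1) (u x - u y)" and "J' = spow (p - 1) (u (x + h) - u y)"
      define q where "q = (1 + \<bar>u y\<bar>) powr (p - 1)"
      have Deq: "D z = \<phi> x * ((J' - J) * k' + J * (k' - k))"
        by (simp add: D_def F_def \<psi>_def J_def J'_def k_def k'_def x_def y_def algebra_simps)
      have "\<bar>D z\<bar> \<le> g x * (q * k)"
      proof (cases "1 - 2 * \<rho> < norm x")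
        case True
        then show ?thesis by (simp add: Deq g_def supp)
      next
        case False
        have "norm (x + h) \<le> norm x + norm h" by (rule norm_triangle_ineq)
        then have ux: "\<bar>u x\<bar> \<le> 1" "\<bar>u (x + h)\<bar> \<le> 1" using False h \<rho> normalizedD(2)[OF u] by auto
        have k0: "0 \<le> k" "0 \<le> k'" by (auto simp: k_def k'_def)
        have far: "k' \<le> 2 powr m * k" "\<bar>k' - k\<bar> \<le> m * 2 powr m / \<rho> * norm h * k"
          using far_kern_shift[OF sp \<rho>(1) h, of "x - y"] by (auto simp: k_def k'_def m_def)
        have Jb: "\<bar>J\<bar> \<le> q" unfolding J_def q_def abs_spow using ux p by (intro powr_mono2) auto
        have "\<bar>J' - J\<bar> \<le> (p - 1) * (\<bar>u (x + h) - u y\<bar> + \<bar>u x - u y\<bar>) powr (p - 2) * \<bar>u (x + h) - u x\<bar>"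
          using spow_diff_upper[of "p - 1" "u (x + h) - u y" "u x - u y"] p by (simp add: J_def J'_def)
        also have "\<dots> \<le> (p - 1) * (2 * (1 + \<bar>u y\<bar>)) powr (p - 2) * \<bar>u (x + h) - u x\<bar>"
          using ux p by (intro mult_right_mono mult_left_mono powr_mono2) auto
        also have "\<dots> = (p - 1) * (2 powr (p - 2) * (1 + \<bar>u y\<bar>) powr (p - 2)) * \<bar>u (x + h) - u x\<bar>"
          by (subst powr_mult) auto
        also have "\<dots> \<le> (p - 1) * (2 powr (p - 2) * q) * \<bar>u (x + h) - u x\<bar>"
          unfolding q_def using p by (intro mult_right_mono mult_left_mono powr_mono) auto
        finally have JJ: "\<bar>J' - J\<bar> \<le> (p - 1) * (2 powr (p - 2) * q) * \<bar>u (x + h) - u x\<bar>" .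
        have q0: "0 \<le> q" by (simp add: q_def)
        have "\<bar>(J' - J) * k' + J * (k' - k)\<bar> \<le> \<bar>J' - J\<bar> * k' + \<bar>J\<bar> * \<bar>k' - k\<bar>"
          using abs_triangle_ineq[of "(J' - J) * k'" "J * (k' - k)"] k0 by (simp add: abs_mult)
        also have "\<dots> \<le> ((p - 1) * (2 powr (p - 2) * q) * \<bar>u (x + h) - u x\<bar>) * (2 powr m * k) + q * (m * 2 powr m / \<rho> * norm h * k)"
          using JJ far Jb k0 q0 p by (intro add_mono mult_mono) auto
        also have "\<dots> = ((p - 1) * 2 powr (p - 2) * 2 powr m * \<bar>u (x + h) - u x\<bar> + m * 2 powr m / \<rho> * norm h) * (q * k)"
          by (simp add: algebra_simps)
        also have "\<dots> \<le> (K * \<bar>u (x + h) - u x\<bar> + K * norm h) * (q * k)"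
          unfolding K_def using k0 q0 p m \<rho> by (intro mult_right_mono add_mono) auto
        finally have "\<bar>D z\<bar> \<le> \<bar>\<phi> x\<bar> * ((K * \<bar>u (x + h) - u x\<bar> + K * norm h) * (q * k))"
          unfolding Deq abs_mult by (rule mult_left_mono) simp
        then show ?thesis by (simp add: g_def algebra_simps)
      qed
      then show "\<bar>D z\<bar> \<le> g (fst z) * ((1 + \<bar>u (snd z)\<bar>) powr (p - 1) * far_kern s p \<rho> (fst z - snd z))"
        by (simp add: x_def y_def q_def k_def)
    qed
    have "ennreal \<bar>\<integral>z. D z \<partial>lborel\<bar> \<le> ennreal (\<integral>z. \<bar>D z\<bar> \<partial>lborel)" by (intro ennreal_leI integral_abs_bound)
    also have "\<dots> = (\<integral>\<^sup>+z. ennreal \<bar>D z\<bar> \<partial>lborel)" using D by (subst nn_integral_eq_integral) auto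
    also have "\<dots> \<le> (\<integral>\<^sup>+z. ennreal (g (fst z) * ((1 + \<bar>u (snd z)\<bar>) powr (p - 1) * far_kern s p \<rho> (fst z - snd z))) \<partial>lborel)"
      by (rule nn_integral_mono) (rule pt)
    also have "\<dots> \<le> ennreal T * (\<integral>\<^sup>+x. ennreal (g x) \<partial>lborel)"
    proof (rule nn_integral_far_weight)
      show "0 \<le> g x" for x using K0 by (simp add: g_def)
      show "g x = 0" if "1 - \<rho> < norm x" for x using supp1[OF that] by (simp add: g_def)
      show "0 \<le> T" using T(1) by simp
      show "(\<integral>\<^sup>+y. ennreal ((1 + \<bar>u y\<bar>) powr (p - 1) * far_kern s p \<rho> (x - y)) \<partial>lborel) \<le> ennreal T"
        if "norm x \<le> 1 - \<rho>" for x using T(2)[OF u that] .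
    qed measurable
    also have "(\<integral>\<^sup>+x. ennreal (g x) \<partial>lborel) = (\<integral>\<^sup>+x. ennreal K * ennreal (\<bar>\<phi> x\<bar> * (\<bar>u (x + h) - u x\<bar> + norm h)) \<partial>lborel)"
      using K0 by (simp add: g_def ennreal_mult)
    also have "\<dots> = ennreal K * (\<integral>\<^sup>+x. ennreal (\<bar>\<phi> x\<bar> * (\<bar>u (x + h) - u x\<bar> + norm h)) \<partial>lborel)"
      by (rule nn_integral_cmult) measurable
    finally have *: "ennreal \<bar>\<integral>z. D z \<partial>lborel\<bar>
        \<le> ennreal T * (ennreal K * (\<integral>\<^sup>+x. ennreal (\<bar>\<phi> x\<bar> * (\<bar>u (x + h) - u x\<bar> + norm h)) \<partial>lborel))" .
    have "ennreal \<bar>\<integral>z. G z \<partial>lborel\<bar> = ennreal 2 * ennreal \<bar>\<integral>z. D z \<partial>lborel\<bar>"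
      by (subst ennreal_mult[symmetric]) (auto simp: GD abs_mult)
    also have "\<dots> \<le> ennreal 2 * (ennreal T * (ennreal K * (\<integral>\<^sup>+x. ennreal (\<bar>\<phi> x\<bar> * (\<bar>u (x + h) - u x\<bar> + norm h)) \<partial>lborel)))"
      using * by (rule mult_left_mono) simp
    also have "\<dots> = ennreal (2 * (T * K)) * (\<integral>\<^sup>+x. ennreal (\<bar>\<phi> x\<bar> * (\<bar>u (x + h) - u x\<bar> + norm h)) \<partial>lborel)"
      using T K0 by (simp add: ennreal_mult mult.assoc)
    finally show "integrable lborel (difference_integrand p (near_kern s p \<rho>) u h \<phi>) \<and>
       ennreal \<bar>\<integral>z. difference_integrand p (near_kern s p \<rho>) u h \<phi> z \<partial>lborel\<bar>
       \<le> ennreal (2 * (T * K)) * (\<integral>\<^sup>+x. ennreal (\<bar>\<phi> x\<bar> * (\<bar>u (x + h) - u x\<bar> + norm h)) \<partial>lborel)"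
      using \<open>integrable lborel G\<close> unfolding G_def by blast
  qed
qed

section \<open>Bounds for differences in Lebesgue spaces\<close>

definition diff_integral :: "real \<Rightarrow> (real^'n \<Rightarrow> real) \<Rightarrow> real^'n \<Rightarrow> real \<Rightarrow> ennreal" where
  "diff_integral q f h r = (\<integral>\<^sup>+x\<in>ball 0 r. ennreal (\<bar>f (x + h) - f x\<bar> powr q) \<partial>lborel)"

definition unit_class :: "(real^'n \<Rightarrow> real) set \<Rightarrow> bool" where
  "unit_class U \<longleftrightarrow> (\<forall>u\<in>U. u \<in> borel_measurable borel \<and> (\<forall>x. norm x < 1 \<longrightarrow> \<bar>u x\<bar> \<le> 1))"

text \<open>
  Nikolskii regularity of order \<open>\<sigma>\<close> in \<open>L\<^sup>q\<close>, locally in the unit ball and uniformly over the class \<open>U\<close>.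
  The restriction on \<open>h\<close> is the one under which \<open>x + h\<close> stays in the unit ball. Uniformity over \<open>U\<close> is
  what finally makes the constant depend on \<open>N, p, s, \<gamma>\<close> only.
\<close>

definition nikolskii :: "(real^'n \<Rightarrow> real) set \<Rightarrow> real \<Rightarrow> real \<Rightarrow> bool" where
  "nikolskii U q \<sigma> \<longleftrightarrow> (\<forall>r. 0 < r \<and> r < 1 \<longrightarrow> (\<exists>C\<ge>0. \<forall>u\<in>U. \<forall>h. norm h < 1 - r \<longrightarrow>
      diff_integral q u h r \<le> ennreal (C * norm h powr (\<sigma> * q))))"

lemma unit_classD:
  assumes "unit_class U" "u \<in> U"
  shows "u \<in> borel_measurable borel" "norm x < 1 \<Longrightarrow> \<bar>u x\<bar> \<le> 1"
  using assms by (auto simp: unit_class_def)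

lemma nikolskiiE:
  assumes "nikolskii U q \<sigma>" "0 < r" "r < 1"
  obtains C where "0 \<le> C"
    "\<And>u h. u \<in> U \<Longrightarrow> norm h < 1 - r \<Longrightarrow> diff_integral q u h r \<le> ennreal (C * norm h powr (\<sigma> * q))"
proof -
  have "\<exists>C\<ge>0. \<forall>u\<in>U. \<forall>h. norm h < 1 - r \<longrightarrow> diff_integral q u h r \<le> ennreal (C * norm h powr (\<sigma> * q))"
    using assms(1)[unfolded nikolskii_def, THEN spec, of r] assms(2,3) by simp
  then obtain C where C: "0 \<le> C" "\<forall>u\<in>U. \<forall>h. norm h < 1 - r \<longrightarrow> diff_integral q u h r \<le> ennreal (C * norm h powr (\<sigma> * q))"
    by (elim exE conjE)
  show thesis by (rule that[OF C(1)]) (simp add: C(2))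
qed

lemma unit_class_normalized: "unit_class {u. normalized s p u}"
  by (auto simp: unit_class_def normalized_def)

lemma diff_integral_zero [simp]: "diff_integral q f 0 r = 0"
  by (simp add: diff_integral_def)

lemma unit_class_diff_le_2:
  assumes "unit_class U" "u \<in> U" "norm h < 1 - r" "norm x < r"
  shows "\<bar>u (x + h) - u x\<bar> \<le> 2"
proof -
  have "norm (x + h) < 1" using assms(3,4) norm_triangle_ineq[of x h] by linarith
  moreover have "norm x < 1" using assms(3,4) norm_ge_zero[of h] by linarith
  ultimately have "\<bar>u (x + h)\<bar> \<le> 1" "\<bar>u x\<bar> \<le> 1" using unit_classD[OF assms(1,2)] by auto
  then show ?thesis by linarith
qed

lemma diff_integral_trivial:
  fixes U :: "(real^'n \<Rightarrow> real) set"
  assumes U: "unit_class U" "u \<in> U" and h: "norm h < 1 - r" and r: "0 < r" and q: "0 \<le> q"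
  shows "diff_integral q u h r \<le> ennreal (2 powr q * unit_ball_vol CARD('n))"
proof -
  have pt: "ennreal (\<bar>u (x + h) - u x\<bar> powr q) * indicator (ball 0 r) x \<le> ennreal (2 powr q) * indicator (ball 0 1) x" for x
  proof (cases "norm x < r")
    case True
    then have "\<bar>u (x + h) - u x\<bar> \<le> 2" using unit_class_diff_le_2[OF U h] by simp
    then have "\<bar>u (x + h) - u x\<bar> powr q \<le> 2 powr q" using q by (intro powr_mono2) auto
    moreover have "norm x < 1" using True h norm_ge_zero[of h] by linarith
    ultimately show ?thesis using True by (simp add: ennreal_leI)
  qed simp
  have "diff_integral q u h r \<le> (\<integral>\<^sup>+x. ennreal (2 powr q) * indicator (ball (0::real^'n) 1) x \<partial>lborel)"
    unfolding diff_integral_def by (rule nn_integral_mono) (rule pt)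
  also have "\<dots> = ennreal (2 powr q) * emeasure lborel (ball (0::real^'n) 1)"
    by (rule nn_integral_cmult_indicator) simp
  also have "\<dots> = ennreal (2 powr q * unit_ball_vol CARD('n))"
    by (simp add: emeasure_ball_dim ennreal_mult)
  finally show ?thesis .
qed

lemma nikolskii_mono_exponent:
  fixes U :: "(real^'n \<Rightarrow> real) set"
  assumes "nikolskii U q \<sigma>" "\<sigma>' \<le> \<sigma>" "0 \<le> q"
  shows "nikolskii U q \<sigma>'"
  unfolding nikolskii_def
proof (intro allI impI)
  fix r :: real assume r: "0 < r \<and> r < 1"
  obtain C where C: "0 \<le> C" "\<And>u h. u \<in> U \<Longrightarrow> norm h < 1 - r \<Longrightarrow> diff_integral q u h r \<le> ennreal (C * norm h powr (\<sigma> * q))"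
    by (rule nikolskiiE[OF assms(1) r[THEN conjunct1] r[THEN conjunct2]]) (rule that)
  show "\<exists>C\<ge>0. \<forall>u\<in>U. \<forall>h. norm h < 1 - r \<longrightarrow> diff_integral q u h r \<le> ennreal (C * norm h powr (\<sigma>' * q))"
  proof (intro exI[of _ C] conjI ballI allI impI C(1))
    fix u and h :: "real^'n" assume u: "u \<in> U" "norm h < 1 - r"
    have "norm h powr (\<sigma> * q) \<le> norm h powr (\<sigma>' * q)"
      using u r assms by (intro powr_mono' mult_right_mono) auto
    then show "diff_integral q u h r \<le> ennreal (C * norm h powr (\<sigma>' * q))"
      using C u by (intro order_trans[OF C(2)[OF u]] ennreal_leI mult_left_mono) auto
  qed
qed

text \<open>
  Interpolation with the bound \<open>\<bar>u\<bar> \<le> 1\<close>: differences are at most \<open>2\<close>, so the \<open>q'\<close>-th power is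
  controlled by the \<open>q\<close>-th.
\<close>

lemma nikolskii_raise_integrability:
  fixes U :: "(real^'n \<Rightarrow> real) set"
  assumes U: "unit_class U" and nik: "nikolskii U q \<sigma>" and q: "0 < q" "q \<le> q'"
  shows "nikolskii U q' (\<sigma> * q / q')"
  unfolding nikolskii_def
proof (intro allI impI)
  fix r :: real assume r: "0 < r \<and> r < 1"
  obtain C where C: "0 \<le> C" "\<And>u h. u \<in> U \<Longrightarrow> norm h < 1 - r \<Longrightarrow> diff_integral q u h r \<le> ennreal (C * norm h powr (\<sigma> * q))"
    by (rule nikolskiiE[OF nik r[THEN conjunct1] r[THEN conjunct2]]) (rule that)
  show "\<exists>C\<ge>0. \<forall>u\<in>U. \<forall>h. norm h < 1 - r \<longrightarrow> diff_integral q' u h r \<le> ennreal (C * norm h powr (\<sigma> * q / q' * q'))"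
  proof (intro exI[of _ "2 powr (q' - q) * C"] conjI ballI allI impI)
    show "0 \<le> 2 powr (q' - q) * C" using C by simp
    fix u and h :: "real^'n" assume u: "u \<in> U" "norm h < 1 - r"
    note [measurable] = unit_classD(1)[OF U u(1)]
    have pt: "ennreal (\<bar>u (x + h) - u x\<bar> powr q') * indicator (ball 0 r) x
       \<le> ennreal (2 powr (q' - q)) * (ennreal (\<bar>u (x + h) - u x\<bar> powr q) * indicator (ball 0 r) x)" for x
    proof (cases "norm x < r")
      case True
      then have "\<bar>u (x + h) - u x\<bar> powr (q' - q) \<le> 2 powr (q' - q)"
        using unit_class_diff_le_2[OF U u(1,2)] q by (intro powr_mono2) auto
      then have "\<bar>u (x + h) - u x\<bar> powr (q' - q) * \<bar>u (x + h) - u x\<bar> powr q \<le> 2 powr (q' - q) * \<bar>u (x + h) - u x\<bar> powr q"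
        by (rule mult_right_mono) simp
      then have "\<bar>u (x + h) - u x\<bar> powr q' \<le> 2 powr (q' - q) * \<bar>u (x + h) - u x\<bar> powr q"
        by (simp only: powr_add[symmetric]) simp
      then show ?thesis using True by (simp add: ennreal_mult'[symmetric] ennreal_leI)
    qed simp
    have "diff_integral q' u h r \<le> (\<integral>\<^sup>+x. ennreal (2 powr (q' - q)) * (ennreal (\<bar>u (x + h) - u x\<bar> powr q) * indicator (ball 0 r) x) \<partial>lborel)"
      unfolding diff_integral_def by (rule nn_integral_mono) (rule pt)
    also have "\<dots> = ennreal (2 powr (q' - q)) * diff_integral q u h r"
      unfolding diff_integral_def by (rule nn_integral_cmult) measurable
    also have "\<dots> \<le> ennreal (2 powr (q' - q)) * ennreal (C * norm h powr (\<sigma> * q))"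
      by (rule mult_left_mono[OF C(2)[OF u]]) simp
    also have "\<dots> = ennreal (2 powr (q' - q) * C * norm h powr (\<sigma> * q / q' * q'))"
      using q C by (simp add: ennreal_mult'[symmetric] mult.assoc)
    finally show "diff_integral q' u h r \<le> ennreal (2 powr (q' - q) * C * norm h powr (\<sigma> * q / q' * q'))" .
  qed
qed

text \<open>
  The identity \<open>u (x + h) - u x = (u (x + 2 h) - u x) / 2 - (second difference) / 2\<close> bounds the
  differences with step \<open>h\<close> by half of those with step \<open>2 h\<close>. Doubling the step costs the factor
  \<open>2\<^sup>\<sigma> < 2\<close>, so an induction over dyadic sizes of \<open>h\<close>, starting from the trivial bound for \<open>h\<close> bounded
  away from \<open>0\<close>, loses nothing.
\<close>

lemma nikolskii_from_second_differences:
  fixes U :: "(real^'n \<Rightarrow> real) set"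
  assumes U: "unit_class U" and q: "0 < q" and \<sigma>: "\<sigma> < 1"
    and second: "\<And>r. 0 < r \<Longrightarrow> r < 1 \<Longrightarrow> \<exists>C h0. 0 \<le> C \<and> 0 < h0 \<and> (\<forall>u\<in>U. \<forall>h. h \<noteq> 0 \<and> norm h < h0 \<longrightarrow>
       (\<integral>\<^sup>+x\<in>ball 0 r. ennreal (\<bar>(u (x + h + h) - u (x + h)) - (u (x + h) - u x)\<bar> powr q) \<partial>lborel)
         \<le> ennreal (C * norm h powr (\<sigma> * q)))"
  shows "nikolskii U q \<sigma>"
  unfolding nikolskii_def
proof (intro allI impI)
  fix r :: real assume r: "0 < r \<and> r < 1"
  obtain D h1 where D: "0 \<le> D" "0 < h1" "\<And>u h. u \<in> U \<Longrightarrow> h \<noteq> 0 \<Longrightarrow> norm h < h1 \<Longrightarrow>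
      (\<integral>\<^sup>+x\<in>ball 0 r. ennreal (\<bar>(u (x + h + h) - u (x + h)) - (u (x + h) - u x)\<bar> powr q) \<partial>lborel)
         \<le> ennreal (D * norm h powr (\<sigma> * q))"
    using second[of r] r by blast
  define h0 where "h0 = min h1 ((1 - r) / 2)"
  have h0: "0 < h0" "h0 \<le> h1" "2 * h0 \<le> 1 - r" using D r by (auto simp: h0_def min_def)
  define L where "L = (2::real) powr ((1 - \<sigma>) * q)"
  have L: "1 < L" using q \<sigma> by (simp add: L_def)
  \<comment> \<open>any \<open>\<epsilon>\<close> with \<open>1 + \<epsilon> < L\<close> makes the doubling step a contraction; \<open>L > 1\<close> is where \<open>\<sigma> < 1\<close> enters\<close>
  define \<epsilon> where "\<epsilon> = (L - 1) / 2"
  have e: "0 < \<epsilon>" using L by (simp add: \<epsilon>_def)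
  define \<kappa> where "\<kappa> = (1 + \<epsilon>) / L"
  have eL: "0 < 1 + \<epsilon>" "1 + \<epsilon> < L" using L by (simp_all add: \<epsilon>_def field_simps)
  then have \<kappa>: "0 < \<kappa>" "\<kappa> < 1" using L by (simp_all add: \<kappa>_def)
  obtain E where E: "0 < E" "\<And>a b. \<bar>a + b\<bar> powr q \<le> (1 + \<epsilon>) * \<bar>a\<bar> powr q + E * \<bar>b\<bar> powr q"
    by (rule powr_add_le_eps[OF q e]) (rule that)
  define B where "B = max (2 powr q * unit_ball_vol CARD('n) * (if 0 \<le> \<sigma> then h0 powr (- (\<sigma> * q)) else 1)) (E * D / (1 - \<kappa>))"
  have B0: "0 \<le> B" using \<kappa> E D by (auto simp: B_def le_max_iff_disj)
  have claim: "diff_integral q u h r \<le> ennreal (B * norm h powr (\<sigma> * q))"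
    if "u \<in> U" "norm h < 1 - r" "h0 / 2 ^ k \<le> norm h" for u h k
    using that
  proof (induction k arbitrary: h)
    case 0
    have hp: "0 < norm h" "norm h < 1" "h0 \<le> norm h" using 0 h0 r by auto
    have "2 powr q * unit_ball_vol CARD('n) \<le> B * norm h powr (\<sigma> * q)"
    proof (cases "0 \<le> \<sigma>")
      case True
      have "2 powr q * unit_ball_vol CARD('n) = (2 powr q * unit_ball_vol CARD('n) * h0 powr (- (\<sigma> * q))) * h0 powr (\<sigma> * q)"
        using h0 by (simp add: powr_add[symmetric])
      also have "\<dots> \<le> B * norm h powr (\<sigma> * q)"
        using True hp h0 q B0 by (intro mult_mono powr_mono2) (auto simp: B_def)
      finally show ?thesis .
    next
      case False
      have "2 powr q * unit_ball_vol CARD('n) * 1 \<le> B * norm h powr (\<sigma> * q)"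
      proof (intro mult_mono)
        have "norm h powr 0 \<le> norm h powr (\<sigma> * q)"
          using hp False q by (intro powr_mono') (auto simp: mult_nonpos_nonneg)
        then show "1 \<le> norm h powr (\<sigma> * q)" using hp by simp
      qed (use False B0 in \<open>auto simp: B_def\<close>)
      then show ?thesis by simp
    qed
    then have "ennreal (2 powr q * unit_ball_vol CARD('n)) \<le> ennreal (B * norm h powr (\<sigma> * q))"
      by (rule ennreal_leI)
    moreover have "diff_integral q u h r \<le> ennreal (2 powr q * unit_ball_vol CARD('n))"
      by (rule diff_integral_trivial[OF U 0(1,2)]) (use r q in simp_all)
    ultimately show ?case by (rule order_trans[rotated])
  next
    case (Suc k)
    show ?case
    proof (cases "h0 / 2 ^ k \<le> norm h")
      case True then show ?thesis by (rule Suc.IH[OF Suc.prems(1,2)])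
    next
      case False
      note [measurable] = unit_classD(1)[OF U Suc.prems(1)]
      have "h0 / 2 ^ k \<le> h0 / 1" using h0 by (intro divide_left_mono) auto
      then have hh: "norm h < h0" using False by simp
      have "0 < h0 / 2 ^ Suc k" using h0 by simp
      then have h: "h \<noteq> 0" using Suc.prems(3) by auto
      have n2: "norm (h + h) = 2 * norm h" using norm_scaleR[of 2 h] by (simp add: scaleR_2)
      have IH: "diff_integral q u (h + h) r \<le> ennreal (B * norm (h + h) powr (\<sigma> * q))"
      proof (rule Suc.IH[OF Suc.prems(1)])
        show "norm (h + h) < 1 - r" unfolding n2 using hh h0 by linarith
        show "h0 / 2 ^ k \<le> norm (h + h)" unfolding n2 using Suc.prems(3) by (simp add: field_simps)
      qed
      define T where "T x = (u (x + h + h) - u (x + h)) - (u (x + h) - u x)" for x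
      have [measurable]: "T \<in> borel_measurable borel" unfolding T_def[abs_def] by measurable
      have pt: "ennreal (\<bar>u (x + h) - u x\<bar> powr q) * indicator (ball 0 r) x
         \<le> ennreal ((1 + \<epsilon>) * 2 powr (- q)) * (ennreal (\<bar>u (x + (h + h)) - u x\<bar> powr q) * indicator (ball 0 r) x)
            + ennreal E * (ennreal (\<bar>T x\<bar> powr q) * indicator (ball 0 r) x)" for x
      proof (cases "x \<in> ball 0 r")
        case True
        have "\<bar>u (x + h) - u x\<bar> = \<bar>(u (x + (h + h)) - u x) / 2 + (- T x / 2)\<bar>"
        proof -
          have "b - a = (c - a) / 2 + (- ((c - b) - (b - a)) / 2)" for a b c :: real by (simp add: field_simps)
          then show ?thesis unfolding T_def add.assoc[symmetric] by metis
        qed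
        then have "\<bar>u (x + h) - u x\<bar> powr q \<le> (1 + \<epsilon>) * \<bar>(u (x + (h + h)) - u x) / 2\<bar> powr q + E * \<bar>- T x / 2\<bar> powr q"
          using E(2) by metis
        also have "\<dots> \<le> ((1 + \<epsilon>) * 2 powr (- q)) * \<bar>u (x + (h + h)) - u x\<bar> powr q + E * \<bar>T x\<bar> powr q"
        proof (intro add_mono)
          have "\<bar>(u (x + (h + h)) - u x) / 2\<bar> powr q = 2 powr (- q) * \<bar>u (x + (h + h)) - u x\<bar> powr q"
            unfolding abs_divide by (subst powr_divide) (auto simp: powr_minus divide_inverse)
          then show "(1 + \<epsilon>) * \<bar>(u (x + (h + h)) - u x) / 2\<bar> powr q \<le> ((1 + \<epsilon>) * 2 powr (- q)) * \<bar>u (x + (h + h)) - u x\<bar> powr q"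
            by simp
          show "E * \<bar>- T x / 2\<bar> powr q \<le> E * \<bar>T x\<bar> powr q"
            using E q by (intro mult_left_mono powr_mono2) auto
        qed
        finally show ?thesis using True e E
          by (simp add: ennreal_leI ennreal_mult'[symmetric] flip: ennreal_plus)
      qed simp
      have "diff_integral q u h r \<le> (\<integral>\<^sup>+x. ennreal ((1 + \<epsilon>) * 2 powr (- q)) * (ennreal (\<bar>u (x + (h + h)) - u x\<bar> powr q) * indicator (ball 0 r) x)
            + ennreal E * (ennreal (\<bar>T x\<bar> powr q) * indicator (ball 0 r) x) \<partial>lborel)"
        unfolding diff_integral_def by (rule nn_integral_mono) (rule pt)
      also have "\<dots> = (\<integral>\<^sup>+x. ennreal ((1 + \<epsilon>) * 2 powr (- q)) * (ennreal (\<bar>u (x + (h + h)) - u x\<bar> powr q) * indicator (ball 0 r) x) \<partial>lborel)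
            + (\<integral>\<^sup>+x. ennreal E * (ennreal (\<bar>T x\<bar> powr q) * indicator (ball 0 r) x) \<partial>lborel)"
        by (rule nn_integral_add) measurable
      also have "\<dots> = ennreal ((1 + \<epsilon>) * 2 powr (- q)) * diff_integral q u (h + h) r
            + ennreal E * (\<integral>\<^sup>+x\<in>ball 0 r. ennreal (\<bar>T x\<bar> powr q) \<partial>lborel)"
        unfolding diff_integral_def by (intro arg_cong2[where f="(+)"] nn_integral_cmult) measurable
      also have "\<dots> \<le> ennreal ((1 + \<epsilon>) * 2 powr (- q)) * ennreal (B * norm (h + h) powr (\<sigma> * q))
            + ennreal E * ennreal (D * norm h powr (\<sigma> * q))"
        using D(3)[OF Suc.prems(1) h] hh h0 unfolding T_def
        by (intro add_mono mult_left_mono IH) auto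
      also have "\<dots> = ennreal ((1 + \<epsilon>) * 2 powr (- q) * (B * norm (h + h) powr (\<sigma> * q)) + E * (D * norm h powr (\<sigma> * q)))"
        using e E B0 D by (simp add: ennreal_mult')
      also have "\<dots> \<le> ennreal (B * norm h powr (\<sigma> * q))"
      proof (rule ennreal_leI)
        have "2 powr (- q) * 2 powr (\<sigma> * q) = 1 / L"
          unfolding L_def powr_minus_divide[symmetric] powr_add[symmetric] by (simp add: algebra_simps)
        moreover have "(2 * norm h) powr (\<sigma> * q) = 2 powr (\<sigma> * q) * norm h powr (\<sigma> * q)" by (subst powr_mult) auto
        ultimately have "(1 + \<epsilon>) * 2 powr (- q) * (B * norm (h + h) powr (\<sigma> * q)) = (1 + \<epsilon>) * (1 / L) * B * norm h powr (\<sigma> * q)"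
          unfolding n2 by (metis (no_types, opaque_lifting) mult.assoc mult.commute)
        then have "(1 + \<epsilon>) * 2 powr (- q) * (B * norm (h + h) powr (\<sigma> * q)) = \<kappa> * B * norm h powr (\<sigma> * q)"
          by (simp add: \<kappa>_def)
        moreover have "E * D \<le> (1 - \<kappa>) * B"
        proof -
          have "E * D / (1 - \<kappa>) \<le> B" by (simp add: B_def)
          then show ?thesis using \<kappa> by (simp add: divide_le_eq mult.commute)
        qed
        then have "E * (D * norm h powr (\<sigma> * q)) \<le> (1 - \<kappa>) * B * norm h powr (\<sigma> * q)"
          by (simp add: mult.assoc[symmetric] mult_right_mono)
        ultimately show "(1 + \<epsilon>) * 2 powr (- q) * (B * norm (h + h) powr (\<sigma> * q)) + E * (D * norm h powr (\<sigma> * q)) \<le> B * norm h powr (\<sigma> * q)"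
          by (simp add: algebra_simps)
      qed
      finally show ?thesis .
    qed
  qed
  show "\<exists>C\<ge>0. \<forall>u\<in>U. \<forall>h. norm h < 1 - r \<longrightarrow> diff_integral q u h r \<le> ennreal (C * norm h powr (\<sigma> * q))"
  proof (intro exI[of _ B] conjI B0 ballI allI impI)
    fix u and h :: "real^'n" assume u: "u \<in> U" "norm h < 1 - r"
    show "diff_integral q u h r \<le> ennreal (B * norm h powr (\<sigma> * q))"
    proof (cases "h = 0")
      case False
      obtain k where "h0 / norm h < 2 ^ k" using real_arch_pow[of 2 "h0 / norm h"] by auto
      then have "h0 / 2 ^ k \<le> norm h" using False by (simp add: field_simps)
      then show ?thesis by (rule claim[OF u])
    qed simp
  qed
qed

text \<open>
  To estimate \<open>f (x + h) - f x\<close>, insert \<open>f (x + \<zeta>)\<close> and average over \<open>\<zeta>\<close> in the ball of radius \<open>\<bar>h\<bar>\<close>. Both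
  resulting increments have length less than \<open>2 \<bar>h\<bar>\<close>, where the kernel is at least
  \<open>(2 \<bar>h\<bar>)\<^sup>-\<^sup>N\<^sup>-\<^sup>s\<^sup>p\<close>.
\<close>

lemma nikolskii_of_gagliardo:
  fixes s p q :: real
  assumes q: "0 < q" and sp: "0 < s * p"
  obtains C where "0 < C"
    "\<And>(f :: real^'n \<Rightarrow> real) h r. f \<in> borel_measurable borel \<Longrightarrow> h \<noteq> 0 \<Longrightarrow>
       diff_integral q f h r \<le> ennreal (C * norm h powr (s * p)) *
         (\<integral>\<^sup>+z\<in>ball 0 (2 * norm h). ennreal (kern s p z) * diff_integral q f z (r + norm h) \<partial>lborel)"
proof -
  define m where "m = real CARD('n) + s * p"
  define V where "V = unit_ball_vol CARD('n)"
  have V: "0 < V" by (simp add: V_def)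
  define C where "C = 2 * 2 powr q * 2 powr m / V"
  show thesis
  proof (rule that[of C])
    show "0 < C" using V by (simp add: C_def)
    fix f :: "real^'n \<Rightarrow> real" and h :: "real^'n" and r :: real
    assume [measurable]: "f \<in> borel_measurable borel" and h: "h \<noteq> 0"
    define \<Phi> where "\<Phi> z = diff_integral q f z (r + norm h)" for z
    have [measurable]: "\<Phi> \<in> borel_measurable borel"
      unfolding \<Phi>_def[abs_def] diff_integral_def by measurable
    define A where "A = (\<integral>\<^sup>+z\<in>ball 0 (2 * norm h). \<Phi> z \<partial>lborel)"
    let ?c = "ennreal (2 powr q)"
    \<comment> \<open>compare both end points with an intermediate point\<close>
    have inner: "diff_integral q f h r \<le> ?c * \<Phi> (\<zeta> - h) + ?c * \<Phi> \<zeta>" for \<zeta>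
    proof -
      have pt: "ennreal (\<bar>f (x + h) - f x\<bar> powr q) * indicator (ball 0 r) x
        \<le> ?c * (ennreal (\<bar>f (x + h + (\<zeta> - h)) - f (x + h)\<bar> powr q) * indicator (ball 0 (r + norm h)) (x + h))
          + ?c * (ennreal (\<bar>f (x + \<zeta>) - f x\<bar> powr q) * indicator (ball 0 (r + norm h)) x)" for x
      proof (cases "norm x < r")
        case True
        have "norm (x + h) < r + norm h" "norm x < r + norm h"
          using True norm_triangle_ineq[of x h] norm_ge_zero[of h] by linarith+
        moreover have "\<bar>f (x + h) - f x\<bar> powr q \<le> 2 powr q * (\<bar>f (x + h + (\<zeta> - h)) - f (x + h)\<bar> powr q) + 2 powr q * (\<bar>f (x + \<zeta>) - f x\<bar> powr q)"
          using powr_add_le[of q "f (x + h) - f (x + \<zeta>)" "f (x + \<zeta>) - f x"] q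
          by (simp add: abs_minus_commute distrib_left)
        ultimately show ?thesis using True
          by (simp add: ennreal_leI ennreal_mult'[symmetric] flip: ennreal_plus)
      qed simp
      have "diff_integral q f h r \<le> (\<integral>\<^sup>+x. ?c * (ennreal (\<bar>f (x + h + (\<zeta> - h)) - f (x + h)\<bar> powr q) * indicator (ball 0 (r + norm h)) (x + h))
          + ?c * (ennreal (\<bar>f (x + \<zeta>) - f x\<bar> powr q) * indicator (ball 0 (r + norm h)) x) \<partial>lborel)"
        unfolding diff_integral_def by (rule nn_integral_mono) (rule pt)
      also have "\<dots> = (\<integral>\<^sup>+x. ?c * (ennreal (\<bar>f (x + h + (\<zeta> - h)) - f (x + h)\<bar> powr q) * indicator (ball 0 (r + norm h)) (x + h)) \<partial>lborel)
          + (\<integral>\<^sup>+x. ?c * (ennreal (\<bar>f (x + \<zeta>) - f x\<bar> powr q) * indicator (ball 0 (r + norm h)) x) \<partial>lborel)"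
        by (rule nn_integral_add) measurable
      also have "\<dots> = (\<integral>\<^sup>+x. ?c * (ennreal (\<bar>f (x + (\<zeta> - h)) - f x\<bar> powr q) * indicator (ball 0 (r + norm h)) x) \<partial>lborel)
          + (\<integral>\<^sup>+x. ?c * (ennreal (\<bar>f (x + \<zeta>) - f x\<bar> powr q) * indicator (ball 0 (r + norm h)) x) \<partial>lborel)"
        by (subst nn_integral_shift[where h=h and f="\<lambda>x. ?c * (ennreal (\<bar>f (x + (\<zeta> - h)) - f x\<bar> powr q) * indicator (ball 0 (r + norm h)) x)", symmetric]) auto
      also have "\<dots> = ?c * \<Phi> (\<zeta> - h) + ?c * \<Phi> \<zeta>"
        unfolding \<Phi>_def diff_integral_def by (intro arg_cong2[where f="(+)"] nn_integral_cmult) measurable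
      finally show ?thesis .
    qed
    have "diff_integral q f h r * emeasure lborel (ball (0::real^'n) (norm h))
        = (\<integral>\<^sup>+\<zeta>. diff_integral q f h r * indicator (ball (0::real^'n) (norm h)) \<zeta> \<partial>lborel)"
      by (rule nn_integral_cmult_indicator[symmetric]) simp
    also have "\<dots> \<le> (\<integral>\<^sup>+\<zeta>. ?c * (\<Phi> (\<zeta> - h) * indicator (ball 0 (2 * norm h)) (\<zeta> - h)) + ?c * (\<Phi> \<zeta> * indicator (ball 0 (2 * norm h)) \<zeta>) \<partial>lborel)"
    proof (rule nn_integral_mono)
      fix \<zeta> :: "real^'n"
      show "diff_integral q f h r * indicator (ball 0 (norm h)) \<zeta> \<le> ?c * (\<Phi> (\<zeta> - h) * indicator (ball 0 (2 * norm h)) (\<zeta> - h)) + ?c * (\<Phi> \<zeta> * indicator (ball 0 (2 * norm h)) \<zeta>)"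
      proof (cases "norm \<zeta> < norm h")
        case True
        have "norm (\<zeta> - h) < 2 * norm h" "norm \<zeta> < 2 * norm h"
          using True norm_triangle_ineq4[of \<zeta> h] norm_ge_zero[of h] by linarith+
        then show ?thesis using True inner[of \<zeta>] by simp
      qed simp
    qed
    also have "\<dots> = (\<integral>\<^sup>+\<zeta>. ?c * (\<Phi> (\<zeta> - h) * indicator (ball 0 (2 * norm h)) (\<zeta> - h)) \<partial>lborel) + (\<integral>\<^sup>+\<zeta>. ?c * (\<Phi> \<zeta> * indicator (ball 0 (2 * norm h)) \<zeta>) \<partial>lborel)"
      by (rule nn_integral_add) measurable
    also have "\<dots> = (\<integral>\<^sup>+\<zeta>. ?c * (\<Phi> \<zeta> * indicator (ball 0 (2 * norm h)) \<zeta>) \<partial>lborel) + (\<integral>\<^sup>+\<zeta>. ?c * (\<Phi> \<zeta> * indicator (ball 0 (2 * norm h)) \<zeta>) \<partial>lborel)"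
      using nn_integral_shift[where h="-h" and f="\<lambda>\<zeta>. ?c * (\<Phi> \<zeta> * indicator (ball 0 (2 * norm h)) \<zeta>)"] by simp
    also have "(\<integral>\<^sup>+\<zeta>. ?c * (\<Phi> \<zeta> * indicator (ball 0 (2 * norm h)) \<zeta>) \<partial>lborel) = ?c * A"
      unfolding A_def by (rule nn_integral_cmult) measurable
    also have "?c * A + ?c * A = ennreal (2 * 2 powr q) * A"
      by (simp add: ennreal_mult mult_2[symmetric] mult.assoc flip: ennreal_numeral)
    finally have 1: "diff_integral q f h r * emeasure lborel (ball (0::real^'n) (norm h)) \<le> ennreal (2 * 2 powr q) * A" .
    define K where "K = (\<integral>\<^sup>+z\<in>ball 0 (2 * norm h). ennreal (kern s p z) * \<Phi> z \<partial>lborel)"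
    have "A \<le> (\<integral>\<^sup>+z. ennreal ((2 * norm h) powr m) * (ennreal (kern s p z) * \<Phi> z * indicator (ball 0 (2 * norm h)) z) \<partial>lborel)"
      unfolding A_def
    proof (rule nn_integral_mono)
      fix z :: "real^'n"
      show "\<Phi> z * indicator (ball 0 (2 * norm h)) z \<le> ennreal ((2 * norm h) powr m) * (ennreal (kern s p z) * \<Phi> z * indicator (ball 0 (2 * norm h)) z)"
      proof (cases "z \<noteq> 0 \<and> norm z < 2 * norm h")
        case True
        have "1 = norm z powr m * norm z powr (- m)" using True by (simp add: powr_add[symmetric])
        also have "\<dots> \<le> (2 * norm h) powr m * norm z powr (- m)"
          using True sp by (intro mult_right_mono powr_mono2) (auto simp: m_def)
        finally have "ennreal 1 \<le> ennreal ((2 * norm h) powr m * kern s p z)"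
          by (intro ennreal_leI) (simp add: kern_def m_def)
        then have "1 * \<Phi> z \<le> ennreal ((2 * norm h) powr m * kern s p z) * \<Phi> z" by (intro mult_right_mono) auto
        then show ?thesis using True by (simp add: ennreal_mult mult.assoc)
      next
        case False
        then show ?thesis by (auto simp: \<Phi>_def)
      qed
    qed
    also have "\<dots> = ennreal ((2 * norm h) powr m) * K"
      unfolding K_def by (rule nn_integral_cmult) measurable
    finally have 2: "A \<le> ennreal ((2 * norm h) powr m) * K" .
    have hN: "0 < V * norm h powr CARD('n)" using V h by simp
    have "diff_integral q f h r = diff_integral q f h r * ennreal (V * norm h powr CARD('n)) * ennreal (1 / (V * norm h powr CARD('n)))"
    proof -
      have "ennreal (V * norm h powr CARD('n)) * ennreal (1 / (V * norm h powr CARD('n))) = 1"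
        using hN by (subst ennreal_mult[symmetric]) auto
      then show ?thesis by (simp only: mult.assoc mult_1_right)
    qed
    also have "\<dots> \<le> ennreal (2 * 2 powr q) * (ennreal ((2 * norm h) powr m) * K) * ennreal (1 / (V * norm h powr CARD('n)))"
    proof (rule mult_right_mono)
      have "diff_integral q f h r * ennreal (V * norm h powr CARD('n)) \<le> ennreal (2 * 2 powr q) * A"
        using 1 by (simp add: emeasure_ball_dim V_def)
      also have "\<dots> \<le> ennreal (2 * 2 powr q) * (ennreal ((2 * norm h) powr m) * K)" by (rule mult_left_mono[OF 2]) simp
      finally show "diff_integral q f h r * ennreal (V * norm h powr CARD('n)) \<le> ennreal (2 * 2 powr q) * (ennreal ((2 * norm h) powr m) * K)" .
    qed simp
    also have "\<dots> = ennreal (2 * 2 powr q * (2 * norm h) powr m * (1 / (V * norm h powr CARD('n)))) * K"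
    proof -
      have "ennreal a * (ennreal b * K) * ennreal c = ennreal (a * b * c) * K" if "0 \<le> a" "0 \<le> b" "0 \<le> c" for a b c :: real
        using that by (simp add: ennreal_mult mult_ac)
      then show ?thesis using hN by simp
    qed
    also have "2 * 2 powr q * (2 * norm h) powr m * (1 / (V * norm h powr CARD('n))) = C * norm h powr (s * p)"
    proof -
      have "norm h powr m = norm h powr CARD('n) * norm h powr (s * p)" by (simp add: m_def powr_add)
      then show ?thesis using h V by (simp add: C_def powr_mult)
    qed
    finally show "diff_integral q f h r \<le> ennreal (C * norm h powr (s * p)) *
         (\<integral>\<^sup>+z\<in>ball 0 (2 * norm h). ennreal (kern s p z) * diff_integral q f z (r + norm h) \<partial>lborel)"
      unfolding K_def \<Phi>_def .
  qed
qed

section \<open>Test functions built from differences\<close>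

lemma powr_mult_le_sum:
  fixes x y :: real
  assumes "0 \<le> x" "0 \<le> y" "0 \<le> a" "0 \<le> b"
  shows "x powr a * y powr b \<le> x powr (a + b) + y powr (a + b)"
proof -
  have "x powr a * y powr b \<le> max x y powr a * max x y powr b"
    using assms by (intro mult_mono powr_mono2) auto
  also have "\<dots> = max x y powr (a + b)" by (simp add: powr_add)
  also have "\<dots> \<le> x powr (a + b) + y powr (a + b)" by (auto simp: max_def)
  finally show ?thesis .
qed

lemma nn_integral_le_integral_plus:
  fixes G E L :: "'a \<Rightarrow> real"
  assumes G: "integrable M G" and [measurable]: "E \<in> borel_measurable M"
    and E0: "\<And>x. 0 \<le> E x" and L: "\<And>x. 0 \<le> L x" "\<And>x. L x \<le> G x + E x"
  shows "(\<integral>\<^sup>+x. ennreal (L x) \<partial>M) \<le> ennreal \<bar>\<integral>x. G x \<partial>M\<bar> + (\<integral>\<^sup>+x. ennreal (E x) \<partial>M)"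
proof (cases "(\<integral>\<^sup>+x. ennreal (E x) \<partial>M) = \<infinity>")
  case False
  then have E: "integrable M E"
    using E0 by (intro integrableI_nonneg) (auto simp: less_top)
  have GE: "0 \<le> G x + E x" for x using L[of x] by linarith
  have "(\<integral>\<^sup>+x. ennreal (L x) \<partial>M) \<le> (\<integral>\<^sup>+x. ennreal (G x + E x) \<partial>M)"
    by (intro nn_integral_mono ennreal_leI L)
  also have "\<dots> = ennreal (\<integral>x. G x + E x \<partial>M)"
    using G E GE by (intro nn_integral_eq_integral) auto
  also have "\<dots> = ennreal ((\<integral>x. G x \<partial>M) + (\<integral>x. E x \<partial>M))" using G E by simp
  also have "\<dots> \<le> ennreal (\<bar>\<integral>x. G x \<partial>M\<bar> + (\<integral>x. E x \<partial>M))" by (intro ennreal_leI) simp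
  also have "\<dots> = ennreal \<bar>\<integral>x. G x \<partial>M\<bar> + ennreal (\<integral>x. E x \<partial>M)"
    using E0 by (intro ennreal_plus) (auto intro: integral_nonneg_AE)
  also have "ennreal (\<integral>x. E x \<partial>M) = (\<integral>\<^sup>+x. ennreal (E x) \<partial>M)"
    using E E0 by (intro nn_integral_eq_integral[symmetric]) auto
  finally show ?thesis .
qed simp

lemma nn_integral_ball_shift_le:
  fixes g :: "real^'n \<Rightarrow> ennreal"
  assumes [measurable]: "g \<in> borel_measurable borel" and r: "r + norm k \<le> r'"
  shows "(\<integral>\<^sup>+x\<in>ball 0 r. g (x + k) \<partial>lborel) \<le> (\<integral>\<^sup>+x\<in>ball 0 r'. g x \<partial>lborel)"
proof -
  have "(\<integral>\<^sup>+x\<in>ball 0 r. g (x + k) \<partial>lborel) \<le> (\<integral>\<^sup>+x. g (x + k) * indicator (ball 0 r') (x + k) \<partial>lborel)"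
  proof (rule nn_integral_mono)
    fix x :: "real^'n"
    show "g (x + k) * indicator (ball 0 r) x \<le> g (x + k) * indicator (ball 0 r') (x + k)"
      using norm_triangle_ineq[of x k] r by (auto simp: indicator_def)
  qed
  also have "\<dots> = (\<integral>\<^sup>+x\<in>ball 0 r'. g x \<partial>lborel)"
    by (rule nn_integral_shift) measurable
  finally show ?thesis .
qed

text \<open>
  Equal to \<open>1\<close> on the ball of radius \<open>r + d\<close>, supported in the ball of radius \<open>r + 2 d\<close>, and
  Lipschitz with constant \<open>1 / d\<close>.
\<close>

definition cutoff :: "real \<Rightarrow> real \<Rightarrow> real^'n \<Rightarrow> real" where
  "cutoff r d x = max 0 (min 1 ((r + 2 * d - norm x) / d))"

lemma cutoff_borel [measurable]: "cutoff r d \<in> borel_measurable borel"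
  unfolding cutoff_def[abs_def] by measurable

lemma cutoff_bounds: "0 \<le> cutoff r d x" "cutoff r d x \<le> 1"
  by (auto simp: cutoff_def)

lemma cutoff_eq_1: "0 < d \<Longrightarrow> norm x \<le> r + d \<Longrightarrow> cutoff r d x = 1"
  by (auto simp: cutoff_def max_def min_def field_simps)

lemma cutoff_eq_0: "0 < d \<Longrightarrow> r + 2 * d \<le> norm x \<Longrightarrow> cutoff r d x = 0"
  by (auto simp: cutoff_def max_def min_def field_simps)

lemma cutoff_lipschitz:
  assumes d: "0 < d"
  shows "\<bar>cutoff r d x - cutoff r d y\<bar> \<le> norm (x - y) / d"
proof -
  have *: "\<bar>max 0 (min 1 a) - max 0 (min 1 b)\<bar> \<le> \<bar>a - b\<bar>" for a b :: real
    by (auto simp: max_def min_def)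
  have "\<bar>cutoff r d x - cutoff r d y\<bar> \<le> \<bar>(r + 2 * d - norm x) / d - (r + 2 * d - norm y) / d\<bar>"
    unfolding cutoff_def by (rule *)
  also have "\<dots> = \<bar>norm y - norm x\<bar> / d" using d by (simp add: diff_divide_distrib[symmetric])
  also have "\<dots> \<le> norm (x - y) / d"
    using d norm_triangle_ineq3[of y x] by (intro divide_right_mono) (auto simp: norm_minus_commute)
  finally show ?thesis .
qed

text \<open>
  Any power of \<open>\<bar>z\<bar>\<close> above \<open>s p\<close> makes the kernel integrable near the origin. It is applied with
  exponent \<open>p\<close> for Lipschitz functions and with exponent \<open>2 + \<sigma> (p - 2)\<close> for the error term.
\<close>

lemma nn_integral_kern_powr_finite:
  fixes s p :: real
  assumes "0 < \<epsilon>" and a: "a = s * p + \<epsilon>" and s: "0 < s * p"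
  shows "(\<integral>\<^sup>+z\<in>ball (0::real^'n) 2. ennreal (norm z powr a * kern s p z) \<partial>lborel) < \<infinity>"
proof -
  have eq: "norm z powr a * kern s p z = norm z powr (\<epsilon> - CARD('n))" for z :: "real^'n"
    by (simp add: kern_def powr_add[symmetric] a)
  let ?c = "ennreal (2 powr \<epsilon>)"
  have "(\<integral>\<^sup>+z\<in>ball (0::real^'n) 2. ennreal (norm z powr a * kern s p z) \<partial>lborel)
     \<le> (\<integral>\<^sup>+z. ennreal (norm z powr (\<epsilon> - CARD('n))) * indicator (ball (0::real^'n) 1) z + ?c * indicator (ball 0 2) z \<partial>lborel)"
  proof (rule nn_integral_mono)
    fix z :: "real^'n"
    show "ennreal (norm z powr a * kern s p z) * indicator (ball 0 2) z
      \<le> ennreal (norm z powr (\<epsilon> - CARD('n))) * indicator (ball (0::real^'n) 1) z + ?c * indicator (ball 0 2) z"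
    proof (cases "norm z < 1 \<or> 2 \<le> norm z")
      case False
      then have "norm z powr (\<epsilon> - CARD('n)) \<le> norm z powr \<epsilon>" by (intro powr_mono) auto
      also have "\<dots> \<le> 2 powr \<epsilon>" using False assms by (intro powr_mono2) auto
      finally show ?thesis unfolding eq using False by (auto simp: ennreal_leI)
    next
      case True
      then show ?thesis unfolding eq by (auto simp: indicator_def)
    qed
  qed
  also have "\<dots> = (\<integral>\<^sup>+z. ennreal (norm z powr (\<epsilon> - CARD('n))) * indicator (ball (0::real^'n) 1) z \<partial>lborel) + (\<integral>\<^sup>+z. ?c * indicator (ball (0::real^'n) 2) z \<partial>lborel)"
    by (rule nn_integral_add) measurable
  also have "(\<integral>\<^sup>+z. ?c * indicator (ball (0::real^'n) 2) z \<partial>lborel) = ?c * emeasure lborel (ball (0::real^'n) 2)"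
    by (rule nn_integral_cmult_indicator) simp
  also have "(\<integral>\<^sup>+z. ennreal (norm z powr (\<epsilon> - CARD('n))) * indicator (ball (0::real^'n) 1) z \<partial>lborel) + ?c * emeasure lborel (ball (0::real^'n) 2) < \<infinity>"
    using nn_integral_norm_powr_ball[OF assms(1), where 'n='n]
    by (simp add: emeasure_ball_dim ennreal_mult_less_top)
  finally show ?thesis .
qed

lemma gagliardo_shift_le:
  fixes u :: "real^'n \<Rightarrow> real"
  assumes [measurable]: "u \<in> borel_measurable borel" and t: "t + norm a \<le> 1"
  shows "gagliardo s p (ball 0 t) (\<lambda>x. u (x + a)) \<le> gagliardo s p (ball 0 1) u"
proof -
  let ?F = "\<lambda>z. ennreal (\<bar>u (fst z) - u (snd z)\<bar> powr p * kern s p (fst z - snd z))"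
  have [measurable]: "ball (0::real^'n) t' \<times> ball (0::real^'n) t' \<in> sets borel" for t'
    by (intro borel_open open_Times) auto
  have "gagliardo s p (ball 0 t) (\<lambda>x. u (x + a)) \<le> (\<integral>\<^sup>+z. ?F (z + (a, a)) * indicator (ball 0 1 \<times> ball 0 1) (z + (a, a)) \<partial>lborel)"
    unfolding gagliardo_def
  proof (rule nn_integral_mono)
    fix z :: "(real^'n) \<times> (real^'n)"
    show "ennreal (\<bar>u (fst z + a) - u (snd z + a)\<bar> powr p * kern s p (fst z - snd z)) * indicator (ball 0 t \<times> ball 0 t) z
      \<le> ?F (z + (a, a)) * indicator (ball 0 1 \<times> ball 0 1) (z + (a, a))"
    proof (cases "z \<in> ball 0 t \<times> ball 0 t")
      case True
      then have "norm (fst z + a) < 1" "norm (snd z + a) < 1"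
        using t norm_triangle_ineq[of "fst z" a] norm_triangle_ineq[of "snd z" a] by (auto simp: mem_Times_iff)
      then have "z + (a, a) \<in> ball 0 1 \<times> ball 0 1" by (simp add: mem_Times_iff)
      then show ?thesis using True by simp
    qed simp
  qed
  also have "\<dots> = (\<integral>\<^sup>+z. ?F z * indicator (ball 0 1 \<times> ball 0 1) z \<partial>lborel)"
    by (rule nn_integral_shift) measurable
  finally show ?thesis unfolding gagliardo_def .
qed

lemma gagliardo_norm_finite:
  fixes s p :: real
  assumes s: "0 < s" "s < 1" and p: "0 < p" and t: "t \<le> 1"
  shows "(\<integral>\<^sup>+z\<in>ball (0::real^'n) t \<times> ball (0::real^'n) t. ennreal (norm (fst z - snd z) powr p * kern s p (fst z - snd z)) \<partial>lborel) < \<infinity>"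
proof -
  let ?k = "\<lambda>z::real^'n. ennreal (norm z powr p * kern s p z)"
  have [measurable]: "ball (0::real^'n) t' \<times> ball (0::real^'n) t' \<in> sets borel" for t'
    by (intro borel_open open_Times) auto
  have "(\<integral>\<^sup>+z\<in>ball (0::real^'n) t \<times> ball (0::real^'n) t. ?k (fst z - snd z) \<partial>lborel)
     = (\<integral>\<^sup>+z. \<integral>\<^sup>+x. ?k (x - (x + z)) * indicator (ball 0 t \<times> ball 0 t) (x, x + z) \<partial>lborel \<partial>lborel)"
    by (subst nn_integral_pair_diff) auto
  also have "\<dots> \<le> (\<integral>\<^sup>+z. \<integral>\<^sup>+x. (?k z * indicator (ball 0 2) z) * indicator (ball (0::real^'n) 1) x \<partial>lborel \<partial>lborel)"
  proof (intro nn_integral_mono)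
    fix z x :: "real^'n"
    show "?k (x - (x + z)) * indicator (ball 0 t \<times> ball 0 t) (x, x + z) \<le> (?k z * indicator (ball 0 2) z) * indicator (ball 0 1) x"
    proof (cases "norm x < t \<and> norm (x + z) < t")
      case True
      then have "norm z < 2" using norm_triangle_ineq4[of "x + z" x] t by auto
      then show ?thesis using True t by simp
    qed auto
  qed
  also have "\<dots> = (\<integral>\<^sup>+z. (?k z * indicator (ball 0 2) z) * emeasure lborel (ball (0::real^'n) 1) \<partial>lborel)"
    by (intro nn_integral_cong nn_integral_cmult_indicator) simp
  also have "\<dots> = (\<integral>\<^sup>+z. ?k z * indicator (ball 0 2) z \<partial>lborel) * emeasure lborel (ball (0::real^'n) 1)"
    by (rule nn_integral_multc) measurable
  also have "\<dots> < \<infinity>"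
    using nn_integral_kern_powr_finite[of "p - s * p" p s p, where 'n='n] s p
    by (simp add: emeasure_ball_dim ennreal_mult_less_top mult_less_cancel_right2)
  finally show ?thesis .
qed

text \<open>
  A function whose increments are dominated by those of translates of \<open>u\<close> and of the identity inherits
  the finite seminorm of \<open>u\<close>; the condition \<open>s < 1\<close> enters through the increments of the identity.
\<close>

lemma admissible_lipschitz_combination:
  fixes u f :: "real^'n \<Rightarrow> real"
  assumes u: "normalized s p u" and s: "0 < s" "s < 1" and p: "0 < p"
    and [measurable]: "f \<in> borel_measurable borel" and B: "\<And>x. \<bar>f x\<bar> \<le> B"
    and t: "0 < t" "t < t'" "t' < 1" and supp: "\<And>x. t < norm x \<Longrightarrow> f x = 0"
    and ab: "t' + norm a \<le> 1" "t' + norm b \<le> 1" and K0: "0 \<le> K"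
    and lip: "\<And>x y. norm x < t' \<Longrightarrow> norm y < t' \<Longrightarrow>
       \<bar>f x - f y\<bar> \<le> K * (\<bar>u (x + a) - u (y + a)\<bar> + \<bar>u (x + b) - u (y + b)\<bar> + norm (x - y))"
  shows "admissible s p f"
proof -
  note [measurable] = normalizedD(1)[OF u]
  have [measurable]: "ball (0::real^'n) t' \<times> ball (0::real^'n) t' \<in> sets borel" for t'
    by (intro borel_open open_Times) auto
  let ?c = "ennreal (K powr p * (2 powr p * 2 powr p))"
  let ?I = "\<lambda>z. indicator (ball (0::real^'n) t' \<times> ball (0::real^'n) t') z :: ennreal"
  let ?A = "\<lambda>a z. ennreal (\<bar>u (fst z + a) - u (snd z + a)\<bar> powr p * kern s p (fst z - snd z)) * ?I z"
  let ?N = "\<lambda>z. ennreal (norm (fst z - snd z) powr p * kern s p (fst z - snd z)) * ?I z"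
  have pt: "ennreal (\<bar>f (fst z) - f (snd z)\<bar> powr p * kern s p (fst z - snd z)) * ?I z
    \<le> ?c * (?A a z + (?A b z + ?N z))" for z
  proof (cases "z \<in> ball 0 t' \<times> ball 0 t'")
    case True
    define X where "X = \<bar>u (fst z + a) - u (snd z + a)\<bar>"
    define Y where "Y = \<bar>u (fst z + b) - u (snd z + b)\<bar>"
    define Z where "Z = norm (fst z - snd z)"
    define k where "k = kern s p (fst z - snd z)"
    have k: "0 \<le> k" by (simp add: k_def)
    have XYZ: "0 \<le> X" "0 \<le> Y" "0 \<le> Z" by (auto simp: X_def Y_def Z_def)
    have "\<bar>f (fst z) - f (snd z)\<bar> \<le> K * (X + Y + Z)"
      using True lip[of "fst z" "snd z"] by (simp add: X_def Y_def Z_def mem_Times_iff)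
    then have "\<bar>f (fst z) - f (snd z)\<bar> powr p \<le> (K * (X + Y + Z)) powr p" using p by (intro powr_mono2) auto
    also have "\<dots> = K powr p * (X + Y + Z) powr p" using K0 XYZ by (subst powr_mult) auto
    also have "(X + Y + Z) powr p \<le> 2 powr p * 2 powr p * (X powr p + (Y powr p + Z powr p))"
    proof -
      have "(X + (Y + Z)) powr p \<le> 2 powr p * (X powr p + (Y + Z) powr p)"
        using powr_add_le[of p X "Y + Z"] p XYZ by simp
      also have "\<dots> \<le> 2 powr p * (2 powr p * X powr p + 2 powr p * (Y powr p + Z powr p))"
        using powr_add_le[of p Y Z] p XYZ ge_one_powr_ge_zero[of 2 p]
        by (intro mult_left_mono add_mono) (auto simp: mult_le_cancel_right1)
      finally show ?thesis by (simp add: algebra_simps)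
    qed
    finally have "\<bar>f (fst z) - f (snd z)\<bar> powr p \<le> K powr p * (2 powr p * 2 powr p * (X powr p + (Y powr p + Z powr p)))"
      by (simp add: mult_left_mono)
    then have "\<bar>f (fst z) - f (snd z)\<bar> powr p * k \<le> K powr p * (2 powr p * 2 powr p * (X powr p + (Y powr p + Z powr p))) * k"
      using k by (rule mult_right_mono)
    then have "\<bar>f (fst z) - f (snd z)\<bar> powr p * k \<le> (K powr p * (2 powr p * 2 powr p)) * (X powr p * k + (Y powr p * k + Z powr p * k))"
      by (simp add: algebra_simps)
    then have "ennreal (\<bar>f (fst z) - f (snd z)\<bar> powr p * k) \<le> ?c * (ennreal (X powr p * k) + (ennreal (Y powr p * k) + ennreal (Z powr p * k)))"
      using k by (simp add: ennreal_mult'[symmetric] ennreal_leI flip: ennreal_plus)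
    then show ?thesis using True by (simp add: X_def Y_def Z_def k_def)
  qed simp
  have "gagliardo s p (ball 0 t') f \<le> (\<integral>\<^sup>+z. ?c * (?A a z + (?A b z + ?N z)) \<partial>lborel)"
    unfolding gagliardo_def by (rule nn_integral_mono) (rule pt)
  also have "\<dots> = ?c * (\<integral>\<^sup>+z. ?A a z + (?A b z + ?N z) \<partial>lborel)"
    by (rule nn_integral_cmult) measurable
  also have "(\<integral>\<^sup>+z. ?A a z + (?A b z + ?N z) \<partial>lborel) = (\<integral>\<^sup>+z. ?A a z \<partial>lborel) + (\<integral>\<^sup>+z. ?A b z + ?N z \<partial>lborel)"
    by (rule nn_integral_add) measurable
  also have "(\<integral>\<^sup>+z. ?A b z + ?N z \<partial>lborel) = (\<integral>\<^sup>+z. ?A b z \<partial>lborel) + (\<integral>\<^sup>+z. ?N z \<partial>lborel)"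
    by (rule nn_integral_add) measurable
  finally have 1: "gagliardo s p (ball 0 t') f \<le> ?c * ((\<integral>\<^sup>+z. ?A a z \<partial>lborel) + ((\<integral>\<^sup>+z. ?A b z \<partial>lborel) + (\<integral>\<^sup>+z. ?N z \<partial>lborel)))" .
  have A: "(\<integral>\<^sup>+z. ?A a z \<partial>lborel) < top" if "t' + norm a \<le> 1" for a
  proof -
    have "(\<integral>\<^sup>+z. ?A a z \<partial>lborel) = gagliardo s p (ball 0 t') (\<lambda>x. u (x + a))" by (simp add: gagliardo_def)
    also have "\<dots> \<le> gagliardo s p (ball 0 1) u" by (rule gagliardo_shift_le[OF _ that]) measurable
    also have "\<dots> \<le> 1" by (rule normalizedD(3)[OF u])
    finally show ?thesis by (rule le_less_trans) simp
  qed
  have N: "(\<integral>\<^sup>+z. ?N z \<partial>lborel) < top" using gagliardo_norm_finite[OF s p, of t', where 'n='n] t by simp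
  have "gagliardo s p (ball 0 t') f < \<infinity>"
    by (rule le_less_trans[OF 1]) (use A[OF ab(1)] A[OF ab(2)] N in \<open>simp add: ennreal_mult_less_top\<close>)
  moreover have "\<exists>B. \<forall>x. \<bar>f x\<bar> \<le> B" using B by blast
  ultimately have "\<exists>t t'. 0 < t \<and> t < t' \<and> t' < 1 \<and> (\<forall>x. t < norm x \<longrightarrow> f x = 0) \<and> gagliardo s p (ball 0 t') f < \<infinity>"
    "\<exists>B. \<forall>x. \<bar>f x\<bar> \<le> B"
    using t supp by blast+
  then show ?thesis unfolding admissible_def by simp
qed

lemma spow_cutoff_diff:
  fixes W V \<eta> \<zeta> :: real
  assumes \<delta>: "1 \<le> \<delta>" and "\<bar>W\<bar> \<le> 2" "\<bar>V\<bar> \<le> 2" "0 \<le> \<eta>" "\<eta> \<le> 1" "0 \<le> \<zeta>" "\<zeta> \<le> 1"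
  shows "\<bar>spow \<delta> W * \<eta>\<^sup>2 - spow \<delta> V * \<zeta>\<^sup>2\<bar> \<le> \<delta> * 4 powr (\<delta> - 1) * \<bar>W - V\<bar> + 2 powr \<delta> * 2 * \<bar>\<eta> - \<zeta>\<bar>"
proof -
  have "spow \<delta> W * \<eta>\<^sup>2 - spow \<delta> V * \<zeta>\<^sup>2 = (spow \<delta> W - spow \<delta> V) * \<eta>\<^sup>2 + spow \<delta> V * ((\<eta> - \<zeta>) * (\<eta> + \<zeta>))"
    by (simp add: power2_eq_square algebra_simps)
  then have "\<bar>spow \<delta> W * \<eta>\<^sup>2 - spow \<delta> V * \<zeta>\<^sup>2\<bar> \<le> \<bar>spow \<delta> W - spow \<delta> V\<bar> * \<eta>\<^sup>2 + \<bar>spow \<delta> V\<bar> * (\<bar>\<eta> - \<zeta>\<bar> * (\<eta> + \<zeta>))"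
    using abs_triangle_ineq[of "(spow \<delta> W - spow \<delta> V) * \<eta>\<^sup>2" "spow \<delta> V * ((\<eta> - \<zeta>) * (\<eta> + \<zeta>))"] assms
    by (simp add: abs_mult)
  also have "\<dots> \<le> (\<delta> * 4 powr (\<delta> - 1) * \<bar>W - V\<bar>) * 1 + 2 powr \<delta> * (\<bar>\<eta> - \<zeta>\<bar> * 2)"
  proof (intro add_mono mult_mono mult_left_mono)
    have "\<bar>spow \<delta> W - spow \<delta> V\<bar> \<le> \<delta> * (\<bar>W\<bar> + \<bar>V\<bar>) powr (\<delta> - 1) * \<bar>W - V\<bar>" by (rule spow_diff_upper[OF \<delta>])
    also have "\<dots> \<le> \<delta> * 4 powr (\<delta> - 1) * \<bar>W - V\<bar>"
      using assms by (intro mult_right_mono mult_left_mono powr_mono2) auto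
    finally show "\<bar>spow \<delta> W - spow \<delta> V\<bar> \<le> \<delta> * 4 powr (\<delta> - 1) * \<bar>W - V\<bar>" .
    show "\<bar>spow \<delta> V\<bar> \<le> 2 powr \<delta>" unfolding abs_spow using assms by (intro powr_mono2) auto
    show "\<eta>\<^sup>2 \<le> 1" using assms by (simp add: power_le_one)
  qed (use assms in auto)
  finally show ?thesis by simp
qed

text \<open>
  The radius budget: the support of the cut-off reaches \<open>r + 2 d\<close>, the shift by \<open>h\<close> adds at most \<open>d / 2\<close>,
  and the differences are then evaluated inside the ball of radius \<open>r + 4 d\<close>, which leaves room in the
  unit ball of radius \<open>r + 8 d\<close>.
\<close>

lemma admissible_difference_test:
  fixes u :: "real^'n \<Rightarrow> real"
  assumes u: "normalized s p u" and s: "0 < s" "s < 1" and p: "0 < p" and \<delta>: "1 \<le> \<delta>"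
    and d: "0 < d" "r + 8 * d = 1" "0 < r" and h: "norm h < d / 2"
  defines "\<phi> \<equiv> (\<lambda>x. spow \<delta> (u (x + h) - u x) * (cutoff r d x)\<^sup>2)"
  shows "admissible s p \<phi>" "admissible s p (\<lambda>x. \<phi> (x - h))"
proof -
  note [measurable] = normalizedD(1)[OF u]
  have [measurable]: "\<phi> \<in> borel_measurable borel" unfolding \<phi>_def by measurable
  define K where "K = max (\<delta> * 4 powr (\<delta> - 1)) (2 powr \<delta> * 2 / d)"
  have K0: "0 \<le> K" using d by (simp add: K_def le_max_iff_disj)
  have w2: "\<bar>u (x + h) - u x\<bar> \<le> 2" if "norm x < r + 4 * d" for x
  proof -
    have "norm (x + h) < 1" "norm x < 1" using that h d norm_triangle_ineq[of x h] by auto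
    then have "\<bar>u (x + h)\<bar> \<le> 1" "\<bar>u x\<bar> \<le> 1" using normalizedD(2)[OF u] by auto
    then show ?thesis by linarith
  qed
  have lip: "\<bar>\<phi> x - \<phi> y\<bar> \<le> K * (\<bar>u (x + h) - u (y + h)\<bar> + \<bar>u x - u y\<bar> + norm (x - y))"
    if xy: "norm x < r + 4 * d" "norm y < r + 4 * d" for x y
  proof -
    have "\<bar>\<phi> x - \<phi> y\<bar> \<le> \<delta> * 4 powr (\<delta> - 1) * \<bar>(u (x + h) - u x) - (u (y + h) - u y)\<bar> + 2 powr \<delta> * 2 * \<bar>cutoff r d x - cutoff r d y\<bar>"
      unfolding \<phi>_def by (rule spow_cutoff_diff[OF \<delta> w2[OF xy(1)] w2[OF xy(2)] cutoff_bounds cutoff_bounds])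
    also have "\<dots> \<le> \<delta> * 4 powr (\<delta> - 1) * (\<bar>u (x + h) - u (y + h)\<bar> + \<bar>u x - u y\<bar>) + 2 powr \<delta> * 2 * (norm (x - y) / d)"
      using \<delta> d by (intro add_mono mult_left_mono cutoff_lipschitz) auto
    also have "\<dots> \<le> K * (\<bar>u (x + h) - u (y + h)\<bar> + \<bar>u x - u y\<bar>) + K * norm (x - y)"
    proof (intro add_mono mult_right_mono)
      have "2 powr \<delta> * 2 * (norm (x - y) / d) = (2 powr \<delta> * 2 / d) * norm (x - y)" by simp
      also have "\<dots> \<le> K * norm (x - y)" by (intro mult_right_mono) (auto simp: K_def)
      finally show "2 powr \<delta> * 2 * (norm (x - y) / d) \<le> K * norm (x - y)" .
    qed (auto simp: K_def)
    finally show ?thesis by (simp add: distrib_left)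
  qed
  have supp: "\<phi> x = 0" if "r + 2 * d \<le> norm x" for x
    using cutoff_eq_0[OF d(1) that] by (simp add: \<phi>_def)
  have B: "\<bar>\<phi> x\<bar> \<le> 2 powr \<delta>" for x
  proof (cases "norm x < r + 4 * d")
    case True
    have "\<bar>spow \<delta> (u (x + h) - u x)\<bar> \<le> 2 powr \<delta>" unfolding abs_spow using w2[OF True] \<delta> by (intro powr_mono2) auto
    then have "\<bar>spow \<delta> (u (x + h) - u x)\<bar> * (cutoff r d x)\<^sup>2 \<le> 2 powr \<delta> * 1"
      using cutoff_bounds[of r d x] by (intro mult_mono) (auto simp: power_le_one)
    then show ?thesis by (simp add: \<phi>_def abs_mult)
  qed (use supp d in auto)
  show "admissible s p \<phi>"
  proof (rule admissible_lipschitz_combination[OF u s p _ B, where t="r + 2 * d" and t'="r + 3 * d" and a=h and b=0 and K=K])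
    show "\<bar>\<phi> x - \<phi> y\<bar> \<le> K * (\<bar>u (x + h) - u (y + h)\<bar> + \<bar>u (x + 0) - u (y + 0)\<bar> + norm (x - y))"
      if "norm x < r + 3 * d" "norm y < r + 3 * d" for x y
      using lip[of x y] that d by simp
  qed (use d h K0 supp in auto)
  show "admissible s p (\<lambda>x. \<phi> (x - h))"
  proof (rule admissible_lipschitz_combination[OF u s p, where t="r + 5 * d / 2" and t'="r + 3 * d" and a=0 and b="- h" and K=K and B="2 powr \<delta>"])
    show "\<bar>\<phi> (x - h) - \<phi> (y - h)\<bar> \<le> K * (\<bar>u (x + 0) - u (y + 0)\<bar> + \<bar>u (x + - h) - u (y + - h)\<bar> + norm (x - y))"
      if "norm x < r + 3 * d" "norm y < r + 3 * d" for x y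
    proof -
      have "norm (x - h) < r + 4 * d" "norm (y - h) < r + 4 * d"
        using that h d norm_triangle_ineq4[of x h] norm_triangle_ineq4[of y h] by auto
      then show ?thesis using lip[of "x - h" "y - h"] by simp
    qed
    show "\<phi> (x - h) = 0" if "r + 5 * d / 2 < norm x" for x
      using that h d norm_triangle_ineq2[of x h] by (intro supp) auto
  qed (use d h K0 B in auto)
qed

section \<open>The gain of differentiability\<close>

text \<open>
  Young's inequality for exponents \<open>a\<close> and \<open>b\<close> summing up to \<open>q\<close>, with \<open>S\<close> and \<open>T\<close> measured in units of
  \<open>x\<^sup>\<sigma>\<close> and \<open>y\<^sup>\<sigma>\<close>. After integration both
  terms on the right are bounded by the assumed regularity of order \<open>\<sigma>\<close>.
\<close>

lemma weighted_young:
  fixes x y S T \<sigma> a b :: real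
  assumes "0 < x" "0 < y" "0 \<le> S" "0 \<le> T" "0 \<le> a" "0 \<le> b"
  shows "S powr a * T powr b \<le> x powr (\<sigma> * a) * y powr (\<sigma> * b) *
     (x powr (- (\<sigma> * (a + b))) * S powr (a + b) + y powr (- (\<sigma> * (a + b))) * T powr (a + b))"
proof -
  have sc: "t powr (\<sigma> * c) * (S / t powr \<sigma>) powr c = S powr c"
      "(S / t powr \<sigma>) powr c = t powr (- (\<sigma> * c)) * S powr c" if "0 < t" "0 \<le> S" for t c S :: real
  proof -
    have e: "(S / t powr \<sigma>) powr c = S powr c / t powr (\<sigma> * c)"
      using that by (simp add: powr_divide powr_powr)
    show "t powr (\<sigma> * c) * (S / t powr \<sigma>) powr c = S powr c" using that by (simp add: e)
    show "(S / t powr \<sigma>) powr c = t powr (- (\<sigma> * c)) * S powr c" by (simp add: e powr_minus_divide)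
  qed
  have "(S / x powr \<sigma>) powr a * (T / y powr \<sigma>) powr b \<le> (S / x powr \<sigma>) powr (a + b) + (T / y powr \<sigma>) powr (a + b)"
    using assms by (intro powr_mult_le_sum) auto
  then have le: "x powr (\<sigma> * a) * y powr (\<sigma> * b) * ((S / x powr \<sigma>) powr a * (T / y powr \<sigma>) powr b)
     \<le> x powr (\<sigma> * a) * y powr (\<sigma> * b) * ((S / x powr \<sigma>) powr (a + b) + (T / y powr \<sigma>) powr (a + b))"
    by (rule mult_left_mono) simp
  have "S powr a * T powr b = (x powr (\<sigma> * a) * (S / x powr \<sigma>) powr a) * (y powr (\<sigma> * b) * (T / y powr \<sigma>) powr b)"
    using assms by (simp only: sc(1))
  also have "\<dots> = x powr (\<sigma> * a) * y powr (\<sigma> * b) * ((S / x powr \<sigma>) powr a * (T / y powr \<sigma>) powr b)" by (simp only: mult_ac)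
  also note le
  finally show ?thesis using assms by (simp only: sc(2))
qed

lemma nn_integral_combination:
  assumes [measurable]: "a \<in> borel_measurable M" "b \<in> borel_measurable M" "a' \<in> borel_measurable M" "b' \<in> borel_measurable M"
  shows "(\<integral>\<^sup>+x. c * (a x + b x) + c' * (a' x + b' x) \<partial>M)
     = c * ((\<integral>\<^sup>+x. a x \<partial>M) + (\<integral>\<^sup>+x. b x \<partial>M)) + c' * ((\<integral>\<^sup>+x. a' x \<partial>M) + (\<integral>\<^sup>+x. b' x \<partial>M))"
  by (simp add: nn_integral_add nn_integral_cmult)

text \<open>
  What the cut-off costs in \<open>caccioppoli_pointwise\<close> for the first difference of \<open>u\<close> with step \<open>h\<close>.
\<close>

definition cutoff_error :: "real \<Rightarrow> real \<Rightarrow> real \<Rightarrow> real \<Rightarrow> real \<Rightarrow> (real^'n \<Rightarrow> real) \<Rightarrow> real^'n \<Rightarrow> (real^'n) \<times> (real^'n) \<Rightarrow> real" where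
  "cutoff_error s p q r d u h z =
     (\<bar>u (fst z + h) - u (snd z + h)\<bar> + \<bar>u (fst z) - u (snd z)\<bar>) powr (p - 2)
       * (\<bar>u (fst z + h) - u (fst z)\<bar> + \<bar>u (snd z + h) - u (snd z)\<bar>) powr (q - p + 2)
       * (cutoff r d (fst z) - cutoff r d (snd z))\<^sup>2 * near_kern s p d (fst z - snd z)"

text \<open>
  The term in which the cut-off is differenced. The cut-off yields \<open>\<bar>z\<bar>\<^sup>2 / d\<^sup>2\<close>, and by
  \<open>weighted_young\<close> the powers of differences of \<open>u\<close> yield \<open>\<bar>z\<bar>\<^sup>\<sigma>\<^sup>(\<^sup>p\<^sup>-\<^sup>2\<^sup>) \<bar>h\<bar>\<^sup>\<sigma>\<^sup>(\<^sup>q\<^sup>-\<^sup>p\<^sup>+\<^sup>2\<^sup>)\<close> times a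
  function whose integral in \<open>x\<close> is bounded. What remains is the integral over \<open>z\<close> of
  \<open>\<bar>z\<bar>\<^sup>2\<^sup>+\<^sup>\<sigma>\<^sup>(\<^sup>p\<^sup>-\<^sup>2\<^sup>)\<close> against the kernel, which converges precisely when \<open>s p - 2 < \<sigma> (p - 2)\<close>.
\<close>

lemma error_term_bound:
  fixes s p q \<sigma> r d :: real
  assumes p: "2 < p" and s: "0 < s" and q: "p \<le> q" and \<sigma>: "s * p - 2 < \<sigma> * (p - 2)"
    and d: "0 < d" "r + 8 * d = 1" "0 < r" and nik: "nikolskii {u :: real^'n \<Rightarrow> real. normalized s p u} q \<sigma>"
  obtains C where "0 \<le> C"
    "\<And>(u :: real^'n \<Rightarrow> real) h. normalized s p u \<Longrightarrow> h \<noteq> 0 \<Longrightarrow> norm h < d / 2 \<Longrightarrow>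
      (\<integral>\<^sup>+z. ennreal (cutoff_error s p q r d u h z) \<partial>lborel)
      \<le> ennreal (C * norm h powr (\<sigma> * (q - p + 2)))"
proof -
  define R where "R = r + 4 * d"
  have R: "0 < R" "R < 1" "1 - R = 4 * d" using d by (auto simp: R_def)
  obtain D where D: "0 \<le> D" "\<And>(u :: real^'n \<Rightarrow> real) h. u \<in> {u. normalized s p u} \<Longrightarrow> norm h < 1 - R \<Longrightarrow>
      diff_integral q u h R \<le> ennreal (D * norm h powr (\<sigma> * q))"
    by (rule nikolskiiE[OF nik R(1,2)]) (rule that)
  have sp: "0 < s * p" using s p by simp
  define a where "a = 2 + \<sigma> * (p - 2)"
  define I where "I = (\<integral>\<^sup>+z\<in>ball (0::real^'n) 2. ennreal (norm z powr a * kern s p z) \<partial>lborel)"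
  have I: "I < \<infinity>"
    unfolding I_def by (rule nn_integral_kern_powr_finite[where \<epsilon>="a - s * p"]) (use \<sigma> sp in \<open>auto simp: a_def\<close>)
  define c where "c = 2 powr q / d\<^sup>2"
  have c0: "0 \<le> c" by (simp add: c_def)
  show thesis
  proof (rule that[of "4 * D * c * enn2real I"])
    show "0 \<le> 4 * D * c * enn2real I" using D c0 by simp
    fix u :: "real^'n \<Rightarrow> real" and h :: "real^'n"
    assume u: "normalized s p u" and h: "h \<noteq> 0" "norm h < d / 2"
    note [measurable] = normalizedD(1)[OF u]
    define H where "H = norm h powr (\<sigma> * (q - p + 2))"
    define F where "F = cutoff_error s p q r d u h"
    have [measurable]: "F \<in> borel_measurable borel" unfolding F_def cutoff_error_def[abs_def] by measurable
    define P where "P z = H * (c * (norm z powr a * kern s p z))" for z :: "real^'n"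
    have P0: "0 \<le> P z" for z using c0 by (simp add: P_def H_def)
    define A where "A z x = ennreal (\<bar>u (x + z) - u x\<bar> powr q)" for z x
    have [measurable]: "A z \<in> borel_measurable borel" for z unfolding A_def[abs_def] by measurable
    define B where "B = ball (0::real^'n) (r + 3 * d)"
    have [measurable]: "B \<in> sets borel" by (simp add: B_def)
    have pt: "ennreal (F (x, x + z)) \<le>
        ennreal (P z * norm z powr (- (\<sigma> * q))) * (A z (x + h) * indicator B x + A z x * indicator B x)
      + ennreal (P z * norm h powr (- (\<sigma> * q))) * (A h x * indicator B x + A h (x + z) * indicator B x)" (is "_ \<le> ?rhs")
      if z: "z \<noteq> 0" "norm z < d" for x z
    proof (cases "x \<in> B")
      case True
      define S T where "S = \<bar>u (x + h + z) - u (x + h)\<bar> + \<bar>u (x + z) - u x\<bar>"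
        and "T = \<bar>u (x + h) - u x\<bar> + \<bar>u (x + z + h) - u (x + z)\<bar>"
      have ST: "0 \<le> S" "0 \<le> T" by (auto simp: S_def T_def)
      have eqF: "F (x, x + z) = S powr (p - 2) * T powr (q - p + 2) * (cutoff r d x - cutoff r d (x + z))\<^sup>2 * near_kern s p d z"
      proof -
        have "x + h + z = x + z + h" by (simp add: add_ac)
        then have "S = \<bar>u (x + h) - u (x + z + h)\<bar> + \<bar>u x - u (x + z)\<bar>"
          unfolding S_def by (simp only: abs_minus_commute)
        then show ?thesis by (simp add: F_def cutoff_error_def T_def)
      qed
      have "\<bar>cutoff r d x - cutoff r d (x + z)\<bar> \<le> norm z / d"
        using cutoff_lipschitz[OF d(1), of r x "x + z"] by simp
      then have "\<bar>cutoff r d x - cutoff r d (x + z)\<bar>\<^sup>2 \<le> (norm z / d)\<^sup>2" by (rule power_mono) simp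
      then have cut: "(cutoff r d x - cutoff r d (x + z))\<^sup>2 \<le> (norm z)\<^sup>2 / d\<^sup>2" by (simp add: power_divide)
      have Sq: "S powr q \<le> 2 powr q * (\<bar>u (x + h + z) - u (x + h)\<bar> powr q + \<bar>u (x + z) - u x\<bar> powr q)"
        and Tq: "T powr q \<le> 2 powr q * (\<bar>u (x + h) - u x\<bar> powr q + \<bar>u (x + z + h) - u (x + z)\<bar> powr q)"
        using powr_add_le[of q "\<bar>u (x + h + z) - u (x + h)\<bar>" "\<bar>u (x + z) - u x\<bar>"]
          powr_add_le[of q "\<bar>u (x + h) - u x\<bar>" "\<bar>u (x + z + h) - u (x + z)\<bar>"] p q
        by (auto simp: S_def T_def)
      define SS where "SS = \<bar>u (x + h + z) - u (x + h)\<bar> powr q + \<bar>u (x + z) - u x\<bar> powr q"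
      define TT where "TT = \<bar>u (x + h) - u x\<bar> powr q + \<bar>u (x + z + h) - u (x + z)\<bar> powr q"
      have SSTT: "0 \<le> SS" "0 \<le> TT" by (auto simp: SS_def TT_def)
      have pq: "p - 2 + (q - p + 2) = q" by simp
      have "S powr (p - 2) * T powr (q - p + 2) \<le> norm z powr (\<sigma> * (p - 2)) * H *
          (norm z powr (- (\<sigma> * q)) * S powr q + norm h powr (- (\<sigma> * q)) * T powr q)"
        using weighted_young[of "norm z" "norm h" S T "p - 2" "q - p + 2" \<sigma>] z h ST p q unfolding pq by (simp add: H_def)
      also have "\<dots> \<le> norm z powr (\<sigma> * (p - 2)) * H *
          (norm z powr (- (\<sigma> * q)) * (2 powr q * SS) + norm h powr (- (\<sigma> * q)) * (2 powr q * TT))"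
        using Sq Tq by (intro mult_left_mono add_mono) (auto simp: H_def SS_def TT_def)
      finally have Y: "S powr (p - 2) * T powr (q - p + 2) \<le> norm z powr (\<sigma> * (p - 2)) * H *
          (norm z powr (- (\<sigma> * q)) * (2 powr q * SS) + norm h powr (- (\<sigma> * q)) * (2 powr q * TT))" .
      have "F (x, x + z) \<le> (norm z powr (\<sigma> * (p - 2)) * H *
          (norm z powr (- (\<sigma> * q)) * (2 powr q * SS) + norm h powr (- (\<sigma> * q)) * (2 powr q * TT))) * ((norm z)\<^sup>2 / d\<^sup>2) * kern s p z"
        unfolding eqF using SSTT
        by (intro mult_mono[OF mult_mono[OF Y cut] near_kern_le_kern]) (simp_all add: H_def)
      also have "\<dots> = (H * (c * ((norm z powr (\<sigma> * (p - 2)) * (norm z)\<^sup>2) * kern s p z))) *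
          (norm z powr (- (\<sigma> * q)) * SS + norm h powr (- (\<sigma> * q)) * TT)"
        by (simp add: c_def algebra_simps add_divide_distrib)
      also have "norm z powr (\<sigma> * (p - 2)) * (norm z)\<^sup>2 = norm z powr a"
        using z by (simp add: a_def powr_add powr_numeral mult.commute)
      finally have "F (x, x + z) \<le> P z * norm z powr (- (\<sigma> * q)) * SS + P z * norm h powr (- (\<sigma> * q)) * TT"
        by (simp add: P_def algebra_simps)
      then have "ennreal (F (x, x + z)) \<le> ennreal (P z * norm z powr (- (\<sigma> * q))) * ennreal SS + ennreal (P z * norm h powr (- (\<sigma> * q))) * ennreal TT"
        using P0[of z] SSTT by (simp add: ennreal_mult'[symmetric] ennreal_leI flip: ennreal_plus)
      then show ?thesis using True by (simp add: A_def SS_def TT_def)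
    next
      case False
      then have "r + 3 * d \<le> norm x" by (simp add: B_def)
      moreover have "norm x - norm z \<le> norm (x + z)" using norm_triangle_ineq4[of "x + z" z] by simp
      ultimately have "r + 2 * d \<le> norm x" "r + 2 * d \<le> norm (x + z)" using z d by auto
      then have "cutoff r d x = 0" "cutoff r d (x + z) = 0" by (simp_all only: cutoff_eq_0[OF d(1)])
      then show ?thesis by (simp add: F_def cutoff_error_def)
    qed
    have inner: "(\<integral>\<^sup>+x. ennreal (F (x, x + z)) \<partial>lborel) \<le> ennreal (4 * D * P z) * indicator (ball 0 2) z" for z
    proof (cases "z \<noteq> 0 \<and> norm z < d")
      case True
      then have z: "z \<noteq> 0" "norm z < d" by auto
      have uR: "u \<in> {u. normalized s p u}" using u by simp
      have nz: "(\<integral>\<^sup>+x. A k (x + l) * indicator B x \<partial>lborel) \<le> ennreal (D * norm k powr (\<sigma> * q))"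
        if "norm k < 4 * d" "norm l < d" for k l
      proof -
        have "(\<integral>\<^sup>+x. A k (x + l) * indicator B x \<partial>lborel) \<le> diff_integral q u k R"
          using nn_integral_ball_shift_le[of "A k" "r + 3 * d" l R] that d by (simp add: B_def R_def diff_integral_def A_def)
        also have "\<dots> \<le> ennreal (D * norm k powr (\<sigma> * q))" using that R by (intro D(2)[OF uR]) simp
        finally show ?thesis .
      qed
      have one: "ennreal (P z * t powr (- (\<sigma> * q))) * (ennreal (D * t powr (\<sigma> * q)) + ennreal (D * t powr (\<sigma> * q))) = ennreal (2 * D * P z)" if "0 < t" for t
      proof -
        have "t powr (- (\<sigma> * q)) * t powr (\<sigma> * q) = 1" using that by (simp add: powr_add[symmetric])
        then have "P z * t powr (- (\<sigma> * q)) * (D * t powr (\<sigma> * q) + D * t powr (\<sigma> * q)) = 2 * D * P z"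
          by (simp add: algebra_simps)
        then show ?thesis using P0[of z] D(1) by (simp add: ennreal_mult'[symmetric] flip: ennreal_plus)
      qed
      have "(\<integral>\<^sup>+x. ennreal (F (x, x + z)) \<partial>lborel) \<le> (\<integral>\<^sup>+x. ennreal (P z * norm z powr (- (\<sigma> * q))) * (A z (x + h) * indicator B x + A z x * indicator B x)
          + ennreal (P z * norm h powr (- (\<sigma> * q))) * (A h x * indicator B x + A h (x + z) * indicator B x) \<partial>lborel)"
        by (rule nn_integral_mono) (rule pt[OF z])
      also have "\<dots> = ennreal (P z * norm z powr (- (\<sigma> * q))) * ((\<integral>\<^sup>+x. A z (x + h) * indicator B x \<partial>lborel) + (\<integral>\<^sup>+x. A z x * indicator B x \<partial>lborel))
          + ennreal (P z * norm h powr (- (\<sigma> * q))) * ((\<integral>\<^sup>+x. A h x * indicator B x \<partial>lborel) + (\<integral>\<^sup>+x. A h (x + z) * indicator B x \<partial>lborel))"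
        by (rule nn_integral_combination) measurable
      also have "\<dots> \<le> ennreal (P z * norm z powr (- (\<sigma> * q))) * (ennreal (D * norm z powr (\<sigma> * q)) + ennreal (D * norm z powr (\<sigma> * q)))
          + ennreal (P z * norm h powr (- (\<sigma> * q))) * (ennreal (D * norm h powr (\<sigma> * q)) + ennreal (D * norm h powr (\<sigma> * q)))"
        using nz[of z h] nz[of z 0] nz[of h 0] nz[of h z] z h d by (intro add_mono mult_left_mono) auto
      also have "\<dots> = ennreal (2 * D * P z) + ennreal (2 * D * P z)" using one[of "norm z"] one[of "norm h"] z h by simp
      also have "\<dots> = ennreal (4 * D * P z)" using P0[of z] D(1) by (simp flip: ennreal_plus)
      finally show ?thesis using z d by simp
    next
      case False
      then have "near_kern s p d (- z) = 0"
        using near_kern_eq_0[of d "- z" s p] by (auto simp: near_kern_def kern_def far_kern_def)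
      then show ?thesis by (simp add: F_def cutoff_error_def)
    qed
    have "(\<integral>\<^sup>+z. ennreal (F z) \<partial>lborel) = (\<integral>\<^sup>+z. \<integral>\<^sup>+x. ennreal (F (x, x + z)) \<partial>lborel \<partial>lborel)"
      by (rule nn_integral_pair_diff) measurable
    also have "\<dots> \<le> (\<integral>\<^sup>+z. ennreal (4 * D * P z) * indicator (ball 0 2) z \<partial>lborel)"
      by (rule nn_integral_mono) (rule inner)
    also have "\<dots> = (\<integral>\<^sup>+z. ennreal (4 * D * H * c) * (ennreal (norm z powr a * kern s p z) * indicator (ball (0::real^'n) 2) z) \<partial>lborel)"
    proof (rule nn_integral_cong)
      fix z :: "real^'n"
      have e: "4 * D * P z = (4 * D * H * c) * (norm z powr a * kern s p z)" by (simp add: P_def)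
      have pos: "0 \<le> 4 * D * H * c" using D c0 by (simp add: H_def)
      show "ennreal (4 * D * P z) * indicator (ball 0 2) z = ennreal (4 * D * H * c) * (ennreal (norm z powr a * kern s p z) * indicator (ball 0 2) z)"
        unfolding e ennreal_mult'[OF pos] by (rule mult.assoc)
    qed
    also have "\<dots> = ennreal (4 * D * H * c) * I"
      unfolding I_def by (rule nn_integral_cmult) measurable
    also have "\<dots> = ennreal (4 * D * H * c) * ennreal (enn2real I)" using I by simp
    also have "\<dots> = ennreal (4 * D * c * enn2real I * H)"
      using D c0 by (simp add: ennreal_mult'[symmetric] H_def mult_ac)
    finally show "(\<integral>\<^sup>+z. ennreal (cutoff_error s p q r d u h z) \<partial>lborel)
      \<le> ennreal (4 * D * c * enn2real I * norm h powr (\<sigma> * (q - p + 2)))"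
      unfolding F_def H_def .
  qed
qed

text \<open>
  Since \<open>\<sigma> \<le> 1\<close>, the summand \<open>\<bar>h\<bar>\<close> is no worse than \<open>\<bar>h\<bar>\<^sup>\<sigma>\<close>, so the whole integrand behaves like
  \<open>\<bar>w\<bar>\<^sup>q\<^sup>-\<^sup>p\<^sup>+\<^sup>2\<close>; the bounded domain makes up for the missing \<open>p - 2\<close> powers.
\<close>

lemma source_term_bound:
  fixes s p q \<sigma> r d :: real
  assumes p: "2 < p" and q: "p \<le> q" and \<sigma>: "0 \<le> \<sigma>" "\<sigma> \<le> 1"
    and d: "0 < d" "r + 8 * d = 1" "0 < r" and nik: "nikolskii {u :: real^'n \<Rightarrow> real. normalized s p u} q \<sigma>"
  obtains C where "0 \<le> C"
    "\<And>(u :: real^'n \<Rightarrow> real) h. normalized s p u \<Longrightarrow> h \<noteq> 0 \<Longrightarrow> norm h < d / 2 \<Longrightarrow>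
      (\<integral>\<^sup>+x. ennreal (\<bar>spow (q - p + 1) (u (x + h) - u x) * (cutoff r d x)\<^sup>2\<bar> * (\<bar>u (x + h) - u x\<bar> + norm h)) \<partial>lborel)
      \<le> ennreal (C * norm h powr (\<sigma> * (q - p + 2)))"
proof -
  define R where "R = r + 4 * d"
  have R: "0 < R" "R < 1" "1 - R = 4 * d" using d by (auto simp: R_def)
  obtain D where D: "0 \<le> D" "\<And>(u :: real^'n \<Rightarrow> real) h. u \<in> {u. normalized s p u} \<Longrightarrow> norm h < 1 - R \<Longrightarrow>
      diff_integral q u h R \<le> ennreal (D * norm h powr (\<sigma> * q))"
    by (rule nikolskiiE[OF nik R(1,2)]) (rule that)
  define V where "V = unit_ball_vol CARD('n) * R powr CARD('n)"
  have V: "0 \<le> V" "emeasure lborel (ball (0::real^'n) R) = ennreal V"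
    using R by (auto simp: V_def emeasure_ball_dim)
  define b where "b = q - p + 2"
  have b: "2 \<le> b" "b \<le> q" using p q by (auto simp: b_def)
  show thesis
  proof (rule that[of "(1 + 2 powr q) * V + 2 powr q * D"])
    show "0 \<le> (1 + 2 powr q) * V + 2 powr q * D" using V D by simp
    fix u :: "real^'n \<Rightarrow> real" and h :: "real^'n"
    assume u: "normalized s p u" and h: "h \<noteq> 0" "norm h < d / 2"
    note [measurable] = normalizedD(1)[OF u]
    define H where "H = norm h powr (\<sigma> * b)"
    define G where "G = H * (2 powr q * norm h powr (- (\<sigma> * q)))"
    have H0: "0 \<le> H" "0 \<le> G" by (auto simp: H_def G_def)
    have h1: "norm h < 1" using h d by linarith
    have pt: "ennreal (\<bar>spow (q - p + 1) (u (x + h) - u x) * (cutoff r d x)\<^sup>2\<bar> * (\<bar>u (x + h) - u x\<bar> + norm h))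
      \<le> ennreal (H * (1 + 2 powr q)) * (indicator (ball 0 R) x + 0)
        + ennreal G * (ennreal (\<bar>u (x + h) - u x\<bar> powr q) * indicator (ball 0 R) x + 0)" for x
    proof (cases "norm x < R")
      case True
      define W where "W = \<bar>u (x + h) - u x\<bar>"
      define T where "T = W + norm h"
      have T: "0 \<le> W" "0 \<le> T" "W \<le> T" by (auto simp: W_def T_def)
      have "(cutoff r d x)\<^sup>2 \<le> 1" using cutoff_bounds[of r d x] by (simp add: power_le_one)
      then have "\<bar>spow (q - p + 1) (u (x + h) - u x) * (cutoff r d x)\<^sup>2\<bar> * T \<le> (W powr (q - p + 1) * 1) * T"
        unfolding abs_mult abs_spow W_def[symmetric] using T by (intro mult_right_mono mult_left_mono) auto
      also have "\<dots> \<le> T powr (q - p + 1) * T"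
        using T p q by (simp add: mult_right_mono powr_mono2)
      also have "T powr (q - p + 1) * T = T powr b"
      proof -
        have "b - 1 = q - p + 1" by (simp add: b_def)
        then show ?thesis using powr_pred_mult[OF T(2), of b] by (simp only:)
      qed
      also have "T powr b = 1 powr (q - b) * T powr b" by simp
      also have "\<dots> \<le> 1 powr (\<sigma> * (q - b)) * norm h powr (\<sigma> * b) *
           (1 powr (- (\<sigma> * ((q - b) + b))) * 1 powr ((q - b) + b) + norm h powr (- (\<sigma> * ((q - b) + b))) * T powr ((q - b) + b))"
        using h T b by (intro weighted_young) auto
      also have "\<dots> = H * (1 + norm h powr (- (\<sigma> * q)) * T powr q)" by (simp add: H_def)
      also have "\<dots> \<le> H * (1 + norm h powr (- (\<sigma> * q)) * (2 powr q * (W powr q + norm h powr (\<sigma> * q))))"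
      proof (intro mult_left_mono add_left_mono H0)
        have "T powr q \<le> 2 powr q * (W powr q + norm h powr q)"
          using powr_add_le[of q W "norm h"] T p q by (simp add: T_def)
        also have "norm h powr q \<le> norm h powr (\<sigma> * q)"
          using h1 \<sigma> p q by (intro powr_mono') (auto simp: mult_le_cancel_right1)
        finally show "T powr q \<le> 2 powr q * (W powr q + norm h powr (\<sigma> * q))" by (simp add: mult_left_mono)
      qed simp
      also have "\<dots> = H * (1 + 2 powr q * (norm h powr (- (\<sigma> * q)) * norm h powr (\<sigma> * q))) + G * W powr q"
        by (simp add: G_def algebra_simps)
      also have "norm h powr (- (\<sigma> * q)) * norm h powr (\<sigma> * q) = 1" using h by (simp add: powr_add[symmetric])
      finally have "\<bar>spow (q - p + 1) (u (x + h) - u x) * (cutoff r d x)\<^sup>2\<bar> * T \<le> H * (1 + 2 powr q) + G * W powr q" by simp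
      then have "ennreal (\<bar>spow (q - p + 1) (u (x + h) - u x) * (cutoff r d x)\<^sup>2\<bar> * T) \<le> ennreal (H * (1 + 2 powr q)) + ennreal G * ennreal (W powr q)"
        using H0 by (simp add: ennreal_mult'[symmetric] ennreal_leI flip: ennreal_plus)
      then show ?thesis using True by (simp add: T_def W_def)
    next
      case False
      then have "r + 2 * d \<le> norm x" using d by (simp add: R_def)
      then have "cutoff r d x = 0" by (rule cutoff_eq_0[OF d(1)])
      then show ?thesis by simp
    qed
    have "(\<integral>\<^sup>+x. ennreal (\<bar>spow (q - p + 1) (u (x + h) - u x) * (cutoff r d x)\<^sup>2\<bar> * (\<bar>u (x + h) - u x\<bar> + norm h)) \<partial>lborel)
      \<le> (\<integral>\<^sup>+x. ennreal (H * (1 + 2 powr q)) * (indicator (ball 0 R) x + 0)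
        + ennreal G * (ennreal (\<bar>u (x + h) - u x\<bar> powr q) * indicator (ball 0 R) x + 0) \<partial>lborel)"
      by (rule nn_integral_mono) (rule pt)
    also have "\<dots> = ennreal (H * (1 + 2 powr q)) * ((\<integral>\<^sup>+x. indicator (ball (0::real^'n) R) x \<partial>lborel) + (\<integral>\<^sup>+x. 0 \<partial>(lborel :: (real^'n) measure)))
        + ennreal G * ((\<integral>\<^sup>+x. ennreal (\<bar>u (x + h) - u x\<bar> powr q) * indicator (ball 0 R) x \<partial>lborel) + (\<integral>\<^sup>+x. 0 \<partial>(lborel :: (real^'n) measure)))"
      by (rule nn_integral_combination) measurable
    also have "\<dots> = ennreal (H * (1 + 2 powr q)) * ennreal V + ennreal G * diff_integral q u h R"
      by (simp add: V diff_integral_def)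
    also have "\<dots> \<le> ennreal (H * (1 + 2 powr q)) * ennreal V + ennreal G * ennreal (D * norm h powr (\<sigma> * q))"
      using h d R u by (intro add_left_mono mult_left_mono D(2)) auto
    also have "\<dots> = ennreal (H * (1 + 2 powr q) * V + G * (D * norm h powr (\<sigma> * q)))"
      using H0 V D by (simp add: ennreal_mult'[symmetric] flip: ennreal_plus)
    also have "H * (1 + 2 powr q) * V + G * (D * norm h powr (\<sigma> * q)) = ((1 + 2 powr q) * V + 2 powr q * D) * H"
    proof -
      have "norm h powr (- (\<sigma> * q)) * norm h powr (\<sigma> * q) = 1" using h by (simp add: powr_add[symmetric])
      then have "G * (D * norm h powr (\<sigma> * q)) = 2 powr q * D * H" by (simp add: G_def algebra_simps)
      then show ?thesis by (simp add: algebra_simps)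
    qed
    finally show "(\<integral>\<^sup>+x. ennreal (\<bar>spow (q - p + 1) (u (x + h) - u x) * (cutoff r d x)\<^sup>2\<bar> * (\<bar>u (x + h) - u x\<bar> + norm h)) \<partial>lborel)
      \<le> ennreal (((1 + 2 powr q) * V + 2 powr q * D) * norm h powr (\<sigma> * (q - p + 2)))"
      unfolding H_def b_def .
  qed
qed


text \<open>
  The energy estimate for \<open>w = u (\<cdot> + h) - u\<close>. The left-hand side of \<open>caccioppoli_pointwise\<close> bounds the
  differences of \<open>w\<close> in all directions; only the direction \<open>h\<close> itself is used, which produces the
  second difference of \<open>u\<close> and, by \<open>nikolskii_of_gagliardo\<close>, the additional factor \<open>\<bar>h\<bar>\<^sup>s\<^sup>p\<close>.
\<close>

lemma nikolskii_gain:
  fixes s p q \<sigma> \<sigma>' :: real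
  assumes p: "2 < p" and s: "0 < s" "s * p \<le> p - 2" and q: "p \<le> q"
    and \<sigma>: "0 \<le> \<sigma>" "\<sigma> \<le> 1" "s * p - 2 < \<sigma> * (p - 2)"
    and \<sigma>': "\<sigma>' = (s * p + \<sigma> * (q - p + 2)) / q" "\<sigma>' < 1"
    and nik: "nikolskii {u :: real^'n \<Rightarrow> real. normalized s p u} q \<sigma>"
  shows "nikolskii {u :: real^'n \<Rightarrow> real. normalized s p u} q \<sigma>'"
proof (rule nikolskii_from_second_differences[OF unit_class_normalized _ \<sigma>'(2)])
  show "0 < q" using p q by simp
  fix r :: real assume r: "0 < r" "r < 1"
  define d where "d = (1 - r) / 8"
  have d: "0 < d" "r + 8 * d = 1" "0 < r" "d < 1" using r by (auto simp: d_def field_simps)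
  have sp: "0 < s * p" using s p by simp
  have "s * p < 1 * p" using s p by linarith
  then have s1: "s < 1" using p by (simp add: mult_less_cancel_right)
  have \<delta>: "1 \<le> q - p + 1" using q by simp
  have p0: "0 < p" "2 \<le> p" using p by auto
  obtain CE where CE: "0 \<le> CE" "\<And>(u :: real^'n \<Rightarrow> real) h. normalized s p u \<Longrightarrow> h \<noteq> 0 \<Longrightarrow> norm h < d / 2 \<Longrightarrow>
      (\<integral>\<^sup>+z. ennreal (cutoff_error s p q r d u h z) \<partial>lborel)
      \<le> ennreal (CE * norm h powr (\<sigma> * (q - p + 2)))"
    by (rule error_term_bound[OF p s(1) q \<sigma>(3) d(1-3) nik]) (rule that)
  obtain CS where CS: "0 \<le> CS" "\<And>(u :: real^'n \<Rightarrow> real) h. normalized s p u \<Longrightarrow> h \<noteq> 0 \<Longrightarrow> norm h < d / 2 \<Longrightarrow>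
      (\<integral>\<^sup>+x. ennreal (\<bar>spow (q - p + 1) (u (x + h) - u x) * (cutoff r d x)\<^sup>2\<bar> * (\<bar>u (x + h) - u x\<bar> + norm h)) \<partial>lborel)
      \<le> ennreal (CS * norm h powr (\<sigma> * (q - p + 2)))"
    by (rule source_term_bound[OF p q \<sigma>(1,2) d(1-3) nik]) (rule that)
  obtain CD where CD: "0 < CD" "\<And>(u :: real^'n \<Rightarrow> real) h \<phi>. normalized s p u \<Longrightarrow> norm h \<le> d / 2 \<Longrightarrow>
       admissible s p \<phi> \<Longrightarrow> admissible s p (\<lambda>x. \<phi> (x - h)) \<Longrightarrow> (\<forall>x. 1 - 2 * d < norm x \<longrightarrow> \<phi> x = 0) \<Longrightarrow>
       integrable lborel (difference_integrand p (near_kern s p d) u h \<phi>) \<and>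
       ennreal \<bar>\<integral>z. difference_integrand p (near_kern s p d) u h \<phi> z \<partial>lborel\<bar>
       \<le> ennreal CD * (\<integral>\<^sup>+x. ennreal (\<bar>\<phi> x\<bar> * (\<bar>u (x + h) - u x\<bar> + norm h)) \<partial>lborel)"
    by (rule difference_equation[OF sp p d(1) d(4), where 'n='n]) (rule that)
  obtain c C0 :: real where c: "0 < c" "0 < C0"
    "\<And>a b W V \<eta> \<zeta>. a - b = W - V \<Longrightarrow> 0 \<le> \<eta> \<Longrightarrow> 0 \<le> \<zeta> \<Longrightarrow>
       c * \<bar>W - V\<bar> powr (p - 1 + (q - p + 1)) * (\<eta>\<^sup>2 + \<zeta>\<^sup>2)
       \<le> (spow (p - 1) a - spow (p - 1) b) * (spow (q - p + 1) W * \<eta>\<^sup>2 - spow (q - p + 1) V * \<zeta>\<^sup>2)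
          + C0 * (\<bar>a\<bar> + \<bar>b\<bar>) powr (p - 2) * (\<bar>W\<bar> + \<bar>V\<bar>) powr (q - p + 1 + 1) * (\<eta> - \<zeta>)\<^sup>2"
    by (rule caccioppoli_pointwise[OF p0(2) \<delta>]) (rule that)
  obtain CN where CN: "0 < CN" "\<And>(f :: real^'n \<Rightarrow> real) h r. f \<in> borel_measurable borel \<Longrightarrow> h \<noteq> 0 \<Longrightarrow>
       diff_integral q f h r \<le> ennreal (CN * norm h powr (s * p)) *
         (\<integral>\<^sup>+z\<in>ball 0 (2 * norm h). ennreal (kern s p z) * diff_integral q f z (r + norm h) \<partial>lborel)"
    by (rule nikolskii_of_gagliardo[OF \<open>0 < q\<close> sp, where 'n='n]) (rule that)
  define K where "K = CD * CS + C0 * CE"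
  have K0: "0 \<le> K" using CD CS c CE by (simp add: K_def)
  show "\<exists>C h0. 0 \<le> C \<and> 0 < h0 \<and> (\<forall>u\<in>{u :: real^'n \<Rightarrow> real. normalized s p u}. \<forall>h. h \<noteq> 0 \<and> norm h < h0 \<longrightarrow>
       (\<integral>\<^sup>+x\<in>ball 0 r. ennreal (\<bar>(u (x + h + h) - u (x + h)) - (u (x + h) - u x)\<bar> powr q) \<partial>lborel)
         \<le> ennreal (C * norm h powr (\<sigma>' * q)))"
  proof (intro exI conjI ballI allI impI)
    show "0 \<le> CN * (2 / c * K)" using CN c K0 by simp
    show "0 < d / 4" using d by simp
    fix u and h :: "real^'n" assume u': "u \<in> {u :: real^'n \<Rightarrow> real. normalized s p u}" and h': "h \<noteq> 0 \<and> norm h < d / 4"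
    then have u: "normalized s p u" and h: "h \<noteq> 0" "norm h < d / 4" "norm h < d / 2" "norm h \<le> d / 2"
      using d(1) by auto
    note [measurable] = normalizedD(1)[OF u]
    define H where "H = norm h powr (\<sigma> * (q - p + 2))"
    define w where "w x = u (x + h) - u x" for x
    have [measurable]: "w \<in> borel_measurable borel" unfolding w_def[abs_def] by measurable
    define \<phi> where "\<phi> x = spow (q - p + 1) (w x) * (cutoff r d x)\<^sup>2" for x
    have adm: "admissible s p \<phi>" "admissible s p (\<lambda>x. \<phi> (x - h))"
      using admissible_difference_test[OF u s(1) s1 p0(1) \<delta> d(1-3) h(3)]
      by (simp_all add: \<phi>_def[abs_def] w_def)
    have supp: "\<forall>x. 1 - 2 * d < norm x \<longrightarrow> \<phi> x = 0"
    proof (intro allI impI)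
      fix x :: "real^'n" assume "1 - 2 * d < norm x"
      then have "r + 2 * d \<le> norm x" using d by linarith
      then have "cutoff r d x = 0" by (rule cutoff_eq_0[OF d(1)])
      then show "\<phi> x = 0" by (simp add: \<phi>_def)
    qed
    define G where "G = difference_integrand p (near_kern s p d) u h \<phi>"
    have G: "integrable lborel G"
      "ennreal \<bar>\<integral>z. G z \<partial>lborel\<bar> \<le> ennreal CD * (\<integral>\<^sup>+x. ennreal (\<bar>\<phi> x\<bar> * (\<bar>u (x + h) - u x\<bar> + norm h)) \<partial>lborel)"
      unfolding G_def using CD(2)[OF u h(4) adm supp] by (blast, blast)
    define E where "E = cutoff_error s p q r d u h"
    have [measurable]: "E \<in> borel_measurable borel" unfolding E_def cutoff_error_def[abs_def] by measurable
    have E0: "0 \<le> E z" for z by (simp add: E_def cutoff_error_def)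
    define L where "L z = c * \<bar>w (fst z) - w (snd z)\<bar> powr q * ((cutoff r d (fst z))\<^sup>2 + (cutoff r d (snd z))\<^sup>2) * near_kern s p d (fst z - snd z)" for z
    have [measurable]: "L \<in> borel_measurable borel" unfolding L_def[abs_def] by measurable
    have L0: "0 \<le> L z" for z using c by (simp add: L_def)
    \<comment> \<open>\<open>L\<close> is the coercive part, \<open>G\<close> the integrand of the equation, \<open>E\<close> the error of the cut-off\<close>
    have L: "L z \<le> G z + C0 * E z" for z
    proof -
      define k where "k = near_kern s p d (fst z - snd z)"
      have k: "0 \<le> k" by (simp add: k_def)
      have e1: "p - 1 + (q - p + 1) = q" and e2: "q - p + 1 + 1 = q - p + 2" by simp_all
      have "c * \<bar>w (fst z) - w (snd z)\<bar> powr q * ((cutoff r d (fst z))\<^sup>2 + (cutoff r d (snd z))\<^sup>2)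
        \<le> (spow (p - 1) (u (fst z + h) - u (snd z + h)) - spow (p - 1) (u (fst z) - u (snd z))) * (\<phi> (fst z) - \<phi> (snd z))
          + C0 * (\<bar>u (fst z + h) - u (snd z + h)\<bar> + \<bar>u (fst z) - u (snd z)\<bar>) powr (p - 2)
             * (\<bar>w (fst z)\<bar> + \<bar>w (snd z)\<bar>) powr (q - p + 2) * (cutoff r d (fst z) - cutoff r d (snd z))\<^sup>2"
        unfolding \<phi>_def by (rule c(3)[unfolded e1 e2]) (simp_all add: w_def cutoff_bounds)
      from mult_right_mono[OF this k] show ?thesis
        by (simp add: L_def G_def difference_integrand_def E_def cutoff_error_def k_def w_def algebra_simps)
    qed
    have "(\<integral>\<^sup>+z. ennreal (L z) \<partial>lborel) \<le> ennreal \<bar>\<integral>z. G z \<partial>lborel\<bar> + (\<integral>\<^sup>+z. ennreal (C0 * E z) \<partial>lborel)"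
      using c E0 by (intro nn_integral_le_integral_plus G L0 L) auto
    also have "(\<integral>\<^sup>+z. ennreal (C0 * E z) \<partial>lborel) = (\<integral>\<^sup>+z. ennreal C0 * ennreal (E z) \<partial>lborel)"
      using c by (simp add: ennreal_mult')
    also have "\<dots> = ennreal C0 * (\<integral>\<^sup>+z. ennreal (E z) \<partial>lborel)" by (rule nn_integral_cmult) measurable
    also have "ennreal \<bar>\<integral>z. G z \<partial>lborel\<bar> + ennreal C0 * (\<integral>\<^sup>+z. ennreal (E z) \<partial>lborel)
        \<le> ennreal CD * ennreal (CS * H) + ennreal C0 * ennreal (CE * H)"
    proof (intro add_mono mult_left_mono)
      have "(\<integral>\<^sup>+x. ennreal (\<bar>\<phi> x\<bar> * (\<bar>u (x + h) - u x\<bar> + norm h)) \<partial>lborel) \<le> ennreal (CS * H)"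
        using CS(2)[OF u h(1,3)] by (simp add: H_def \<phi>_def w_def)
      then show "ennreal \<bar>\<integral>z. G z \<partial>lborel\<bar> \<le> ennreal CD * ennreal (CS * H)"
        by (intro order_trans[OF G(2)] mult_left_mono) auto
      show "(\<integral>\<^sup>+z. ennreal (E z) \<partial>lborel) \<le> ennreal (CE * H)"
        unfolding E_def H_def by (rule CE(2)[OF u h(1,3)])
    qed simp
    also have "\<dots> = ennreal (K * H)"
      using CD CS c CE by (simp add: K_def ennreal_mult'[symmetric] H_def algebra_simps flip: ennreal_plus)
    finally have up: "(\<integral>\<^sup>+z. ennreal (L z) \<partial>lborel) \<le> ennreal (K * H)" .
    define Q where "Q = (\<integral>\<^sup>+z\<in>ball 0 (2 * norm h). ennreal (kern s p z) * diff_integral q w z (r + norm h) \<partial>lborel)"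
    have [measurable]: "(\<lambda>z. diff_integral q w z (r + norm h)) \<in> borel_measurable borel"
      unfolding diff_integral_def by measurable
    have "ennreal (c / 2) * Q = (\<integral>\<^sup>+z. ennreal (c / 2) * (ennreal (kern s p z) * diff_integral q w z (r + norm h) * indicator (ball 0 (2 * norm h)) z) \<partial>lborel)"
      unfolding Q_def by (rule nn_integral_cmult[symmetric]) measurable
    also have "\<dots> \<le> (\<integral>\<^sup>+z. \<integral>\<^sup>+x. ennreal (L (x, x + z)) \<partial>lborel \<partial>lborel)"
    proof (rule nn_integral_mono)
      fix z :: "real^'n"
      show "ennreal (c / 2) * (ennreal (kern s p z) * diff_integral q w z (r + norm h) * indicator (ball 0 (2 * norm h)) z) \<le> (\<integral>\<^sup>+x. ennreal (L (x, x + z)) \<partial>lborel)"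
      proof (cases "norm z < 2 * norm h")
        case True
        then have z: "norm z \<le> d / 2" using h by simp
        have "ennreal (c / 2) * (ennreal (kern s p z) * diff_integral q w z (r + norm h)) = ennreal (c / 2 * kern s p z) * diff_integral q w z (r + norm h)"
          using c(1) by (subst ennreal_mult') (simp_all add: mult.assoc)
        also have "\<dots> = (\<integral>\<^sup>+x. ennreal (c / 2 * kern s p z) * (ennreal (\<bar>w (x + z) - w x\<bar> powr q) * indicator (ball 0 (r + norm h)) x) \<partial>lborel)"
          unfolding diff_integral_def by (rule nn_integral_cmult[symmetric]) measurable
        also have "\<dots> \<le> (\<integral>\<^sup>+x. ennreal (L (x, x + z)) \<partial>lborel)"
        proof (rule nn_integral_mono)
          fix x :: "real^'n"
          show "ennreal (c / 2 * kern s p z) * (ennreal (\<bar>w (x + z) - w x\<bar> powr q) * indicator (ball 0 (r + norm h)) x) \<le> ennreal (L (x, x + z))"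
          proof (cases "norm x < r + norm h")
            case True
            then have \<eta>: "cutoff r d x = 1" using h d by (intro cutoff_eq_1) auto
            have "c / 2 * kern s p z * \<bar>w (x + z) - w x\<bar> powr q = c * \<bar>w (x + z) - w x\<bar> powr q * 1 * (kern s p z / 2)" by simp
            also have "\<dots> \<le> c * \<bar>w (x + z) - w x\<bar> powr q * ((cutoff r d x)\<^sup>2 + (cutoff r d (x + z))\<^sup>2) * near_kern s p d z"
              using c near_kern_ge_half_kern[OF sp z] \<eta> by (intro mult_mono mult_left_mono) auto
            also have "\<dots> = L (x, x + z)" by (simp add: L_def abs_minus_commute)
            finally show ?thesis using True c by (simp add: ennreal_mult'[symmetric] ennreal_leI)
          qed simp
        qed
        finally show ?thesis using True by simp
      qed simp
    qed
    also have "\<dots> = (\<integral>\<^sup>+z. ennreal (L z) \<partial>lborel)" by (rule nn_integral_pair_diff[symmetric]) measurable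
    also note up
    finally have Q1: "ennreal (c / 2) * Q \<le> ennreal (K * H)" .
    have "Q = ennreal (2 / c) * (ennreal (c / 2) * Q)"
    proof -
      have "ennreal (2 / c) * ennreal (c / 2) = 1" using c by (simp add: ennreal_mult'[symmetric])
      then show ?thesis by (simp only: mult.assoc[symmetric] mult_1_left)
    qed
    also have "\<dots> \<le> ennreal (2 / c) * ennreal (K * H)" using Q1 by (rule mult_left_mono) simp
    finally have Q2: "Q \<le> ennreal (2 / c) * ennreal (K * H)" .
    have "(\<integral>\<^sup>+x\<in>ball 0 r. ennreal (\<bar>(u (x + h + h) - u (x + h)) - (u (x + h) - u x)\<bar> powr q) \<partial>lborel) = diff_integral q w h r"
      by (simp add: diff_integral_def w_def)
    also have "\<dots> \<le> ennreal (CN * norm h powr (s * p)) * Q"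
      unfolding Q_def by (rule CN(2)) (use h in measurable)
    also have "\<dots> \<le> ennreal (CN * norm h powr (s * p)) * (ennreal (2 / c) * ennreal (K * H))"
      using Q2 by (rule mult_left_mono) simp
    also have "\<dots> = ennreal (CN * (2 / c * K) * (norm h powr (s * p) * H))"
      using CN c K0 by (simp add: ennreal_mult'[symmetric] H_def mult_ac)
    also have "norm h powr (s * p) * H = norm h powr (\<sigma>' * q)"
      using p q by (simp add: H_def powr_add[symmetric] \<sigma>'(1))
    finally show "(\<integral>\<^sup>+x\<in>ball 0 r. ennreal (\<bar>(u (x + h + h) - u (x + h)) - (u (x + h) - u x)\<bar> powr q) \<partial>lborel)
         \<le> ennreal (CN * (2 / c * K) * norm h powr (\<sigma>' * q))" .
  qed
qed

section \<open>Iteration in order and integrability\<close>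

lemma nikolskii_small_increments:
  fixes U :: "(real^'n \<Rightarrow> real) set"
  assumes U: "unit_class U" and q: "0 \<le> q" and \<sigma>: "0 \<le> \<sigma>"
    and small: "\<And>r. 0 < r \<Longrightarrow> r < 1 \<Longrightarrow> \<exists>C h0. 0 \<le> C \<and> 0 < h0 \<and>
       (\<forall>u\<in>U. \<forall>h. h \<noteq> 0 \<and> norm h < h0 \<longrightarrow> diff_integral q u h r \<le> ennreal (C * norm h powr (\<sigma> * q)))"
  shows "nikolskii U q \<sigma>"
  unfolding nikolskii_def
proof (intro allI impI)
  fix r :: real assume r: "0 < r \<and> r < 1"
  then obtain C h0 where C: "0 \<le> C" "0 < h0"
    "\<forall>u\<in>U. \<forall>h. h \<noteq> 0 \<and> norm h < h0 \<longrightarrow> diff_integral q u h r \<le> ennreal (C * norm h powr (\<sigma> * q))"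
    using small[of r] by (elim exE conjE) auto
  define B where "B = max C (2 powr q * unit_ball_vol CARD('n) / h0 powr (\<sigma> * q))"
  have "2 powr q * unit_ball_vol CARD('n) / h0 powr (\<sigma> * q) \<le> B" by (simp add: B_def)
  then have B3: "2 powr q * unit_ball_vol CARD('n) \<le> B * h0 powr (\<sigma> * q)"
    using C(2) by (subst (asm) pos_divide_le_eq) auto
  have B: "0 \<le> B" "C \<le> B" using C(1) by (auto simp: B_def le_max_iff_disj)
  show "\<exists>C\<ge>0. \<forall>u\<in>U. \<forall>h. norm h < 1 - r \<longrightarrow> diff_integral q u h r \<le> ennreal (C * norm h powr (\<sigma> * q))"
  proof (intro exI[of _ B] conjI B(1) ballI allI impI)
    fix u and h :: "real^'n" assume u: "u \<in> U" "norm h < 1 - r"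
    consider "h = 0" | "h \<noteq> 0" "norm h < h0" | "h0 \<le> norm h" by linarith
    then show "diff_integral q u h r \<le> ennreal (B * norm h powr (\<sigma> * q))"
    proof cases
      case 2
      then have "diff_integral q u h r \<le> ennreal (C * norm h powr (\<sigma> * q))" using C(3) u by blast
      also have "\<dots> \<le> ennreal (B * norm h powr (\<sigma> * q))" using B by (intro ennreal_leI mult_right_mono) auto
      finally show ?thesis .
    next
      case 3
      have "diff_integral q u h r \<le> ennreal (2 powr q * unit_ball_vol CARD('n))"
        using r q by (intro diff_integral_trivial[OF U u]) auto
      also have "\<dots> \<le> ennreal (B * norm h powr (\<sigma> * q))"
      proof (rule ennreal_leI)
        have "h0 powr (\<sigma> * q) \<le> norm h powr (\<sigma> * q)" using 3 C q \<sigma> by (intro powr_mono2) auto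
        then have "B * h0 powr (\<sigma> * q) \<le> B * norm h powr (\<sigma> * q)" using B(1) by (rule mult_left_mono)
        then show "2 powr q * unit_ball_vol CARD('n) \<le> B * norm h powr (\<sigma> * q)" using B3 by linarith
      qed
      finally show ?thesis .
    qed simp
  qed
qed

text \<open>
  The starting point of the iteration: the normalized seminorm itself bounds differences to order
  \<open>s\<close> in \<open>L\<^sup>p\<close>.
\<close>

lemma nikolskii_base:
  fixes s p :: real
  assumes p: "2 < p" and s: "0 < s"
  shows "nikolskii {u :: real^'n \<Rightarrow> real. normalized s p u} p s"
proof (rule nikolskii_small_increments[OF unit_class_normalized])
  show "0 \<le> p" "0 \<le> s" using p s by auto
  fix r :: real assume r: "0 < r" "r < 1"
  have sp: "0 < s * p" and p0: "0 < p" using s p by auto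
  obtain CN where CN: "0 < CN" "\<And>(f :: real^'n \<Rightarrow> real) h r. f \<in> borel_measurable borel \<Longrightarrow> h \<noteq> 0 \<Longrightarrow>
       diff_integral p f h r \<le> ennreal (CN * norm h powr (s * p)) *
         (\<integral>\<^sup>+z\<in>ball 0 (2 * norm h). ennreal (kern s p z) * diff_integral p f z (r + norm h) \<partial>lborel)"
    by (rule nikolskii_of_gagliardo[OF p0 sp, where 'n='n]) (rule that)
  show "\<exists>C h0. 0 \<le> C \<and> 0 < h0 \<and> (\<forall>u\<in>{u :: real^'n \<Rightarrow> real. normalized s p u}. \<forall>h. h \<noteq> 0 \<and> norm h < h0 \<longrightarrow>
      diff_integral p u h r \<le> ennreal (C * norm h powr (s * p)))"
  proof (intro exI conjI ballI allI impI)
    show "0 \<le> CN" using CN by simp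
    show "0 < (1 - r) / 3" using r by simp
    fix u and h :: "real^'n" assume u': "u \<in> {u :: real^'n \<Rightarrow> real. normalized s p u}" and h: "h \<noteq> 0 \<and> norm h < (1 - r) / 3"
    then have u: "normalized s p u" by simp
    note [measurable] = normalizedD(1)[OF u]
    have [measurable]: "ball (0::real^'n) 1 \<times> ball (0::real^'n) 1 \<in> sets borel"
      by (intro borel_open open_Times) auto
    let ?F = "\<lambda>z :: (real^'n) \<times> (real^'n). ennreal (\<bar>u (fst z) - u (snd z)\<bar> powr p * kern s p (fst z - snd z)) * indicator (ball 0 1 \<times> ball 0 1) z"
    have "(\<integral>\<^sup>+z\<in>ball 0 (2 * norm h). ennreal (kern s p z) * diff_integral p u z (r + norm h) \<partial>lborel)
       \<le> (\<integral>\<^sup>+z. \<integral>\<^sup>+x. ?F (x, x + z) \<partial>lborel \<partial>lborel)"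
    proof (rule nn_integral_mono)
      fix z :: "real^'n"
      show "ennreal (kern s p z) * diff_integral p u z (r + norm h) * indicator (ball 0 (2 * norm h)) z \<le> (\<integral>\<^sup>+x. ?F (x, x + z) \<partial>lborel)"
      proof (cases "norm z < 2 * norm h")
        case True
        have "ennreal (kern s p z) * diff_integral p u z (r + norm h)
           = (\<integral>\<^sup>+x. ennreal (kern s p z) * (ennreal (\<bar>u (x + z) - u x\<bar> powr p) * indicator (ball 0 (r + norm h)) x) \<partial>lborel)"
          unfolding diff_integral_def by (rule nn_integral_cmult[symmetric]) measurable
        also have "\<dots> \<le> (\<integral>\<^sup>+x. ?F (x, x + z) \<partial>lborel)"
        proof (rule nn_integral_mono)
          fix x :: "real^'n"
          show "ennreal (kern s p z) * (ennreal (\<bar>u (x + z) - u x\<bar> powr p) * indicator (ball 0 (r + norm h)) x) \<le> ?F (x, x + z)"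
          proof (cases "norm x < r + norm h")
            case x: True
            have hh: "3 * norm h < 1 - r" using h by simp
            have "norm x < 1" using x hh r norm_ge_zero[of h] by linarith
            moreover have "norm (x + z) < 1" using x True hh norm_triangle_ineq[of x z] by linarith
            ultimately show ?thesis using x
              by (simp add: abs_minus_commute ennreal_mult'[symmetric] mult.commute)
          qed simp
        qed
        finally show ?thesis using True by simp
      qed simp
    qed
    also have "\<dots> = (\<integral>\<^sup>+z. ?F z \<partial>lborel)" by (rule nn_integral_pair_diff[symmetric]) measurable
    also have "\<dots> \<le> 1" using normalizedD(3)[OF u] by (simp add: gagliardo_def)
    finally have G: "(\<integral>\<^sup>+z\<in>ball 0 (2 * norm h). ennreal (kern s p z) * diff_integral p u z (r + norm h) \<partial>lborel) \<le> 1" .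
    have "diff_integral p u h r \<le> ennreal (CN * norm h powr (s * p)) *
         (\<integral>\<^sup>+z\<in>ball 0 (2 * norm h). ennreal (kern s p z) * diff_integral p u z (r + norm h) \<partial>lborel)"
      by (rule CN(2)) (use h in auto)
    also have "\<dots> \<le> ennreal (CN * norm h powr (s * p)) * 1" using G by (rule mult_left_mono) simp
    finally show "diff_integral p u h r \<le> ennreal (CN * norm h powr (s * p))" by simp
  qed
qed

text \<open>
  For fixed \<open>q\<close> one step of \<open>nikolskii_gain\<close> maps \<open>\<sigma>\<close> to the convex combination
  \<open>(1 - \<kappa>) l + \<kappa> \<sigma>\<close> with \<open>l = s p / (p - 2)\<close> and \<open>\<kappa> = 1 - (p - 2) / q\<close>, so the distance to \<open>l\<close> shrinks
  geometrically. As \<open>l \<le> 1\<close>, all intermediate orders stay below \<open>1\<close>.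
\<close>

lemma nikolskii_saturate:
  fixes s p q \<sigma>0 \<sigma> :: real
  assumes p: "2 < p" and s: "0 < s" "s * p \<le> p - 2" and q: "p \<le> q"
    and \<sigma>0: "0 \<le> \<sigma>0" "s * p - 2 < \<sigma>0 * (p - 2)" and \<sigma>: "\<sigma> < s * p / (p - 2)"
    and nik: "nikolskii {u :: real^'n \<Rightarrow> real. normalized s p u} q \<sigma>0"
  shows "nikolskii {u :: real^'n \<Rightarrow> real. normalized s p u} q \<sigma>"
proof (cases "\<sigma> \<le> \<sigma>0")
  case True
  then show ?thesis using p q by (intro nikolskii_mono_exponent[OF nik]) auto
next
  case False
  define l where "l = s * p / (p - 2)"
  define \<kappa> where "\<kappa> = 1 - (p - 2) / q"
  have l: "l \<le> 1" "\<sigma>0 < l" "s * p = l * (p - 2)" using s p False \<sigma> by (auto simp: l_def divide_le_eq)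
  have \<kappa>: "0 < \<kappa>" "\<kappa> < 1" using p q by (auto simp: \<kappa>_def divide_less_eq)
  \<comment> \<open>the explicit form of the iterated orders\<close>
  have step: "nikolskii {u :: real^'n \<Rightarrow> real. normalized s p u} q (l - (l - \<sigma>0) * \<kappa> ^ k)" for k
  proof (induction k)
    case 0 then show ?case using nik by simp
  next
    case (Suc k)
    define t where "t = l - (l - \<sigma>0) * \<kappa> ^ k"
    define t' where "t' = l - (l - \<sigma>0) * \<kappa> ^ Suc k"
    have "\<kappa> ^ k \<le> 1" "0 < \<kappa> ^ k" "0 < \<kappa> ^ Suc k" using \<kappa> by (auto simp: power_le_one)
    then have k: "(l - \<sigma>0) * \<kappa> ^ k \<le> (l - \<sigma>0) * 1" "0 < (l - \<sigma>0) * \<kappa> ^ k" "0 < (l - \<sigma>0) * \<kappa> ^ Suc k"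
      using l by (auto intro!: mult_left_mono simp del: power_Suc)
    then have t: "\<sigma>0 \<le> t" "t < l" "t' < l" by (auto simp: t_def t'_def)
    have "\<sigma>0 * (p - 2) \<le> t * (p - 2)" using t p by (intro mult_right_mono) auto
    then have t2: "s * p - 2 < t * (p - 2)" using \<sigma>0 by linarith
    have "t' = l * (1 - \<kappa>) + t * \<kappa>" by (simp add: t_def t'_def algebra_simps)
    also have "\<dots> = (l * (p - 2) + t * (q - (p - 2))) / q"
      using p q by (simp add: \<kappa>_def field_simps)
    also have "q - (p - 2) = q - p + 2" by simp
    also have "l * (p - 2) = s * p" by (rule l(3)[symmetric])
    finally have t': "t' = (s * p + t * (q - p + 2)) / q" .
    show ?case unfolding t'_def[symmetric]
      by (rule nikolskii_gain[OF p s q _ _ t2 t' _ Suc[folded t_def]]) (use t l \<sigma>0 in auto)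
  qed
  have l\<sigma>: "\<sigma> < l" unfolding l_def by (rule \<sigma>)
  then have "0 < (l - \<sigma>) / (l - \<sigma>0)" using l(2) by (intro divide_pos_pos) auto
  then obtain k where k: "\<kappa> ^ k < (l - \<sigma>) / (l - \<sigma>0)"
    using real_arch_pow_inv[OF _ \<kappa>(2)] by blast
  have "\<kappa> ^ k * (l - \<sigma>0) < l - \<sigma>"
    using k l(2) by (subst (asm) pos_less_divide_eq) auto
  then have "\<sigma> \<le> l - (l - \<sigma>0) * \<kappa> ^ k" by (simp add: mult.commute)
  then show ?thesis using p q by (intro nikolskii_mono_exponent[OF step]) auto
qed

text \<open>
  The factor \<open>\<theta> = (s p + 2) / (s p + 1)\<close> satisfies \<open>\<theta> (s p - 2) < s p\<close>, since
  \<open>(s p + 2) (s p - 2) < s p (s p + 1)\<close>. Hence some \<open>\<tau> < s p / (p - 2)\<close> still satisfies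
  \<open>s p - 2 < (\<tau> / \<theta>) (p - 2)\<close>, and the order \<open>\<tau> / \<theta>\<close> left after raising \<open>q\<close> to \<open>\<theta> q\<close> is enough to
  restart the iteration.
\<close>

lemma nikolskii_all_exponents:
  fixes s p \<sigma> :: real
  assumes p: "2 < p" and s: "0 < s" "s * p \<le> p - 2" and \<sigma>: "\<sigma> < s * p / (p - 2)"
  shows "nikolskii {u :: real^'n \<Rightarrow> real. normalized s p u} (p * ((s * p + 2) / (s * p + 1)) ^ k) \<sigma>"
  using \<sigma>
proof (induction k arbitrary: \<sigma>)
  case 0
  have "s * p < 1 * p" using s p by linarith
  then have s1: "s < 1" using p by (simp add: mult_less_cancel_right)
  show ?case
    using nikolskii_saturate[OF p s order_refl _ _ 0 nikolskii_base[OF p s(1)]] s1 s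
    by (simp add: right_diff_distrib)
next
  case (Suc k)
  define \<theta> where "\<theta> = (s * p + 2) / (s * p + 1)"
  define q where "q = p * \<theta> ^ k"
  have sp: "0 < s * p" using s p by simp
  have \<theta>: "1 < \<theta>" using sp by (simp add: \<theta>_def)
  have q: "p \<le> q" "0 < q" using \<theta> p by (auto simp: q_def mult_le_cancel_left1 one_le_power)
  have q': "p * \<theta> ^ Suc k = \<theta> * q" by (simp add: q_def)
  have "(s * p + 2) * (s * p - 2) < s * p * (s * p + 1)" using sp by (simp add: algebra_simps)
  then have "\<theta> * (s * p - 2) < s * p" using sp by (simp add: \<theta>_def divide_less_eq)
  then have "\<theta> * (s * p - 2) / (p - 2) < s * p / (p - 2)" using p by (simp add: divide_strict_right_mono)
  moreover have "0 < s * p / (p - 2)" using sp p by simp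
  ultimately obtain \<tau> where \<tau>: "max 0 (\<theta> * (s * p - 2) / (p - 2)) < \<tau>" "\<tau> < s * p / (p - 2)"
    using dense[of "max 0 (\<theta> * (s * p - 2) / (p - 2))" "s * p / (p - 2)"] by auto
  have "nikolskii {u :: real^'n \<Rightarrow> real. normalized s p u} q \<tau>"
    using Suc.IH[OF \<tau>(2)] by (simp add: q_def \<theta>_def)
  then have nik: "nikolskii {u :: real^'n \<Rightarrow> real. normalized s p u} (\<theta> * q) (\<tau> * q / (\<theta> * q))"
    using \<theta> q by (intro nikolskii_raise_integrability[OF unit_class_normalized]) auto
  have e: "\<tau> * q / (\<theta> * q) = \<tau> / \<theta>" using q by simp
  have "\<theta> * (s * p - 2) < \<tau> * (p - 2)" using \<tau> p by (simp add: divide_less_eq)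
  then have "s * p - 2 < \<tau> / \<theta> * (p - 2)" using \<theta> by (simp add: field_simps)
  moreover have "p \<le> \<theta> * q" using q \<theta> by (auto intro: order_trans[of p q "\<theta> * q"])
  ultimately show ?case unfolding \<theta>_def[symmetric] q'
    using \<tau> \<theta> q Suc.prems by (intro nikolskii_saturate[OF p s _ _ _ _ nik[unfolded e]]) auto
qed

lemma nikolskii_arbitrary_integrability:
  fixes s p \<sigma> Q :: real
  assumes p: "2 < p" and s: "0 < s" "s * p \<le> p - 2" and \<sigma>: "\<sigma> < s * p / (p - 2)"
  obtains q where "Q \<le> q" "1 \<le> q" "nikolskii {u :: real^'n \<Rightarrow> real. normalized s p u} q \<sigma>"
proof -
  define \<theta> where "\<theta> = (s * p + 2) / (s * p + 1)"
  have "0 < s * p" using s p by simp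
  then have \<theta>: "1 < \<theta>" by (simp add: \<theta>_def)
  obtain k where k: "Q < \<theta> ^ k" using real_arch_pow[OF \<theta>] by blast
  have "1 * \<theta> ^ k \<le> p * \<theta> ^ k" using \<theta> p by (intro mult_right_mono) auto
  moreover have "1 \<le> \<theta> ^ k" using \<theta> by (simp add: one_le_power)
  ultimately have "Q \<le> p * \<theta> ^ k" "1 \<le> p * \<theta> ^ k" using k by linarith+
  then show thesis
    by (rule that) (use nikolskii_all_exponents[OF p s \<sigma>, of k, where 'n='n] in \<open>simp add: \<theta>_def\<close>)
qed

section \<open>From integrated differences to Hoelder continuity\<close>

definition avg :: "(real^'n \<Rightarrow> real) \<Rightarrow> (real^'n) set \<Rightarrow> real" where
  "avg u B = (\<integral>x. u x * indicator B x \<partial>lborel) / measure lborel B"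

lemma measure_ball_dim:
  fixes c :: "real^'n"
  assumes "0 \<le> r"
  shows "measure lborel (ball c r) = unit_ball_vol CARD('n) * r powr CARD('n)"
  using emeasure_ball_dim[OF assms, of c] assms by (simp add: measure_def)

lemma emeasure_ball_measure:
  fixes c :: "real^'n"
  assumes "0 \<le> r"
  shows "emeasure lborel (ball c r) = ennreal (measure lborel (ball c r))"
  using assms by (simp add: emeasure_ball_dim measure_ball_dim)

text \<open>
  Multiplied by the volume, which avoids divisions in extended nonnegative reals. Using it twice
  bounds the difference of two averages by a double integral of differences of \<open>u\<close>.
\<close>

lemma avg_deviation:
  fixes u :: "real^'n \<Rightarrow> real"
  assumes u: "u \<in> borel_measurable borel" "\<And>x. x \<in> ball a r \<Longrightarrow> \<bar>u x\<bar> \<le> 1" and r: "0 < r"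
  shows "ennreal \<bar>avg u (ball a r) - c\<bar> * emeasure lborel (ball a r) \<le> (\<integral>\<^sup>+x\<in>ball a r. ennreal \<bar>u x - c\<bar> \<partial>lborel)"
proof -
  note [measurable] = u(1)
  let ?B = "ball a r"
  define V where "V = measure lborel ?B"
  have V: "0 < V" using r by (simp add: V_def measure_ball_dim)
  have eV: "emeasure lborel ?B = ennreal V" using r by (simp add: V_def emeasure_ball_measure)
  have ind: "integrable lborel (\<lambda>x. indicator ?B x :: real)" using eV by (simp add: integrable_indicator_iff)
  have int: "integrable lborel (\<lambda>x. u x * indicator ?B x)"
  proof (rule Bochner_Integration.integrable_bound[OF ind])
    show "AE x in lborel. norm (u x * indicator ?B x) \<le> norm (indicator ?B x :: real)"
      using u(2) by (intro AE_I2) (simp add: indicator_def)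
  qed measurable
  have "(avg u ?B - c) * V = (\<integral>x. u x * indicator ?B x \<partial>lborel) - c * V"
    using V by (simp add: avg_def V_def left_diff_distrib)
  also have "\<dots> = (\<integral>x. u x * indicator ?B x - c * indicator ?B x \<partial>lborel)"
    using int ind by (simp add: V_def)
  also have "\<dots> = (\<integral>x. (u x - c) * indicator ?B x \<partial>lborel)" by (simp add: left_diff_distrib)
  finally have "\<bar>avg u ?B - c\<bar> * V = \<bar>\<integral>x. (u x - c) * indicator ?B x \<partial>lborel\<bar>"
    using V by (metis abs_mult abs_of_pos)
  also have "\<dots> \<le> (\<integral>x. \<bar>(u x - c) * indicator ?B x\<bar> \<partial>lborel)" by (rule integral_abs_bound)
  finally have 1: "\<bar>avg u ?B - c\<bar> * V \<le> (\<integral>x. \<bar>(u x - c) * indicator ?B x\<bar> \<partial>lborel)" .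
  have "integrable lborel (\<lambda>x. \<bar>u x * indicator ?B x - c * indicator ?B x\<bar>)" using int ind by simp
  then have int2: "integrable lborel (\<lambda>x. \<bar>(u x - c) * indicator ?B x\<bar>)" by (simp add: left_diff_distrib)
  have "ennreal \<bar>avg u ?B - c\<bar> * emeasure lborel ?B = ennreal (\<bar>avg u ?B - c\<bar> * V)"
    using V by (simp add: eV ennreal_mult)
  also have "\<dots> \<le> ennreal (\<integral>x. \<bar>(u x - c) * indicator ?B x\<bar> \<partial>lborel)" using 1 by (rule ennreal_leI)
  also have "\<dots> = (\<integral>\<^sup>+x. ennreal \<bar>(u x - c) * indicator ?B x\<bar> \<partial>lborel)"
    using int2 by (intro nn_integral_eq_integral[symmetric]) auto
  also have "\<dots> = (\<integral>\<^sup>+x\<in>?B. ennreal \<bar>u x - c\<bar> \<partial>lborel)"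
    by (intro nn_integral_cong) (simp add: indicator_def)
  finally show ?thesis .
qed

text \<open>
  For the passage from \<open>L\<^sup>q\<close> to \<open>L\<^sup>1\<close>; the threshold \<open>\<mu>\<close> is chosen afterwards so as to balance both
  terms.
\<close>

lemma abs_le_scaled_powr:
  fixes t \<mu> q :: real
  assumes "1 \<le> q" "0 < \<mu>"
  shows "\<bar>t\<bar> \<le> \<mu> + \<mu> powr (1 - q) * \<bar>t\<bar> powr q"
proof (cases "\<bar>t\<bar> \<le> \<mu>")
  case False
  then have t: "\<mu> \<le> \<bar>t\<bar>" "0 < \<bar>t\<bar>" using assms by auto
  have "\<bar>t\<bar> = \<bar>t\<bar> powr (1 - q) * \<bar>t\<bar> powr q" using t by (simp add: powr_add[symmetric])
  also have "\<dots> \<le> \<mu> powr (1 - q) * \<bar>t\<bar> powr q" using t assms by (intro mult_right_mono powr_mono2') auto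
  finally show ?thesis using assms by linarith
qed (simp add: add_increasing2)

lemma diff_L1_bound:
  fixes u :: "real^'n \<Rightarrow> real"
  assumes [measurable]: "u \<in> borel_measurable borel" and q: "1 \<le> q" and \<mu>: "0 < \<mu>"
    and sub: "A \<subseteq> ball 0 r" and [measurable]: "A \<in> sets borel"
  shows "(\<integral>\<^sup>+x\<in>A. ennreal \<bar>u (x + z) - u x\<bar> \<partial>lborel)
    \<le> ennreal \<mu> * emeasure lborel A + ennreal (\<mu> powr (1 - q)) * diff_integral q u z r"
proof -
  have pt: "ennreal \<bar>u (x + z) - u x\<bar> * indicator A x
      \<le> ennreal \<mu> * indicator A x + ennreal (\<mu> powr (1 - q)) * (ennreal (\<bar>u (x + z) - u x\<bar> powr q) * indicator (ball 0 r) x)" for x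
  proof (cases "x \<in> A")
    case True
    then have "x \<in> ball 0 r" using sub by blast
    moreover have "ennreal \<bar>u (x + z) - u x\<bar> \<le> ennreal \<mu> + ennreal (\<mu> powr (1 - q)) * ennreal (\<bar>u (x + z) - u x\<bar> powr q)"
      using abs_le_scaled_powr[OF q \<mu>, of "u (x + z) - u x"] \<mu>
      by (simp add: ennreal_mult'[symmetric] ennreal_leI flip: ennreal_plus)
    ultimately show ?thesis using True by simp
  qed simp
  have "(\<integral>\<^sup>+x\<in>A. ennreal \<bar>u (x + z) - u x\<bar> \<partial>lborel)
    \<le> (\<integral>\<^sup>+x. ennreal \<mu> * indicator A x + ennreal (\<mu> powr (1 - q)) * (ennreal (\<bar>u (x + z) - u x\<bar> powr q) * indicator (ball 0 r) x) \<partial>lborel)"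
    by (rule nn_integral_mono) (rule pt)
  also have "\<dots> = (\<integral>\<^sup>+x. ennreal \<mu> * indicator A x \<partial>lborel) + (\<integral>\<^sup>+x. ennreal (\<mu> powr (1 - q)) * (ennreal (\<bar>u (x + z) - u x\<bar> powr q) * indicator (ball 0 r) x) \<partial>lborel)"
    by (rule nn_integral_add) measurable
  also have "(\<integral>\<^sup>+x. ennreal \<mu> * indicator A x \<partial>lborel) = ennreal \<mu> * emeasure lborel A"
    by (rule nn_integral_cmult_indicator) measurable
  also have "(\<integral>\<^sup>+x. ennreal (\<mu> powr (1 - q)) * (ennreal (\<bar>u (x + z) - u x\<bar> powr q) * indicator (ball 0 r) x) \<partial>lborel)
      = ennreal (\<mu> powr (1 - q)) * diff_integral q u z r"
    unfolding diff_integral_def by (rule nn_integral_cmult) measurable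
  finally show ?thesis .
qed

text \<open>
  Averages over comparable balls inside a ball of radius \<open>\<rho>\<close> differ by at most the mean of
  \<open>\<bar>u x - u y\<bar>\<close> over pairs in that ball, which is of order \<open>\<rho>\<^sup>\<sigma>\<^sup>-\<^sup>N\<^sup>/\<^sup>q\<close>: the \<open>L\<^sup>q\<close> bound gives \<open>\<rho>\<^sup>\<sigma>\<close> and averaging over
  the volume \<open>\<rho>\<^sup>N\<close> costs \<open>\<rho>\<^sup>-\<^sup>N\<^sup>/\<^sup>q\<close>.
\<close>

lemma avg_comparison:
  fixes u :: "real^'n \<Rightarrow> real"
  assumes u: "u \<in> borel_measurable borel" "\<And>x. norm x < 1 \<Longrightarrow> \<bar>u x\<bar> \<le> 1" and q: "1 \<le> q" and D: "0 \<le> D"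
    and nik: "\<And>z. norm z < 1 / 4 \<Longrightarrow> diff_integral q u z (3 / 4) \<le> ennreal (D * norm z powr (\<sigma> * q))"
    and \<sigma>: "0 \<le> \<sigma>" and \<gamma>: "\<gamma> = \<sigma> - CARD('n) / q"
    and \<rho>: "0 < \<rho>" "\<rho> \<le> 1 / 8" and c: "ball c \<rho> \<subseteq> ball 0 (3 / 4)"
    and ab: "ball a (\<rho> / 2) \<subseteq> ball c \<rho>" and bb: "ball b r \<subseteq> ball c \<rho>" "\<rho> / 2 \<le> r"
  defines "K \<equiv> 4 powr CARD('n) * (2 powr CARD('n) + D * 2 powr (\<sigma> * q) * 2 powr CARD('n) / unit_ball_vol CARD('n))"
  shows "\<bar>avg u (ball a (\<rho> / 2)) - avg u (ball b r)\<bar> \<le> K * \<rho> powr \<gamma>"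
proof -
  note [measurable] = u(1)
  define N where "N = real CARD('n)"
  define V where "V = unit_ball_vol CARD('n)"
  define A1 where "A1 = ball a (\<rho> / 2)"
  define A2 where "A2 = ball b r"
  define Bc where "Bc = ball c \<rho>"
  define m where "m = avg u A1"
  define m2 where "m2 = avg u A2"
  \<comment> \<open>the threshold for which both terms of \<open>diff_L1_bound\<close> have the same order in \<open>\<rho>\<close>\<close>
  define \<mu> where "\<mu> = \<rho> powr \<gamma>"
  have \<mu>: "0 < \<mu>" using \<rho> by (simp add: \<mu>_def)
  have V: "0 < V" by (simp add: V_def)
  have [measurable]: "A1 \<in> sets borel" "A2 \<in> sets borel" "Bc \<in> sets borel" by (auto simp: A1_def A2_def Bc_def)
  have sub: "A1 \<subseteq> Bc" "A2 \<subseteq> Bc" "Bc \<subseteq> ball 0 (3 / 4)" using ab bb c by (auto simp: A1_def A2_def Bc_def)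
  have u1: "\<bar>u x\<bar> \<le> 1" if "x \<in> Bc" for x using u(2)[of x] that sub by auto
  have r: "0 < r" using bb \<rho> by simp
  have v: "V * (\<rho> / 2) powr N \<le> measure lborel A2"
    using bb \<rho> V r by (simp add: A2_def measure_ball_dim V_def N_def powr_mono2)
  have v1: "emeasure lborel A1 = ennreal (V * (\<rho> / 2) powr N)"
    using \<rho> by (simp add: A1_def emeasure_ball_dim V_def N_def)
  have vc: "emeasure lborel Bc = ennreal (V * \<rho> powr N)"
    using \<rho> by (simp add: Bc_def emeasure_ball_dim V_def N_def)
  define F where "F z = ennreal \<bar>u (fst z) - u (snd z)\<bar> * indicator Bc (fst z) * indicator Bc (snd z)" for z
  have [measurable]: "F \<in> borel_measurable borel" unfolding F_def[abs_def] by measurable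
  have dev1: "ennreal \<bar>m - u y\<bar> * emeasure lborel A1 \<le> (\<integral>\<^sup>+x. F (x, y) \<partial>lborel)" if y: "y \<in> A2" for y
  proof -
    have "ennreal \<bar>m - u y\<bar> * emeasure lborel A1 \<le> (\<integral>\<^sup>+x\<in>A1. ennreal \<bar>u x - u y\<bar> \<partial>lborel)"
      unfolding m_def A1_def using \<rho> sub u1 by (intro avg_deviation) (auto simp: A1_def)
    also have "\<dots> \<le> (\<integral>\<^sup>+x. F (x, y) \<partial>lborel)"
      using y sub by (intro nn_integral_mono) (auto simp: F_def indicator_def)
    finally show ?thesis .
  qed
  have "ennreal \<bar>m - m2\<bar> * emeasure lborel A2 \<le> (\<integral>\<^sup>+y\<in>A2. ennreal \<bar>u y - m\<bar> \<partial>lborel)"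
  proof -
    have "ennreal \<bar>m2 - m\<bar> * emeasure lborel A2 \<le> (\<integral>\<^sup>+y\<in>A2. ennreal \<bar>u y - m\<bar> \<partial>lborel)"
      unfolding m2_def A2_def using r sub u1 by (intro avg_deviation) (auto simp: A2_def)
    then show ?thesis by (simp add: abs_minus_commute)
  qed
  then have "ennreal \<bar>m - m2\<bar> * emeasure lborel A2 * emeasure lborel A1 \<le> (\<integral>\<^sup>+y\<in>A2. ennreal \<bar>u y - m\<bar> \<partial>lborel) * emeasure lborel A1"
    by (rule mult_right_mono) simp
  also have "\<dots> = (\<integral>\<^sup>+y. ennreal \<bar>u y - m\<bar> * indicator A2 y * emeasure lborel A1 \<partial>lborel)"
    by (rule nn_integral_multc[symmetric]) measurable
  also have "\<dots> \<le> (\<integral>\<^sup>+y. \<integral>\<^sup>+x. F (x, y) \<partial>lborel \<partial>lborel)"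
  proof (rule nn_integral_mono)
    fix y :: "real^'n"
    show "ennreal \<bar>u y - m\<bar> * indicator A2 y * emeasure lborel A1 \<le> (\<integral>\<^sup>+x. F (x, y) \<partial>lborel)"
      using dev1[of y] by (cases "y \<in> A2") (simp_all add: abs_minus_commute)
  qed
  also have "\<dots> = (\<integral>\<^sup>+z. F z \<partial>lborel)" by (rule nn_integral_pair(2)[symmetric]) measurable
  also have "\<dots> = (\<integral>\<^sup>+z. \<integral>\<^sup>+x. F (x, x + z) \<partial>lborel \<partial>lborel)" by (rule nn_integral_pair_diff) measurable
  also have "\<dots> \<le> (\<integral>\<^sup>+z. (ennreal \<mu> * ennreal (V * \<rho> powr N) + ennreal (\<mu> powr (1 - q)) * ennreal (D * (2 * \<rho>) powr (\<sigma> * q))) * indicator (ball (0::real^'n) (2 * \<rho>)) z \<partial>lborel)"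
  proof (rule nn_integral_mono)
    fix z :: "real^'n"
    show "(\<integral>\<^sup>+x. F (x, x + z) \<partial>lborel) \<le> (ennreal \<mu> * ennreal (V * \<rho> powr N) + ennreal (\<mu> powr (1 - q)) * ennreal (D * (2 * \<rho>) powr (\<sigma> * q))) * indicator (ball (0::real^'n) (2 * \<rho>)) z"
    proof (cases "norm z < 2 * \<rho>")
      case True
      have "(\<integral>\<^sup>+x. F (x, x + z) \<partial>lborel) \<le> (\<integral>\<^sup>+x\<in>Bc. ennreal \<bar>u (x + z) - u x\<bar> \<partial>lborel)"
        by (intro nn_integral_mono) (auto simp: F_def indicator_def abs_minus_commute)
      also have "\<dots> \<le> ennreal \<mu> * emeasure lborel Bc + ennreal (\<mu> powr (1 - q)) * diff_integral q u z (3 / 4)"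
        by (rule diff_L1_bound[OF _ q \<mu> sub(3)]) measurable
      also have "\<dots> \<le> ennreal \<mu> * ennreal (V * \<rho> powr N) + ennreal (\<mu> powr (1 - q)) * ennreal (D * (2 * \<rho>) powr (\<sigma> * q))"
      proof (intro add_mono mult_left_mono)
        have "diff_integral q u z (3 / 4) \<le> ennreal (D * norm z powr (\<sigma> * q))" using True \<rho> by (intro nik) simp
        also have "\<dots> \<le> ennreal (D * (2 * \<rho>) powr (\<sigma> * q))"
          using True D \<sigma> q by (intro ennreal_leI mult_left_mono powr_mono2) auto
        finally show "diff_integral q u z (3 / 4) \<le> ennreal (D * (2 * \<rho>) powr (\<sigma> * q))" .
      qed (simp_all add: vc)
      finally show ?thesis using True by simp
    next
      case False
      have "F (x, x + z) = 0" for x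
      proof (rule ccontr)
        assume "F (x, x + z) \<noteq> 0"
        then have "x \<in> Bc" "x + z \<in> Bc" by (auto simp: F_def indicator_def split: if_splits)
        then have "dist c x < \<rho>" "dist c (x + z) < \<rho>" by (auto simp: Bc_def)
        then have "dist x (x + z) < 2 * \<rho>" using dist_triangle2[of x "x + z" c] by (simp add: dist_commute)
        then show False using False by (simp add: dist_norm)
      qed
      then show ?thesis by simp
    qed
  qed
  also have "\<dots> = (ennreal \<mu> * ennreal (V * \<rho> powr N) + ennreal (\<mu> powr (1 - q)) * ennreal (D * (2 * \<rho>) powr (\<sigma> * q))) * emeasure lborel (ball (0::real^'n) (2 * \<rho>))"
    by (rule nn_integral_cmult_indicator) simp
  also have "emeasure lborel (ball (0::real^'n) (2 * \<rho>)) = ennreal (V * (2 * \<rho>) powr N)"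
    using \<rho> by (simp add: emeasure_ball_dim V_def N_def)
  also have "(ennreal \<mu> * ennreal (V * \<rho> powr N) + ennreal (\<mu> powr (1 - q)) * ennreal (D * (2 * \<rho>) powr (\<sigma> * q))) * ennreal (V * (2 * \<rho>) powr N)
      = ennreal ((\<mu> * (V * \<rho> powr N) + \<mu> powr (1 - q) * (D * (2 * \<rho>) powr (\<sigma> * q))) * (V * (2 * \<rho>) powr N))"
    using \<mu> V D by (simp add: ennreal_mult'[symmetric] flip: ennreal_plus)
  finally have "ennreal \<bar>m - m2\<bar> * emeasure lborel A2 * emeasure lborel A1 \<le> ennreal ((\<mu> * (V * \<rho> powr N) + \<mu> powr (1 - q) * (D * (2 * \<rho>) powr (\<sigma> * q))) * (V * (2 * \<rho>) powr N))" .
  moreover have "ennreal \<bar>m - m2\<bar> * emeasure lborel A2 * emeasure lborel A1 = ennreal (\<bar>m - m2\<bar> * measure lborel A2 * (V * (\<rho> / 2) powr N))"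
    using r V by (simp add: v1 A2_def emeasure_ball_measure ennreal_mult)
  ultimately have 1: "\<bar>m - m2\<bar> * measure lborel A2 * (V * (\<rho> / 2) powr N)
      \<le> (\<mu> * (V * \<rho> powr N) + \<mu> powr (1 - q) * (D * (2 * \<rho>) powr (\<sigma> * q))) * (V * (2 * \<rho>) powr N)" (is "_ \<le> ?R")
    using \<mu> V D by (simp add: ennreal_le_iff)
  have "\<bar>m - m2\<bar> * (V * (\<rho> / 2) powr N) * (V * (\<rho> / 2) powr N) \<le> \<bar>m - m2\<bar> * measure lborel A2 * (V * (\<rho> / 2) powr N)"
    using v V by (intro mult_right_mono mult_left_mono) auto
  also note 1
  finally have 2: "\<bar>m - m2\<bar> * (V * (\<rho> / 2) powr N) * (V * (\<rho> / 2) powr N) \<le> ?R" .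
  define P where "P = \<rho> powr N"
  have P: "0 < P" using \<rho> by (simp add: P_def)
  have e1: "(\<rho> / 2) powr N = P / 2 powr N" "(2 * \<rho>) powr N = 2 powr N * P"
    using \<rho> by (auto simp: P_def powr_divide powr_mult)
  have e2: "\<mu> powr (1 - q) * (2 * \<rho>) powr (\<sigma> * q) = 2 powr (\<sigma> * q) * \<mu> * P"
  proof -
    have qN: "\<gamma> * q = \<sigma> * q - N" using q by (simp add: \<gamma> N_def left_diff_distrib)
    have "\<mu> powr (1 - q) * (2 * \<rho>) powr (\<sigma> * q) = 2 powr (\<sigma> * q) * (\<rho> powr (\<gamma> * (1 - q)) * \<rho> powr (\<sigma> * q))"
      using \<rho> by (simp add: \<mu>_def powr_powr powr_mult)
    also have "\<rho> powr (\<gamma> * (1 - q)) * \<rho> powr (\<sigma> * q) = \<rho> powr (\<gamma> + N)"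
      unfolding powr_add[symmetric] using qN by (simp add: right_diff_distrib)
    finally show ?thesis by (simp add: \<mu>_def P_def powr_add)
  qed
  have "?R = (\<mu> * (V * P) + D * (\<mu> powr (1 - q) * (2 * \<rho>) powr (\<sigma> * q))) * (V * (2 powr N * P))"
    by (simp only: e1(2) P_def[symmetric] mult.left_commute[of "\<mu> powr (1 - q)" D])
  also have "\<dots> = V * V * P * P * \<mu> * (2 powr N + D * 2 powr (\<sigma> * q) * 2 powr N / V)"
    unfolding e2 using V by (simp add: field_simps)
  finally have R: "?R = V * V * P * P * \<mu> * (2 powr N + D * 2 powr (\<sigma> * q) * 2 powr N / V)" .
  have "\<bar>m - m2\<bar> * (V * (\<rho> / 2) powr N) * (V * (\<rho> / 2) powr N) = V * V * P * P * (\<bar>m - m2\<bar> / 4 powr N)"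
  proof -
    have "(4::real) powr N = 2 powr N * 2 powr N" using powr_mult[of 2 2 N] by simp
    then show ?thesis unfolding e1 by (simp add: field_simps)
  qed
  with 2 R have "V * V * P * P * (\<bar>m - m2\<bar> / 4 powr N) \<le> V * V * P * P * (\<mu> * (2 powr N + D * 2 powr (\<sigma> * q) * 2 powr N / V))"
    by (simp add: mult.assoc)
  then have "\<bar>m - m2\<bar> / 4 powr N \<le> \<mu> * (2 powr N + D * 2 powr (\<sigma> * q) * 2 powr N / V)"
    by (rule mult_left_le_imp_le) (use V P in simp)
  then have "\<bar>m - m2\<bar> \<le> \<mu> * (2 powr N + D * 2 powr (\<sigma> * q) * 2 powr N / V) * 4 powr N"
    by (simp add: pos_divide_le_eq)
  then show ?thesis by (simp add: K_def m_def m2_def A1_def A2_def N_def V_def \<mu>_def mult_ac)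
qed


lemma avg_le_1:
  fixes u :: "real^'n \<Rightarrow> real"
  assumes "u \<in> borel_measurable borel" "\<And>x. x \<in> ball a r \<Longrightarrow> \<bar>u x\<bar> \<le> 1" and r: "0 < r"
  shows "\<bar>avg u (ball a r)\<bar> \<le> 1"
proof -
  define V where "V = measure lborel (ball a r)"
  have V: "0 < V" "emeasure lborel (ball a r) = ennreal V"
    using r by (auto simp: V_def measure_ball_dim emeasure_ball_dim)
  have "ennreal (\<bar>avg u (ball a r)\<bar> * V) = ennreal \<bar>avg u (ball a r) - 0\<bar> * emeasure lborel (ball a r)"
    using V by (simp add: ennreal_mult)
  also have "\<dots> \<le> (\<integral>\<^sup>+x\<in>ball a r. ennreal \<bar>u x - 0\<bar> \<partial>lborel)" by (rule avg_deviation[OF assms])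
  also have "\<dots> \<le> (\<integral>\<^sup>+x. indicator (ball a r) x \<partial>lborel)"
    using assms(2) by (intro nn_integral_mono) (simp add: indicator_def)
  also have "\<dots> = ennreal (1 * V)" using V by simp
  finally have "\<bar>avg u (ball a r)\<bar> * V \<le> 1 * V" by (subst (asm) ennreal_le_iff) (use V in auto)
  then show ?thesis using V by (simp add: mult_le_cancel_right)
qed

lemma holder_bound_imp_continuous_on:
  fixes v :: "real^'n \<Rightarrow> real"
  assumes \<gamma>: "0 < \<gamma>" and v: "\<And>x y. x \<in> S \<Longrightarrow> y \<in> S \<Longrightarrow> \<bar>v x - v y\<bar> \<le> C * norm (x - y) powr \<gamma>"
  shows "continuous_on S v"
  unfolding continuous_on_iff
proof (intro ballI allI impI)
  fix x e assume x: "x \<in> S" and e: "(0::real) < e"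
  have "((\<lambda>y. C * norm (x - y) powr \<gamma>) \<longlongrightarrow> C * norm (x - x) powr \<gamma>) (at x)"
    using \<gamma> by (intro tendsto_intros tendsto_powr') auto
  then have "\<forall>\<^sub>F y in at x. C * norm (x - y) powr \<gamma> < e"
    using e by (intro order_tendstoD(2)) auto
  then obtain d where d: "0 < d" "\<And>y. y \<noteq> x \<Longrightarrow> dist y x < d \<Longrightarrow> C * norm (x - y) powr \<gamma> < e"
    unfolding eventually_at by auto
  show "\<exists>d>0. \<forall>x'\<in>S. dist x' x < d \<longrightarrow> dist (v x') (v x) < e"
  proof (intro exI[of _ d] conjI d(1) ballI impI)
    fix y assume y: "y \<in> S" "dist y x < d"
    show "dist (v y) (v x) < e"
    proof (cases "y = x")
      case False
      have "\<bar>v x - v y\<bar> \<le> C * norm (x - y) powr \<gamma>" using x y by (intro v)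
      also have "\<dots> < e" using d(2)[OF False y(2)] .
      finally show ?thesis by (simp add: dist_real_def abs_minus_commute)
    qed (use e in simp)
  qed
qed

text \<open>
  The representative is the limit of averages over balls of dyadic radii. By \<open>avg_comparison\<close>
  consecutive averages differ by a geometric sequence, so the limit exists, is attained at a geometric
  rate, and is Hoelder continuous because averages around two points at distance \<open>t\<close> are comparable at
  scale \<open>t\<close>. The averages also converge to \<open>u\<close> in \<open>L\<^sup>1\<close>, at the rate \<open>\<rho>\<^sup>\<sigma>\<close>; hence the limit
  equals \<open>u\<close> almost everywhere.
\<close>

lemma nikolskii_imp_holder:
  fixes U :: "(real^'n \<Rightarrow> real) set"
  assumes U: "unit_class U" and nik: "nikolskii U q \<sigma>" and q: "1 \<le> q" and \<sigma>: "CARD('n) / q < \<sigma>"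
    and \<gamma>: "\<gamma> = \<sigma> - CARD('n) / q"
  obtains C where "0 \<le> C"
    "\<And>u. u \<in> U \<Longrightarrow> \<exists>v. (\<forall>x y. norm x < 1 / 2 \<longrightarrow> norm y < 1 / 2 \<longrightarrow> \<bar>v x - v y\<bar> \<le> C * norm (x - y) powr \<gamma>)
        \<and> (AE x in lborel. norm x < 1 / 2 \<longrightarrow> v x = u x)"
proof -
  have r34: "0 < (3 / 4 :: real)" "(3 / 4 :: real) < 1" by simp_all
  obtain D where D: "0 \<le> D" "\<And>(u :: real^'n \<Rightarrow> real) h. u \<in> U \<Longrightarrow> norm h < 1 - 3 / 4 \<Longrightarrow>
      diff_integral q u h (3 / 4) \<le> ennreal (D * norm h powr (\<sigma> * q))"
    by (rule nikolskiiE[OF nik r34]) (rule that)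
  have \<gamma>0: "0 < \<gamma>" using \<sigma> \<gamma> by simp
  have "0 \<le> CARD('n) / q" using q by simp
  then have \<sigma>0: "0 < \<sigma>" using \<sigma> by linarith
  define K where "K = 4 powr CARD('n) * (2 powr CARD('n) + D * 2 powr (\<sigma> * q) * 2 powr CARD('n) / unit_ball_vol CARD('n))"
  have K: "0 \<le> K" using D by (simp add: K_def)
  define \<rho> where "\<rho> k = 2 powr (- real k) / 8" for k :: nat
  have \<rho>: "0 < \<rho> k" "\<rho> k \<le> 1 / 8" "\<rho> k / 2 = \<rho> (Suc k)" for k
  proof -
    have "- real (Suc k) = - real k - 1" by simp
    then have "2 powr (- real (Suc k)) = 2 powr (- real k) / (2 powr 1 :: real)" by (simp only: powr_diff)
    then show "\<rho> k / 2 = \<rho> (Suc k)" by (simp add: \<rho>_def)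
  qed (auto simp: \<rho>_def powr_minus divide_simps ge_one_powr_ge_zero)
  define \<beta> where "\<beta> = 2 powr (- \<gamma>)"
  have \<beta>: "0 < \<beta>" "\<beta> < 1" using \<gamma>0 by (auto simp: \<beta>_def powr_less_one)
  define K1 where "K1 = K * 8 powr (- \<gamma>)"
  define K2 where "K2 = K1 / (1 - \<beta>)"
  have K1: "0 \<le> K1" "0 \<le> K2" using K \<beta> by (auto simp: K1_def K2_def)
  have K\<rho>: "K * \<rho> k powr \<gamma> = K1 * \<beta> ^ k" for k
  proof -
    have "\<beta> ^ k = (2 powr (- real k)) powr \<gamma>"
      using powr_realpow[OF \<beta>(1), of k] by (simp add: \<beta>_def powr_powr mult.commute)
    moreover have "\<rho> k powr \<gamma> = (2 powr (- real k)) powr \<gamma> / 8 powr \<gamma>"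
      unfolding \<rho>_def by (rule powr_divide)
    ultimately show ?thesis unfolding K1_def powr_minus_divide[of "8"] by (metis mult.assoc mult.commute times_divide_eq_left mult_1_left times_divide_eq_right)
  qed
  define C where "C = (2 * K2 + 2) * 16 powr \<gamma> + (2 * K2 + K1) * 32 powr \<gamma>"
  show thesis
  proof (rule that[of C])
    show "0 \<le> C" using K1 by (simp add: C_def)
    fix u assume u: "u \<in> U"
    note [measurable] = unit_classD(1)[OF U u]
    have u1: "\<bar>u x\<bar> \<le> 1" if "norm x < 1" for x using unit_classD(2)[OF U u that] .
    have nik': "diff_integral q u z (3 / 4) \<le> ennreal (D * norm z powr (\<sigma> * q))" if "norm z < 1 / 4" for z
      using D(2)[OF u] that by simp
    define a where "a x k = avg u (ball x (\<rho> k))" for x k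
    have sub: "ball x (\<rho> k) \<subseteq> ball 0 (3 / 4)" if "norm x < 1 / 2" for x k
    proof
      fix y assume "y \<in> ball x (\<rho> k)"
      then have "norm (y - x) < 1 / 8" using \<rho>(2)[of k] by (simp add: dist_norm norm_minus_commute)
      then show "y \<in> ball 0 (3 / 4)" using that norm_triangle_ineq[of x "y - x"] by simp
    qed
    have comp: "\<bar>a y (Suc k) - avg u (ball x r)\<bar> \<le> K1 * \<beta> ^ k"
      if "norm x < 1 / 2" "ball y (\<rho> k / 2) \<subseteq> ball x (\<rho> k)" "\<rho> k / 2 \<le> r" "r \<le> \<rho> k" for x y k r
      using avg_comparison[OF unit_classD(1)[OF U u] u1 q D(1) nik' less_imp_le[OF \<sigma>0] \<gamma> \<rho>(1,2)[of k] sub[OF that(1)] that(2), of x r] that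
      by (simp add: K_def[symmetric] K\<rho> a_def \<rho>(3) subset_ball)
    have step: "\<bar>a x (Suc k) - a x k\<bar> \<le> K1 * \<beta> ^ k" if "norm x < 1 / 2" for x k
      using comp[OF that, of x k "\<rho> k"] \<rho>(1)[of k] by (simp add: a_def subset_ball)
    have tail: "\<bar>a x (k + n) - a x k\<bar> \<le> K2 * \<beta> ^ k * (1 - \<beta> ^ n)" if x: "norm x < 1 / 2" for x k n
    proof (induction n)
      case (Suc n)
      have "K2 * \<beta> ^ k * (1 - \<beta> ^ Suc n) = K2 * \<beta> ^ k * (1 - \<beta> ^ n) + K2 * (1 - \<beta>) * \<beta> ^ (k + n)"
        by (simp add: algebra_simps power_add)
      also have "K2 * (1 - \<beta>) = K1" using \<beta> by (simp add: K2_def)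
      finally show ?case using Suc step[OF x, of "k + n"] by simp
    qed simp
    have conv: "convergent (a x)" if x: "norm x < 1 / 2" for x
    proof -
      have "summable (\<lambda>k. K1 * \<beta> ^ k)" using \<beta> by (intro summable_mult summable_geometric) auto
      then have "summable (\<lambda>k. a x (Suc k) - a x k)"
        by (rule summable_comparison_test') (use step[OF x] in simp)
      then have "convergent (\<lambda>n. a x n - a x 0)"
        by (simp add: summable_iff_convergent sum_lessThan_telescope)
      then show ?thesis by (simp add: convergent_diff_const_right_iff)
    qed
    define v where "v x = lim (a x)" for x
    have va: "\<bar>v x - a x k\<bar> \<le> K2 * \<beta> ^ k" if x: "norm x < 1 / 2" for x k
    proof -
      have "a x \<longlonglongrightarrow> v x" using conv[OF x] by (simp add: v_def convergent_LIMSEQ_iff)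
      then have "(\<lambda>n. a x (n + k)) \<longlonglongrightarrow> v x" by (rule LIMSEQ_ignore_initial_segment)
      then have "(\<lambda>n. \<bar>a x (n + k) - a x k\<bar>) \<longlonglongrightarrow> \<bar>v x - a x k\<bar>" by (intro tendsto_intros)
      then show ?thesis
      proof (rule LIMSEQ_le_const2)
        have "\<bar>a x (n + k) - a x k\<bar> \<le> K2 * \<beta> ^ k" for n
        proof -
          have "K2 * \<beta> ^ k * (1 - \<beta> ^ n) \<le> K2 * \<beta> ^ k * 1"
            using K1 \<beta> by (intro mult_left_mono) auto
          then show ?thesis using tail[OF x, of k n] by (simp add: add.commute)
        qed
        then show "\<exists>N. \<forall>n\<ge>N. \<bar>a x (n + k) - a x k\<bar> \<le> K2 * \<beta> ^ k" by blast
      qed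
    qed
    have holder: "\<bar>v x - v y\<bar> \<le> C * norm (x - y) powr \<gamma>" if xy: "norm x < 1 / 2" "norm y < 1 / 2" for x y
    proof (cases "x = y")
      case False
      define t where "t = norm (x - y)"
      have t: "0 < t" using False by (simp add: t_def)
      show ?thesis
      proof (cases "16 * t \<le> 1")
        case True
        \<comment> \<open>at this scale \<open>\<rho> k / 4 < t \<le> \<rho> k / 2\<close>, so both half-size balls lie in the ball around \<open>x\<close>\<close>
        obtain k where k: "16 * t \<le> 2 powr (- real k)" "2 powr (- real k) < 2 * (16 * t)"
          using dyadic_shell[of "16 * t"] True t by auto
        have "ball y (\<rho> k / 2) \<subseteq> ball x (\<rho> k)"
        proof
          fix z assume "z \<in> ball y (\<rho> k / 2)"
          moreover have "dist x y \<le> \<rho> k / 2" using k by (simp add: \<rho>_def dist_norm t_def)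
          ultimately show "z \<in> ball x (\<rho> k)" using dist_triangle[of x z y] by (simp add: dist_commute)
        qed
        then have "\<bar>a y (Suc k) - a x (Suc k)\<bar> \<le> K1 * \<beta> ^ k"
          using comp[OF xy(1) _ order_refl, of y k] \<rho>(1)[of k] by (simp add: a_def[of x "Suc k"] flip: \<rho>(3))
        moreover have "K2 * \<beta> ^ Suc k \<le> K2 * \<beta> ^ k" using K1 \<beta> by (intro mult_left_mono power_decreasing) auto
        ultimately have "\<bar>v x - v y\<bar> \<le> (2 * K2 + K1) * \<beta> ^ k"
          using va[OF xy(1), of "Suc k"] va[OF xy(2), of "Suc k"] by (simp add: distrib_right)
        also have "\<beta> ^ k = (2 powr (- real k)) powr \<gamma>"
          using powr_realpow[OF \<beta>(1), of k] by (simp add: \<beta>_def powr_powr mult.commute)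
        also have "(2 * K2 + K1) * (2 powr (- real k)) powr \<gamma> \<le> (2 * K2 + K1) * (32 * t) powr \<gamma>"
          using k K1 \<gamma>0 by (intro mult_left_mono powr_mono2) auto
        also have "\<dots> = (2 * K2 + K1) * 32 powr \<gamma> * t powr \<gamma>" using t by (simp add: powr_mult)
        also have "\<dots> \<le> C * t powr \<gamma>" using K1 by (intro mult_right_mono) (auto simp: C_def)
        finally show ?thesis by (simp add: t_def)
      next
        case False
        have a1: "\<bar>a x 0\<bar> \<le> 1" if "norm x < 1 / 2" for x
          unfolding a_def using \<rho>(1) sub[OF that, of 0] by (intro avg_le_1 u1) auto
        have "\<bar>v x - v y\<bar> \<le> (2 * K2 + 2) * 1"
          using va[OF xy(1), of 0] va[OF xy(2), of 0] a1[OF xy(1)] a1[OF xy(2)] by simp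
        also have "\<dots> \<le> (2 * K2 + 2) * (16 * t) powr \<gamma>"
          using False K1 \<gamma>0 by (intro mult_left_mono ge_one_powr_ge_zero) auto
        also have "\<dots> = (2 * K2 + 2) * 16 powr \<gamma> * t powr \<gamma>" using t by (simp add: powr_mult)
        also have "\<dots> \<le> C * t powr \<gamma>" using K1 by (intro mult_right_mono) (auto simp: C_def)
        finally show ?thesis by (simp add: t_def)
      qed
    qed simp
    define B where "B = ball (0::real^'n) (1 / 2)"
    define VB where "VB = measure lborel B"
    have VB: "emeasure lborel B = ennreal VB" "0 \<le> VB" by (auto simp: B_def VB_def emeasure_ball_measure)
    have [measurable]: "B \<in> sets borel" by (simp add: B_def)
    have contv: "continuous_on B v"
      by (rule holder_bound_imp_continuous_on[OF \<gamma>0 holder]) (simp_all add: B_def)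
    have vm [measurable]: "(\<lambda>x. indicator B x * v x) \<in> borel_measurable borel"
      using borel_measurable_continuous_on_indicator[OF _ contv] by simp
    define J where "J = (\<integral>\<^sup>+x. ennreal \<bar>indicator B x * v x - indicator B x * u x\<bar> \<partial>lborel)"
    have J: "J \<le> ennreal (K2 * \<beta> ^ k * VB + \<rho> k powr \<sigma> * (VB + D))" for k
    proof -
      define Bk where "Bk = ball (0::real^'n) (\<rho> k)"
      define V where "V = measure lborel Bk"
      have V: "0 < V" "emeasure lborel Bk = ennreal V"
        using \<rho>(1)[of k] by (auto simp: V_def Bk_def measure_ball_dim emeasure_ball_dim)
      have [measurable]: "Bk \<in> sets borel" by (simp add: Bk_def)
      define G where "G z = ennreal \<bar>u (fst z + snd z) - u (fst z)\<bar> * indicator B (fst z) * indicator Bk (snd z)" for z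
      have [measurable]: "G \<in> borel_measurable borel" unfolding G_def[abs_def] by measurable
      have pt: "ennreal \<bar>indicator B x * v x - indicator B x * u x\<bar> * ennreal V \<le> ennreal (K2 * \<beta> ^ k * V) * indicator B x + (\<integral>\<^sup>+z. G (x, z) \<partial>lborel)" for x
      proof (cases "x \<in> B")
        case True
        then have x: "norm x < 1 / 2" by (simp add: B_def)
        have "\<bar>v x - u x\<bar> \<le> K2 * \<beta> ^ k + \<bar>a x k - u x\<bar>" using va[OF x, of k] by linarith
        then have "ennreal \<bar>v x - u x\<bar> * ennreal V \<le> (ennreal (K2 * \<beta> ^ k) + ennreal \<bar>a x k - u x\<bar>) * ennreal V"
          using K1 \<beta> by (intro mult_right_mono) (simp_all add: ennreal_leI flip: ennreal_plus)
        also have "\<dots> = ennreal (K2 * \<beta> ^ k * V) + ennreal \<bar>a x k - u x\<bar> * emeasure lborel (ball x (\<rho> k))"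
        proof -
          have "emeasure lborel (ball x (\<rho> k)) = ennreal V"
            using V(2) \<rho>(1)[of k] by (simp add: Bk_def emeasure_ball_dim)
          then show ?thesis using K1 \<beta> by (simp add: distrib_right ennreal_mult')
        qed
        also have "ennreal \<bar>a x k - u x\<bar> * emeasure lborel (ball x (\<rho> k)) \<le> (\<integral>\<^sup>+y\<in>ball x (\<rho> k). ennreal \<bar>u y - u x\<bar> \<partial>lborel)"
          unfolding a_def using \<rho>(1) sub[OF x, of k] by (intro avg_deviation u1) auto
        also have "(\<integral>\<^sup>+y\<in>ball x (\<rho> k). ennreal \<bar>u y - u x\<bar> \<partial>lborel) = (\<integral>\<^sup>+z. ennreal \<bar>u (z + x) - u x\<bar> * indicator (ball x (\<rho> k)) (z + x) \<partial>lborel)"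
          by (rule nn_integral_shift[symmetric]) measurable
        also have "\<dots> = (\<integral>\<^sup>+z. G (x, z) \<partial>lborel)"
          using True by (intro nn_integral_cong) (auto simp: G_def Bk_def indicator_def dist_norm add.commute)
        finally show ?thesis using True by (simp add: add_left_mono)
      qed simp
      have "J * ennreal V = (\<integral>\<^sup>+x. ennreal \<bar>indicator B x * v x - indicator B x * u x\<bar> * ennreal V \<partial>lborel)"
        unfolding J_def by (rule nn_integral_multc[symmetric]) measurable
      also have "\<dots> \<le> (\<integral>\<^sup>+x. ennreal (K2 * \<beta> ^ k * V) * indicator B x + (\<integral>\<^sup>+z. G (x, z) \<partial>lborel) \<partial>lborel)"
        by (rule nn_integral_mono) (rule pt)
      also have "\<dots> = (\<integral>\<^sup>+x. ennreal (K2 * \<beta> ^ k * V) * indicator B x \<partial>lborel) + (\<integral>\<^sup>+x. \<integral>\<^sup>+z. G (x, z) \<partial>lborel \<partial>lborel)"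
        by (rule nn_integral_add) measurable
      also have "(\<integral>\<^sup>+x. ennreal (K2 * \<beta> ^ k * V) * indicator B x \<partial>lborel) = ennreal (K2 * \<beta> ^ k * V) * ennreal VB"
        by (subst nn_integral_cmult_indicator) (simp_all add: VB)
      also have "(\<integral>\<^sup>+x. \<integral>\<^sup>+z. G (x, z) \<partial>lborel \<partial>lborel) = (\<integral>\<^sup>+z. \<integral>\<^sup>+x. G (x, z) \<partial>lborel \<partial>lborel)"
        using nn_integral_pair[of G] by simp
      also have "ennreal (K2 * \<beta> ^ k * V) * ennreal VB + (\<integral>\<^sup>+z. \<integral>\<^sup>+x. G (x, z) \<partial>lborel \<partial>lborel)
        \<le> ennreal (K2 * \<beta> ^ k * V) * ennreal VB + ennreal (\<rho> k powr \<sigma> * (VB + D)) * ennreal V"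
      proof (rule add_left_mono)
        have "(\<integral>\<^sup>+z. \<integral>\<^sup>+x. G (x, z) \<partial>lborel \<partial>lborel) \<le> (\<integral>\<^sup>+z. ennreal (\<rho> k powr \<sigma> * (VB + D)) * indicator Bk z \<partial>lborel)"
        proof (rule nn_integral_mono)
          fix z :: "real^'n"
          show "(\<integral>\<^sup>+x. G (x, z) \<partial>lborel) \<le> ennreal (\<rho> k powr \<sigma> * (VB + D)) * indicator Bk z"
          proof (cases "z \<in> Bk")
            case True
            then have z: "norm z < \<rho> k" "norm z < 1 / 4" using \<rho>(2)[of k] by (auto simp: Bk_def)
            define \<mu> where "\<mu> = \<rho> k powr \<sigma>"
            have \<mu>: "0 < \<mu>" using \<rho>(1)[of k] by (simp add: \<mu>_def)
            have "(\<integral>\<^sup>+x. G (x, z) \<partial>lborel) = (\<integral>\<^sup>+x\<in>B. ennreal \<bar>u (x + z) - u x\<bar> \<partial>lborel)"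
              using True by (simp add: G_def)
            also have "\<dots> \<le> ennreal \<mu> * emeasure lborel B + ennreal (\<mu> powr (1 - q)) * diff_integral q u z (3 / 4)"
              by (rule diff_L1_bound[OF _ q \<mu>]) (auto simp: B_def)
            also have "\<dots> \<le> ennreal \<mu> * ennreal VB + ennreal (\<mu> powr (1 - q)) * ennreal (D * \<rho> k powr (\<sigma> * q))"
            proof (intro add_mono mult_left_mono)
              have "diff_integral q u z (3 / 4) \<le> ennreal (D * norm z powr (\<sigma> * q))" by (rule nik'[OF z(2)])
              also have "\<dots> \<le> ennreal (D * \<rho> k powr (\<sigma> * q))"
                using z D \<sigma>0 q by (intro ennreal_leI mult_left_mono powr_mono2) auto
              finally show "diff_integral q u z (3 / 4) \<le> ennreal (D * \<rho> k powr (\<sigma> * q))" .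
            qed (simp_all add: VB)
            also have "\<dots> = ennreal (\<mu> * VB + \<mu> powr (1 - q) * (D * \<rho> k powr (\<sigma> * q)))"
              using \<mu> VB D by (simp add: ennreal_mult'[symmetric] flip: ennreal_plus)
            also have "\<mu> powr (1 - q) * (D * \<rho> k powr (\<sigma> * q)) = \<mu> * D"
            proof -
              have "\<rho> k powr (\<sigma> * q) = \<mu> powr q" by (simp add: \<mu>_def powr_powr)
              then have "\<mu> powr (1 - q) * \<rho> k powr (\<sigma> * q) = \<mu>" using \<mu> by (simp add: powr_add[symmetric])
              then show ?thesis by (metis mult.assoc mult.commute)
            qed
            finally show ?thesis using True by (simp add: \<mu>_def distrib_left)
          qed (simp add: G_def)
        qed
        also have "\<dots> = ennreal (\<rho> k powr \<sigma> * (VB + D)) * emeasure lborel Bk"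
          by (rule nn_integral_cmult_indicator) simp
        finally show "(\<integral>\<^sup>+z. \<integral>\<^sup>+x. G (x, z) \<partial>lborel \<partial>lborel) \<le> ennreal (\<rho> k powr \<sigma> * (VB + D)) * ennreal V"
          by (simp add: V(2))
      qed
      also have "\<dots> = ennreal (K2 * \<beta> ^ k * VB + \<rho> k powr \<sigma> * (VB + D)) * ennreal V"
        using K1 \<beta> V VB D by (simp add: ennreal_mult'[symmetric] algebra_simps flip: ennreal_plus)
      finally have "J * ennreal V \<le> ennreal (K2 * \<beta> ^ k * VB + \<rho> k powr \<sigma> * (VB + D)) * ennreal V" .
      then have "J * ennreal V * ennreal (1 / V) \<le> ennreal (K2 * \<beta> ^ k * VB + \<rho> k powr \<sigma> * (VB + D)) * ennreal V * ennreal (1 / V)"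
        by (rule mult_right_mono) simp
      moreover have "ennreal V * ennreal (1 / V) = 1" using V by (simp add: ennreal_mult'[symmetric])
      ultimately show ?thesis by (simp add: mult.assoc)
    qed
    have "(\<lambda>k. K2 * \<beta> ^ k * VB + \<rho> k powr \<sigma> * (VB + D)) \<longlonglongrightarrow> K2 * 0 * VB + 0 * (VB + D)"
    proof (intro tendsto_add tendsto_mult tendsto_const)
      show "(\<lambda>k. \<beta> ^ k) \<longlonglongrightarrow> 0" using \<beta> by (intro LIMSEQ_realpow_zero) auto
      have "(\<lambda>k. (1 / 2) ^ k / 8 :: real) \<longlonglongrightarrow> 0 / 8" by (intro tendsto_divide LIMSEQ_realpow_zero tendsto_const) auto
      then have lim: "(\<lambda>k. (1 / 2) ^ k / 8 :: real) \<longlonglongrightarrow> 0" by (simp only: div_0)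
      have "\<rho> k = (1 / 2) ^ k / 8" for k
        by (simp add: \<rho>_def powr_minus powr_realpow power_one_over inverse_eq_divide)
      then have "\<rho> = (\<lambda>k. (1 / 2) ^ k / 8)" by (rule ext)
      then have "\<rho> \<longlonglongrightarrow> 0" using lim by (simp only:)
      then show "(\<lambda>k. \<rho> k powr \<sigma>) \<longlonglongrightarrow> 0"
        using tendsto_powr'[of \<rho> 0 sequentially "\<lambda>_. \<sigma>" \<sigma>] \<sigma>0 \<rho>(1) by (simp add: less_imp_le)
    qed
    then have "(\<lambda>k. ennreal (K2 * \<beta> ^ k * VB + \<rho> k powr \<sigma> * (VB + D))) \<longlonglongrightarrow> ennreal 0"
      by (intro tendsto_ennrealI) simp
    then have "J \<le> ennreal 0" by (rule LIMSEQ_le_const) (use J in blast)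
    then have "J = 0" by simp
    then have "AE x in lborel. ennreal \<bar>indicator B x * v x - indicator B x * u x\<bar> = 0"
      unfolding J_def by (subst (asm) nn_integral_0_iff_AE) auto
    then have ae: "AE x in lborel. norm x < 1 / 2 \<longrightarrow> v x = u x"
      by eventually_elim (auto simp: B_def indicator_def split: if_splits)
    show "\<exists>v. (\<forall>x y. norm x < 1 / 2 \<longrightarrow> norm y < 1 / 2 \<longrightarrow> \<bar>v x - v y\<bar> \<le> C * norm (x - y) powr \<gamma>)
        \<and> (AE x in lborel. norm x < 1 / 2 \<longrightarrow> v x = u x)"
      using holder ae by (intro exI[of _ v]) auto
  qed
qed

section \<open>Lebesgue measure versus Borel measure\<close>

text \<open>
  An order \<open>\<sigma>\<close> strictly between \<open>\<gamma>\<close> and the critical exponent leaves room for the loss \<open>N / q\<close>, which is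
  made at most \<open>\<sigma> - \<gamma>\<close> by taking \<open>q\<close> large.
\<close>

lemma normalized_regularity:
  fixes s p \<gamma> :: real
  assumes p: "2 < p" and s: "0 < s" "s * p \<le> p - 2" and \<gamma>: "0 < \<gamma>" "\<gamma> < s * p / (p - 2)"
  obtains C where "0 \<le> C"
    "\<And>u :: real^'n \<Rightarrow> real. normalized s p u \<Longrightarrow>
       \<exists>v. (\<forall>x y. norm x < 1 / 2 \<longrightarrow> norm y < 1 / 2 \<longrightarrow> \<bar>v x - v y\<bar> \<le> C * norm (x - y) powr \<gamma>)
         \<and> (AE x in lborel. norm x < 1 / 2 \<longrightarrow> v x = u x)"
proof -
  obtain \<sigma> where \<sigma>: "\<gamma> < \<sigma>" "\<sigma> < s * p / (p - 2)" using dense[OF \<gamma>(2)] by blast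
  obtain q where q: "CARD('n) / (\<sigma> - \<gamma>) \<le> q" "1 \<le> q" "nikolskii {u :: real^'n \<Rightarrow> real. normalized s p u} q \<sigma>"
    by (rule nikolskii_arbitrary_integrability[OF p s \<sigma>(2), where 'n='n]) (rule that)
  have "CARD('n) / q \<le> \<sigma> - \<gamma>" using q \<sigma> by (simp add: field_simps)
  then have e: "\<gamma> \<le> \<sigma> - CARD('n) / q" "CARD('n) / q < \<sigma>" using \<gamma> by auto
  obtain C where C: "0 \<le> C"
    "\<And>u :: real^'n \<Rightarrow> real. u \<in> {u. normalized s p u} \<Longrightarrow> \<exists>v. (\<forall>x y. norm x < 1 / 2 \<longrightarrow> norm y < 1 / 2 \<longrightarrow> \<bar>v x - v y\<bar> \<le> C * norm (x - y) powr (\<sigma> - CARD('n) / q))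
        \<and> (AE x in lborel. norm x < 1 / 2 \<longrightarrow> v x = u x)"
    by (rule nikolskii_imp_holder[OF unit_class_normalized q(3,2) e(2) refl]) (rule that)
  show thesis
  proof (rule that[OF C(1)])
    fix u :: "real^'n \<Rightarrow> real" assume "normalized s p u"
    then have "u \<in> {u. normalized s p u}" by simp
    then obtain v where v: "\<And>x y. norm x < 1 / 2 \<Longrightarrow> norm y < 1 / 2 \<Longrightarrow> \<bar>v x - v y\<bar> \<le> C * norm (x - y) powr (\<sigma> - CARD('n) / q)"
        "AE x in lborel. norm x < 1 / 2 \<longrightarrow> v x = u x"
      using C(2) by blast
    have "\<bar>v x - v y\<bar> \<le> C * norm (x - y) powr \<gamma>" if xy: "norm x < 1 / 2" "norm y < 1 / 2" for x y
    proof -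
      have "norm (x - y) \<le> 1" using norm_triangle_ineq4[of x y] xy by linarith
      then have "norm (x - y) powr (\<sigma> - CARD('n) / q) \<le> norm (x - y) powr \<gamma>" using e by (intro powr_mono') auto
      then have "C * norm (x - y) powr (\<sigma> - CARD('n) / q) \<le> C * norm (x - y) powr \<gamma>" using C(1) by (rule mult_left_mono)
      then show ?thesis using v(1)[OF xy] by linarith
    qed
    then show "\<exists>v. (\<forall>x y. norm x < 1 / 2 \<longrightarrow> norm y < 1 / 2 \<longrightarrow> \<bar>v x - v y\<bar> \<le> C * norm (x - y) powr \<gamma>)
         \<and> (AE x in lborel. norm x < 1 / 2 \<longrightarrow> v x = u x)"
      using v(2) by blast
  qed
qed

lemma sigma_finite_lebesgue: "sigma_finite_measure (lebesgue :: 'a::euclidean_space measure)"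
proof
  obtain A :: "'a set set" where "countable A" "A \<subseteq> sets lborel" "\<Union>A = space lborel" "\<forall>a\<in>A. emeasure lborel a \<noteq> \<infinity>"
    using lborel.sigma_finite_countable by blast
  then show "\<exists>A::'a set set. countable A \<and> A \<subseteq> sets lebesgue \<and> \<Union>A = space lebesgue \<and> (\<forall>a\<in>A. emeasure lebesgue a \<noteq> \<infinity>)"
    by (intro exI[of _ A]) auto
qed

lemma sigma_finite_lebesgue_on:
  fixes E :: "'a::euclidean_space set"
  assumes "E \<in> sets lebesgue"
  shows "sigma_finite_measure (lebesgue_on E)"
  using sigma_finite_lebesgue assms by (rule sigma_finite_measure_restrict_space)

lemma id_lebesgue_borel:
  shows "(\<lambda>x. x) \<in> borel_measurable (lebesgue_on E :: 'a::euclidean_space measure)"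
    and "(\<lambda>x. x) \<in> borel_measurable (lebesgue :: 'a::euclidean_space measure)"
proof -
  show "(\<lambda>x. x) \<in> borel_measurable (lebesgue :: 'a::euclidean_space measure)"
    by (intro measurable_completion) auto
  then show "(\<lambda>x. x) \<in> borel_measurable (lebesgue_on E :: 'a::euclidean_space measure)"
    by (rule measurable_restrict_space1)
qed

text \<open>
  The product of two Lebesgue \<open>\<sigma>\<close>-algebras is not complete, and a Lebesgue measurable function composed
  with \<open>(x, y) \<mapsto> x - y\<close> need not be measurable for it. Borel functions cause no such trouble, and
  they suffice after a modification on a null set.
\<close>

lemma borel_measurable_lebesgue_on_pair:
  fixes f :: "'a::euclidean_space \<times> 'b::euclidean_space \<Rightarrow> 'c::topological_space"
  assumes f: "f \<in> borel_measurable borel"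
  shows "f \<in> borel_measurable (lebesgue_on E \<Otimes>\<^sub>M lebesgue_on F)"
    and "f \<in> borel_measurable (lebesgue \<Otimes>\<^sub>M lebesgue)"
proof -
  have "(\<lambda>z. (fst z, snd z)) \<in> borel_measurable (lebesgue_on E \<Otimes>\<^sub>M lebesgue_on F)"
    by (intro borel_measurable_Pair measurable_compose[OF measurable_fst id_lebesgue_borel(1)] measurable_compose[OF measurable_snd id_lebesgue_borel(1)])
  from measurable_compose[OF this f] show "f \<in> borel_measurable (lebesgue_on E \<Otimes>\<^sub>M lebesgue_on F)" by simp
  have "(\<lambda>z. (fst z, snd z)) \<in> borel_measurable (lebesgue \<Otimes>\<^sub>M lebesgue)"
    by (intro borel_measurable_Pair measurable_compose[OF measurable_fst id_lebesgue_borel(2)] measurable_compose[OF measurable_snd id_lebesgue_borel(2)])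
  from measurable_compose[OF this f] show "f \<in> borel_measurable (lebesgue \<Otimes>\<^sub>M lebesgue)" by simp
qed

lemma nn_integral_lebesgue_on:
  fixes E :: "'a::euclidean_space set"
  assumes "E \<in> sets lebesgue"
  shows "(\<integral>\<^sup>+x. f x \<partial>lebesgue_on E) = (\<integral>\<^sup>+x\<in>E. f x \<partial>lborel)"
  using assms by (simp add: nn_integral_restrict_space nn_integral_completion)

lemma nn_integral_lebesgue_on_pair:
  fixes f :: "'a::euclidean_space \<times> 'a \<Rightarrow> ennreal"
  assumes f [measurable]: "f \<in> borel_measurable borel" and E [measurable]: "E \<in> sets borel"
  shows "(\<integral>\<^sup>+z. f z \<partial>(lebesgue_on E \<Otimes>\<^sub>M lebesgue_on E)) = (\<integral>\<^sup>+z\<in>E \<times> E. f z \<partial>lborel)"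
proof -
  have E': "E \<in> sets lebesgue" using E by simp
  interpret N: sigma_finite_measure "lebesgue_on E" by (rule sigma_finite_lebesgue_on[OF E'])
  have g: "(\<lambda>z. f z * indicator (E \<times> E) z) \<in> borel_measurable borel"
  proof -
    have "(\<lambda>z. f z * (indicator E (fst z) * indicator E (snd z))) \<in> borel_measurable borel" by measurable
    then show ?thesis by (simp add: indicator_times)
  qed
  have "(\<integral>\<^sup>+z. f z \<partial>(lebesgue_on E \<Otimes>\<^sub>M lebesgue_on E)) = (\<integral>\<^sup>+x. \<integral>\<^sup>+y. f (x, y) \<partial>lebesgue_on E \<partial>lebesgue_on E)"
    by (rule N.nn_integral_fst[symmetric]) (rule borel_measurable_lebesgue_on_pair[OF f])
  also have "\<dots> = (\<integral>\<^sup>+x. (\<integral>\<^sup>+y. f (x, y) * indicator E y \<partial>lborel) * indicator E x \<partial>lborel)"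
    by (simp add: nn_integral_lebesgue_on[OF E'])
  also have "\<dots> = (\<integral>\<^sup>+x. \<integral>\<^sup>+y. f (x, y) * indicator (E \<times> E) (x, y) \<partial>lborel \<partial>lborel)"
    by (intro nn_integral_cong) (simp add: indicator_def)
  also have "\<dots> = (\<integral>\<^sup>+z\<in>E \<times> E. f z \<partial>lborel)" by (rule nn_integral_pair(1)[symmetric]) (rule g)
  finally show ?thesis .
qed

lemma AE_pair_components:
  assumes M: "sigma_finite_measure M" and P: "AE x in M. P x"
  shows "AE z in M \<Otimes>\<^sub>M M. P (fst z) \<and> P (snd z)"
proof -
  interpret sigma_finite_measure M by (rule M)
  interpret pair_sigma_finite M M ..
  obtain N where N: "N \<in> null_sets M" "{x \<in> space M. \<not> P x} \<subseteq> N"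
    using P by (auto elim!: AE_E)
  have [measurable]: "N \<in> sets M" using N by auto
  have nN: "AE x in M. x \<notin> N" by (rule AE_not_in[OF N(1)])
  have "AE z in M \<Otimes>\<^sub>M M. fst z \<notin> N \<and> snd z \<notin> N"
  proof (rule AE_pair_measure)
    show "AE x in M. AE y in M. fst (x, y) \<notin> N \<and> snd (x, y) \<notin> N"
      using nN by eventually_elim (use nN in auto)
  qed measurable
  moreover have "AE z in M \<Otimes>\<^sub>M M. z \<in> space (M \<Otimes>\<^sub>M M)" by (rule AE_space)
  ultimately show ?thesis by eventually_elim (use N in \<open>auto simp: space_pair_measure\<close>)
qed

text \<open>
  Restricted to Borel sets, the product of Lebesgue measure with itself is the Borel-Lebesgue measure
  of the product space.
\<close>

lemma distr_lebesgue_pair: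
  "distr (lebesgue \<Otimes>\<^sub>M lebesgue) (borel :: ('a::euclidean_space \<times> 'a) measure) (\<lambda>z. z) = lborel"
proof (rule measure_eqI)
  interpret N: sigma_finite_measure "lebesgue :: 'a measure" by (rule sigma_finite_lebesgue)
  fix A assume "A \<in> sets (distr (lebesgue \<Otimes>\<^sub>M lebesgue) (borel :: ('a \<times> 'a) measure) (\<lambda>z. z))"
  then have A [measurable]: "A \<in> sets borel" by simp
  have m: "(\<lambda>z. z) \<in> borel_measurable (lebesgue \<Otimes>\<^sub>M (lebesgue :: 'a measure))"
    by (rule borel_measurable_lebesgue_on_pair(2)) simp
  have ind: "indicator A \<in> borel_measurable (borel :: ('a \<times> 'a) measure)" by measurable
  have "emeasure (distr (lebesgue \<Otimes>\<^sub>M lebesgue) borel (\<lambda>z. z)) A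
      = (\<integral>\<^sup>+z. indicator A z \<partial>distr (lebesgue \<Otimes>\<^sub>M (lebesgue :: 'a measure)) borel (\<lambda>z. z))" by simp
  also have "\<dots> = (\<integral>\<^sup>+z. indicator A z \<partial>(lebesgue \<Otimes>\<^sub>M (lebesgue :: 'a measure)))"
    by (rule nn_integral_distr[OF m]) simp
  also have "\<dots> = (\<integral>\<^sup>+x. \<integral>\<^sup>+y. indicator A (x, y) \<partial>lebesgue \<partial>lebesgue)"
    by (rule N.nn_integral_fst[symmetric]) (rule borel_measurable_lebesgue_on_pair(2)[OF ind])
  also have "\<dots> = (\<integral>\<^sup>+x. \<integral>\<^sup>+y. indicator A (x, y) \<partial>lborel \<partial>lborel)" by (simp add: nn_integral_completion)
  also have "\<dots> = (\<integral>\<^sup>+z. indicator A z \<partial>lborel)" by (rule nn_integral_pair(1)[symmetric]) (rule ind)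
  also have "\<dots> = emeasure lborel A" by simp
  finally show "emeasure (distr (lebesgue \<Otimes>\<^sub>M lebesgue) borel (\<lambda>z. z)) A = emeasure lborel A" .
qed simp

lemma has_bochner_integral_lebesgue_pair:
  fixes f :: "'a::euclidean_space \<times> 'a \<Rightarrow> real"
  assumes "has_bochner_integral (lebesgue \<Otimes>\<^sub>M lebesgue) f c" and f [measurable]: "f \<in> borel_measurable borel"
  shows "has_bochner_integral lborel f c"
proof -
  have m: "(\<lambda>z. z) \<in> borel_measurable (lebesgue \<Otimes>\<^sub>M (lebesgue :: 'a measure))"
    by (rule borel_measurable_lebesgue_on_pair(2)) simp
  have "integrable (distr (lebesgue \<Otimes>\<^sub>M lebesgue) borel (\<lambda>z. z)) f"
    using assms by (subst integrable_distr_eq[OF m]) (auto simp: has_bochner_integral_iff)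
  moreover have "(\<integral>z. f z \<partial>distr (lebesgue \<Otimes>\<^sub>M lebesgue) borel (\<lambda>z. z)) = c"
    using assms by (subst integral_distr[OF m]) (auto simp: has_bochner_integral_iff)
  ultimately show ?thesis by (simp add: distr_lebesgue_pair has_bochner_integral_iff)
qed

lemma has_bochner_integral_affine_zero:
  fixes f :: "'a::euclidean_space \<Rightarrow> real"
  assumes f: "has_bochner_integral lborel f 0" and c: "0 < c"
  shows "has_bochner_integral lborel (\<lambda>x. f (t + c *\<^sub>R x)) 0"
proof -
  have [measurable]: "f \<in> borel_measurable borel"
    using f borel_measurable_has_bochner_integral by fastforce
  have eq: "lborel = density (distr lborel borel (\<lambda>x. t + c *\<^sub>R x)) (\<lambda>_. ennreal (c ^ DIM('a)))"
    using lborel_affine[of c t] c by simp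
  have c0: "c ^ DIM('a) \<noteq> 0" using c by simp
  have "integrable (density (distr lborel borel (\<lambda>x. t + c *\<^sub>R x)) (\<lambda>_. ennreal (c ^ DIM('a)))) f"
    using f eq by (simp add: has_bochner_integral_iff)
  then have "integrable (distr lborel borel (\<lambda>x. t + c *\<^sub>R x)) (\<lambda>x. c ^ DIM('a) *\<^sub>R f x)"
    using c by (subst (asm) integrable_density) auto
  then have "integrable lborel (\<lambda>x. c ^ DIM('a) *\<^sub>R f (t + c *\<^sub>R x))"
    by (subst (asm) integrable_distr_eq) auto
  then have i: "integrable lborel (\<lambda>x. f (t + c *\<^sub>R x))" using c0 by simp
  have "0 = (\<integral>x. f x \<partial>density (distr lborel borel (\<lambda>x. t + c *\<^sub>R x)) (\<lambda>_. ennreal (c ^ DIM('a))))"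
    using f eq by (simp add: has_bochner_integral_iff)
  also have "\<dots> = (\<integral>x. c ^ DIM('a) *\<^sub>R f x \<partial>distr lborel borel (\<lambda>x. t + c *\<^sub>R x))"
    using c by (subst integral_density) auto
  also have "\<dots> = c ^ DIM('a) * (\<integral>x. f (t + c *\<^sub>R x) \<partial>lborel)"
    by (subst integral_distr) auto
  finally have "(\<integral>x. f (t + c *\<^sub>R x) \<partial>lborel) = 0" using c0 by simp
  then show ?thesis using i by (simp add: has_bochner_integral_iff)
qed

lemma epowr_le_imp:
  assumes q: "0 < q" and M: "0 \<le> M" and le: "epowr X (1 / q) \<le> ennreal M"
  shows "X \<le> ennreal (M powr q)"
proof (cases X)
  case (real x)
  then have x: "0 \<le> x" "X = ennreal x" by auto
  have "x powr (1 / q) \<le> M" using le x M by (simp add: epowr_def)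
  then have "(x powr (1 / q)) powr q \<le> M powr q" using q by (intro powr_mono2) auto
  then have "x \<le> M powr q" using q x by (simp add: powr_powr)
  then show ?thesis using x by (simp add: ennreal_leI)
next
  case top
  then show ?thesis using le by (simp add: epowr_def top_unique)
qed

lemma epowr_less_top: "X < top \<Longrightarrow> epowr X a < top"
  by (simp add: epowr_def)

section \<open>Rescaling to the unit ball\<close>

lemma kern_scale:
  assumes "0 < R"
  shows "kern s p (R *\<^sub>R z :: real^'n) = R powr (- (real CARD('n) + s * p)) * kern s p z"
  using assms by (simp add: kern_def powr_mult)

lemma kern_eq_divide: "a / norm (z :: real^'n) powr (real CARD('n) + s * p) = a * kern s p z"
  unfolding kern_def powr_minus_divide by simp

lemma ball_affine_iff:
  fixes x :: "real^'n"
  assumes "0 < R"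
  shows "x0 + R *\<^sub>R x \<in> ball x0 (R * t) \<longleftrightarrow> x \<in> ball 0 t"
  using assms by (simp add: dist_norm)

text \<open>
  Two integrations contribute \<open>R\<^sup>2\<^sup>N\<close> and the kernel \<open>R\<^sup>-\<^sup>N\<^sup>-\<^sup>s\<^sup>p\<close>.
\<close>

lemma gagliardo_affine:
  fixes f :: "real^'n \<Rightarrow> real"
  assumes [measurable]: "f \<in> borel_measurable borel" and R: "0 < R"
  shows "(\<integral>\<^sup>+z\<in>ball x0 (R * t) \<times> ball x0 (R * t). ennreal (\<bar>f (fst z) - f (snd z)\<bar> powr p * kern s p (fst z - snd z)) \<partial>lborel)
    = ennreal (R powr (real CARD('n) - s * p)) * gagliardo s p (ball 0 t) (\<lambda>x. f (x0 + R *\<^sub>R x))"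
proof -
  let ?F = "\<lambda>z. ennreal (\<bar>f (fst z) - f (snd z)\<bar> powr p * kern s p (fst z - snd z)) * indicator (ball x0 (R * t) \<times> ball x0 (R * t)) z"
  let ?G = "\<lambda>z. ennreal (\<bar>f (x0 + R *\<^sub>R fst z) - f (x0 + R *\<^sub>R snd z)\<bar> powr p * kern s p (fst z - snd z)) * indicator (ball 0 t \<times> ball 0 t) z"
  have [measurable]: "ball a t' \<times> ball a t' \<in> sets borel" for t' and a :: "real^'n"
    by (intro borel_open open_Times) auto
  have m: "?F \<in> borel_measurable borel" by measurable
  define c where "c = R powr (- (real CARD('n) + s * p))"
  have "(\<integral>\<^sup>+z. ?F z \<partial>lborel) = ennreal (R ^ DIM((real^'n) \<times> (real^'n))) * (\<integral>\<^sup>+z. ?F ((x0, x0) + R *\<^sub>R z) \<partial>lborel)"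
    by (rule nn_integral_affine[OF m R])
  also have "(\<integral>\<^sup>+z. ?F ((x0, x0) + R *\<^sub>R z) \<partial>lborel) = (\<integral>\<^sup>+z. ennreal c * ?G z \<partial>lborel)"
  proof (rule nn_integral_cong)
    fix z :: "(real^'n) \<times> (real^'n)"
    have "(x0 + R *\<^sub>R fst z) - (x0 + R *\<^sub>R snd z) = R *\<^sub>R (fst z - snd z)" by (simp add: scaleR_diff_right)
    then have k: "kern s p ((x0 + R *\<^sub>R fst z) - (x0 + R *\<^sub>R snd z)) = c * kern s p (fst z - snd z)"
      by (simp only: kern_scale[OF R] c_def)
    have i: "indicator (ball x0 (R * t) \<times> ball x0 (R * t)) ((x0, x0) + R *\<^sub>R z) = (indicator (ball 0 t \<times> ball 0 t) z :: ennreal)"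
      using ball_affine_iff[OF R, of x0 "fst z" t] ball_affine_iff[OF R, of x0 "snd z" t]
      by (simp add: indicator_def mem_Times_iff)
    have f1: "fst ((x0, x0) + R *\<^sub>R z) = x0 + R *\<^sub>R fst z" "snd ((x0, x0) + R *\<^sub>R z) = x0 + R *\<^sub>R snd z" by simp_all
    show "?F ((x0, x0) + R *\<^sub>R z) = ennreal c * ?G z"
      unfolding i f1 k by (simp add: c_def ennreal_mult'[symmetric] mult_ac)
  qed
  also have "\<dots> = ennreal c * gagliardo s p (ball 0 t) (\<lambda>x. f (x0 + R *\<^sub>R x))"
    unfolding gagliardo_def by (rule nn_integral_cmult) measurable
  finally have "(\<integral>\<^sup>+z. ?F z \<partial>lborel) = ennreal (R ^ DIM((real^'n) \<times> (real^'n))) * (ennreal c * gagliardo s p (ball 0 t) (\<lambda>x. f (x0 + R *\<^sub>R x)))" .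
  also have "\<dots> = ennreal (R ^ DIM((real^'n) \<times> (real^'n)) * c) * gagliardo s p (ball 0 t) (\<lambda>x. f (x0 + R *\<^sub>R x))"
    using R by (simp add: ennreal_mult' mult.assoc)
  also have "R ^ DIM((real^'n) \<times> (real^'n)) * c = R powr (real CARD('n) - s * p)"
  proof -
    have "R ^ DIM((real^'n) \<times> (real^'n)) = R powr (real (CARD('n) + CARD('n)))"
      using R by (subst powr_realpow) auto
    then show ?thesis by (simp add: c_def powr_add[symmetric])
  qed
  finally show ?thesis .
qed

lemma tail_affine:
  fixes f :: "real^'n \<Rightarrow> real"
  assumes [measurable]: "f \<in> borel_measurable borel" and R: "0 < R"
  shows "(\<integral>\<^sup>+x\<in>- ball x0 R. ennreal (\<bar>f x\<bar> powr a * kern s p (x - x0)) \<partial>lborel)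
    = ennreal (R powr (- (s * p))) * (\<integral>\<^sup>+x\<in>- ball 0 1. ennreal (\<bar>f (x0 + R *\<^sub>R x)\<bar> powr a * kern s p x) \<partial>lborel)"
proof -
  let ?F = "\<lambda>x. ennreal (\<bar>f x\<bar> powr a * kern s p (x - x0)) * indicator (- ball x0 R) x"
  let ?G = "\<lambda>x. ennreal (\<bar>f (x0 + R *\<^sub>R x)\<bar> powr a * kern s p x) * indicator (- ball 0 1) x"
  define c where "c = R powr (- (real CARD('n) + s * p))"
  have m: "?F \<in> borel_measurable borel" by measurable
  have "(\<integral>\<^sup>+x. ?F x \<partial>lborel) = ennreal (R ^ DIM(real^'n)) * (\<integral>\<^sup>+x. ?F (x0 + R *\<^sub>R x) \<partial>lborel)"
    by (rule nn_integral_affine[OF m R])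
  also have "(\<integral>\<^sup>+x. ?F (x0 + R *\<^sub>R x) \<partial>lborel) = (\<integral>\<^sup>+x. ennreal c * ?G x \<partial>lborel)"
  proof (rule nn_integral_cong)
    fix x :: "real^'n"
    have i: "indicator (- ball x0 R) (x0 + R *\<^sub>R x) = (indicator (- ball 0 1) x :: ennreal)"
      using ball_affine_iff[OF R, of x0 x 1] by (simp add: indicator_def)
    have "x0 + R *\<^sub>R x - x0 = R *\<^sub>R x" by simp
    then have k: "kern s p (x0 + R *\<^sub>R x - x0) = c * kern s p x" by (simp only: kern_scale[OF R] c_def)
    show "?F (x0 + R *\<^sub>R x) = ennreal c * ?G x"
      unfolding i k by (simp add: c_def ennreal_mult'[symmetric] mult_ac)
  qed
  also have "\<dots> = ennreal c * (\<integral>\<^sup>+x. ?G x \<partial>lborel)" by (rule nn_integral_cmult) measurable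
  finally have "(\<integral>\<^sup>+x. ?F x \<partial>lborel) = ennreal (R ^ DIM(real^'n)) * (ennreal c * (\<integral>\<^sup>+x. ?G x \<partial>lborel))" .
  also have "\<dots> = ennreal (R ^ DIM(real^'n) * c) * (\<integral>\<^sup>+x. ?G x \<partial>lborel)"
    using R by (simp add: ennreal_mult' mult.assoc)
  also have "R ^ DIM(real^'n) * c = R powr (- (s * p))"
  proof -
    have "R ^ DIM(real^'n) = R powr (real CARD('n))" using R by (subst powr_realpow) auto
    then show ?thesis by (simp add: c_def powr_add[symmetric])
  qed
  finally show ?thesis .
qed

lemma gagliardo_divide:
  fixes f :: "real^'n \<Rightarrow> real"
  assumes [measurable]: "f \<in> borel_measurable borel" and M: "0 < M"
  shows "gagliardo s p (ball x0 t) f = ennreal (M powr p) * gagliardo s p (ball x0 t) (\<lambda>x. f x / M)"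
proof -
  have [measurable]: "ball a t' \<times> ball a t' \<in> sets borel" for t' and a :: "real^'n"
    by (intro borel_open open_Times) auto
  have e: "\<bar>a - b\<bar> powr p * k = M powr p * (\<bar>a / M - b / M\<bar> powr p * k)" for a b k :: real
    using M by (simp add: diff_divide_distrib[symmetric] powr_divide abs_divide)
  have "gagliardo s p (ball x0 t) f = (\<integral>\<^sup>+z. ennreal (M powr p) * (ennreal (\<bar>f (fst z) / M - f (snd z) / M\<bar> powr p * kern s p (fst z - snd z)) * indicator (ball x0 t \<times> ball x0 t) z) \<partial>lborel)"
    unfolding gagliardo_def by (subst e) (simp add: ennreal_mult' mult.assoc)
  also have "\<dots> = ennreal (M powr p) * gagliardo s p (ball x0 t) (\<lambda>x. f x / M)"
    unfolding gagliardo_def by (rule nn_integral_cmult) measurable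
  finally show ?thesis .
qed

text \<open>
  Pairs inside the slightly larger ball are controlled by the seminorm of \<open>\<phi>\<close>. All other pairs of points
  at which \<open>\<psi>\<close> takes different values have distance at least \<open>R (t' - t)\<close>, and there are only boundedly
  many of them in measure because \<open>\<Omega>\<close> is bounded.
\<close>

lemma admissible_imp_test_function:
  fixes \<phi> :: "real^'n \<Rightarrow> real"
  assumes \<phi>: "admissible s p \<phi>" and p: "0 < p" and sp: "0 < s * p" and R: "0 < R"
    and \<Omega>: "open \<Omega>" "bounded \<Omega>" "cball x0 R \<subseteq> \<Omega>"
  defines "\<psi> \<equiv> (\<lambda>x. \<phi> ((1 / R) *\<^sub>R (x - x0)))"
  shows "\<psi> \<in> frac_Sobolev s p \<Omega>" "\<exists>K. compact K \<and> K \<subseteq> \<Omega> \<and> (\<forall>x. x \<notin> K \<longrightarrow> \<psi> x = 0)"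
proof -
  have [measurable]: "\<phi> \<in> borel_measurable borel" using \<phi> by (simp add: admissible_def)
  have [measurable]: "\<psi> \<in> borel_measurable borel" unfolding \<psi>_def by measurable
  have [measurable]: "\<Omega> \<in> sets borel" using \<Omega>(1) by simp
  obtain B where B: "\<And>x. \<bar>\<phi> x\<bar> \<le> B" using \<phi> unfolding admissible_def by blast
  obtain t t' where t: "0 < t" "t < t'" "t' < 1" "\<And>x. t < norm x \<Longrightarrow> \<phi> x = 0" "gagliardo s p (ball 0 t') \<phi> < \<infinity>"
    using \<phi> unfolding admissible_def by blast
  have B0: "0 \<le> B" using B[of 0] by simp
  have \<psi>B: "\<bar>\<psi> x\<bar> \<le> B" for x by (simp add: \<psi>_def B)
  have \<psi>\<phi>: "\<psi> (x0 + R *\<^sub>R x) = \<phi> x" for x using R by (simp add: \<psi>_def)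
  have supp: "\<psi> x = 0" if "x \<notin> cball x0 (R * t)" for x
  proof -
    have "R * t < norm (x - x0)" using that by (simp add: dist_norm norm_minus_commute)
    then have "t < norm (x - x0) / R" using R by (simp add: field_simps)
    also have "\<dots> = norm ((1 / R) *\<^sub>R (x - x0))" using R by (subst norm_scaleR) simp
    finally have "t < norm ((1 / R) *\<^sub>R (x - x0))" .
    then show ?thesis unfolding \<psi>_def by (rule t(4))
  qed
  have "R * t \<le> R" using R t by simp
  then have "cball x0 (R * t) \<subseteq> \<Omega>" using \<Omega>(3) by (meson order_trans subset_cball)
  then show "\<exists>K. compact K \<and> K \<subseteq> \<Omega> \<and> (\<forall>x. x \<notin> K \<longrightarrow> \<psi> x = 0)"
    using supp by (intro exI[of _ "cball x0 (R * t)"]) auto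
  have e\<Omega>: "emeasure lborel \<Omega> < \<infinity>" by (rule emeasure_bounded_finite[OF \<Omega>(2)])
  have \<Omega>': "\<Omega> \<in> sets lebesgue" by simp
  have "(\<integral>\<^sup>+x. ennreal (\<bar>\<psi> x\<bar> powr p) \<partial>lebesgue_on \<Omega>) \<le> (\<integral>\<^sup>+x. ennreal (B powr p) * indicator \<Omega> x \<partial>lborel)"
    unfolding nn_integral_lebesgue_on[OF \<Omega>']
    using \<psi>B p by (intro nn_integral_mono mult_right_mono ennreal_leI powr_mono2) auto
  also have "\<dots> = ennreal (B powr p) * emeasure lborel \<Omega>" by (rule nn_integral_cmult_indicator) simp
  also have "\<dots> < top" using e\<Omega> by (simp add: ennreal_mult_less_top)
  finally have Lq: "Lq_norm p \<Omega> \<psi> < top" unfolding Lq_norm_def by (rule epowr_less_top)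
  define m where "m = real CARD('n) + s * p"
  have m: "0 < m" using sp by (simp add: m_def add_nonneg_pos)
  define c where "c = (2 * B) powr p * (R * (t' - t)) powr (- m)"
  have Rt: "0 < R * (t' - t)" using R t by simp
  have pair: "\<Omega> \<times> \<Omega> \<in> sets borel" using \<Omega>(1) by (intro borel_open open_Times) auto
  have [measurable]: "ball a r \<times> ball a r \<in> sets borel" "\<Omega> \<times> \<Omega> \<in> sets borel" for r and a :: "real^'n"
    using \<Omega>(1) by (auto intro!: borel_open open_Times)
  let ?F = "\<lambda>z. ennreal (\<bar>\<psi> (fst z) - \<psi> (snd z)\<bar> powr p * kern s p (fst z - snd z))"
  let ?D = "ball x0 (R * t') \<times> ball x0 (R * t')"
  have pt: "?F z * indicator (\<Omega> \<times> \<Omega>) z \<le> ?F z * indicator ?D z + ennreal c * indicator (\<Omega> \<times> \<Omega>) z" for z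
  proof (cases "z \<in> ?D \<or> z \<notin> \<Omega> \<times> \<Omega> \<or> \<psi> (fst z) = \<psi> (snd z)")
    case True
    then show ?thesis by (auto simp: indicator_def)
  next
    case False
    have near: "dist x0 x \<le> R * t \<and> R * t' \<le> dist x0 y \<Longrightarrow> R * (t' - t) \<le> dist x y" for x y :: "real^'n"
      using dist_triangle[of x0 y x] by (auto simp: right_diff_distrib dist_commute)
    have tt: "R * t < R * t'" using R t by simp
    have "fst z \<in> cball x0 (R * t) \<or> snd z \<in> cball x0 (R * t)" using False supp by metis
    moreover have "R * t' \<le> dist x0 (fst z) \<or> R * t' \<le> dist x0 (snd z)" using False by (auto simp: mem_Times_iff)
    ultimately have "R * (t' - t) \<le> dist (fst z) (snd z)"
      using near[of "fst z" "snd z"] near[of "snd z" "fst z"] tt by (auto simp: dist_commute)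
    then have "kern s p (fst z - snd z) \<le> (R * (t' - t)) powr (- m)"
      unfolding kern_def m_def[symmetric] using Rt m by (intro powr_mono2') (auto simp: dist_norm)
    moreover have "\<bar>\<psi> (fst z) - \<psi> (snd z)\<bar> powr p \<le> (2 * B) powr p"
    proof (rule powr_mono2)
      show "\<bar>\<psi> (fst z) - \<psi> (snd z)\<bar> \<le> 2 * B" using \<psi>B[of "fst z"] \<psi>B[of "snd z"] by linarith
    qed (use p in auto)
    ultimately have "?F z \<le> ennreal c" unfolding c_def by (intro ennreal_leI mult_mono) auto
    then show ?thesis using False by (simp add: add_increasing)
  qed
  have "(\<integral>\<^sup>+z. ?F z * indicator (\<Omega> \<times> \<Omega>) z \<partial>lborel) \<le> (\<integral>\<^sup>+z. ?F z * indicator ?D z + ennreal c * indicator (\<Omega> \<times> \<Omega>) z \<partial>lborel)"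
    by (rule nn_integral_mono) (rule pt)
  also have "\<dots> = (\<integral>\<^sup>+z. ?F z * indicator ?D z \<partial>lborel) + (\<integral>\<^sup>+z. ennreal c * indicator (\<Omega> \<times> \<Omega>) z \<partial>lborel)"
    by (rule nn_integral_add) measurable
  also have "(\<integral>\<^sup>+z. ennreal c * indicator (\<Omega> \<times> \<Omega>) z \<partial>lborel) = ennreal c * emeasure lborel (\<Omega> \<times> \<Omega>)"
    by (rule nn_integral_cmult_indicator) (simp add: pair)
  also have "(\<integral>\<^sup>+z. ?F z * indicator ?D z \<partial>lborel) = ennreal (R powr (real CARD('n) - s * p)) * gagliardo s p (ball 0 t') \<phi>"
    using gagliardo_affine[of \<psi> R p s x0 t'] R by (simp add: \<psi>\<phi>)
  also have "ennreal (R powr (real CARD('n) - s * p)) * gagliardo s p (ball 0 t') \<phi> + ennreal c * emeasure lborel (\<Omega> \<times> \<Omega>) < top"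
    using t(5) emeasure_bounded_finite[OF bounded_Times[OF \<Omega>(2) \<Omega>(2)]] by (simp add: ennreal_mult_less_top)
  finally have G: "(\<integral>\<^sup>+z. ?F z * indicator (\<Omega> \<times> \<Omega>) z \<partial>lborel) < top" .
  have Fm: "?F \<in> borel_measurable borel" by measurable
  have "(\<integral>\<^sup>+(x, y). ennreal (\<bar>\<psi> x - \<psi> y\<bar> powr p / norm (x - y) powr (real CARD('n) + s * p)) \<partial>(lebesgue_on \<Omega> \<Otimes>\<^sub>M lebesgue_on \<Omega>))
     = (\<integral>\<^sup>+z. ?F z \<partial>(lebesgue_on \<Omega> \<Otimes>\<^sub>M lebesgue_on \<Omega>))"
    by (simp add: kern_eq_divide case_prod_beta')
  also have "\<dots> = (\<integral>\<^sup>+z. ?F z * indicator (\<Omega> \<times> \<Omega>) z \<partial>lborel)"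
    by (rule nn_integral_lebesgue_on_pair[OF Fm]) measurable
  also note G
  finally have fr: "frac_seminorm s p \<Omega> \<psi> < top" unfolding frac_seminorm_def by (rule epowr_less_top)
  have "\<psi> \<in> borel_measurable (lebesgue_on \<Omega>)"
    by (intro measurable_restrict_space1 measurable_completion) simp
  then show "\<psi> \<in> frac_Sobolev s p \<Omega>" using Lq fr by (simp add: frac_Sobolev_def)
qed


text \<open>
  The exponents in the bracket are those for which each quantity is invariant under
  \<open>x \<mapsto> x0 + R x\<close>: the seminorm scales with \<open>R\<^sup>N\<^sup>/\<^sup>p\<^sup>-\<^sup>s\<close>, and the prefactor \<open>R\<^sup>s\<^sup>p\<close> of the tail cancels the
  dilation of the kernel. The equation is homogeneous under dilations and
  under multiplication by constants.
\<close>

lemma normalized_rescaling: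
  fixes u :: "real^'n \<Rightarrow> real" and s p R M :: real
  assumes p: "2 < p" and s: "0 < s" and \<Omega>: "open \<Omega>" "bounded \<Omega>" "cball x0 R \<subseteq> \<Omega>"
    and u: "local_weak_solution s p \<Omega> u" and R: "0 < R" and M: "0 < M"
    and gag: "ennreal (R powr (s - real CARD('n) / p)) * frac_seminorm s p (ball x0 R) u \<le> ennreal M"
    and Linf: "Linf_norm (ball x0 R) u \<le> ennreal M"
    and tail: "Tail s p u x0 R \<le> ennreal M"
  obtains g where "g \<in> borel_measurable borel" "AE x in lborel. g x = u x"
    "normalized s p (\<lambda>x. g (x0 + R *\<^sub>R x) / M)"
proof -
  have sp: "0 < s * p" using s p by simp
  have um: "u \<in> borel_measurable lebesgue" using u by (simp add: local_weak_solution_def tail_space_def)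
  obtain u' where u': "u' \<in> borel_measurable lborel" "AE x in lborel. u x = u' x"
    using completion_ex_borel_measurable_real[OF um] by blast
  have [measurable]: "u' \<in> borel_measurable borel" using u'(1) by simp
  define B where "B = ball x0 R"
  have [measurable]: "B \<in> sets borel" by (simp add: B_def)
  have BL: "B \<in> sets lebesgue" by simp
  \<comment> \<open>a Borel version of \<open>u\<close>, truncated where the essential bound makes the truncation invisible\<close>
  define g where "g x = (if x \<in> B then max (- M) (min M (u' x)) else u' x)" for x
  have g [measurable]: "g \<in> borel_measurable borel" unfolding g_def[abs_def] by measurable
  have "AE x in lebesgue_on B. ennreal \<bar>u x\<bar> \<le> Linf_norm B u" unfolding Linf_norm_def by (rule esssup_AE)
  then have "AE x in lebesgue. x \<in> B \<longrightarrow> ennreal \<bar>u x\<bar> \<le> Linf_norm B u"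
    by (subst (asm) AE_restrict_space_iff) (use BL in auto)
  then have "AE x in lborel. x \<in> B \<longrightarrow> ennreal \<bar>u x\<bar> \<le> Linf_norm B u" by (simp add: AE_completion_iff)
  then have gu: "AE x in lborel. g x = u x"
    using u'(2)
  proof eventually_elim
    case (elim x)
    have "\<bar>u x\<bar> \<le> M" if "x \<in> B"
    proof -
      have "ennreal \<bar>u x\<bar> \<le> ennreal M" using elim(1) that Linf by (auto simp: B_def intro: order_trans)
      then show ?thesis using M by (simp add: ennreal_le_iff)
    qed
    then show ?case using elim(2) by (auto simp: g_def)
  qed
  then have gu': "AE x in lebesgue. g x = u x" by (rule AE_completion)
  define v where "v x = g (x0 + R *\<^sub>R x) / M" for x
  have [measurable]: "v \<in> borel_measurable borel" unfolding v_def[abs_def] by measurable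
  have gv: "g (x0 + R *\<^sub>R x) = M * v x" for x using M by (simp add: v_def)
  have v1: "\<bar>v x\<bar> \<le> 1" if "x \<in> ball 0 1" for x
  proof -
    have "x0 + R *\<^sub>R x \<in> B" using ball_affine_iff[OF R, of x0 x 1] that by (simp add: B_def)
    then have "\<bar>g (x0 + R *\<^sub>R x)\<bar> \<le> M" using M by (auto simp: g_def)
    then show ?thesis using M by (simp add: v_def)
  qed
  have v2: "gagliardo s p (ball 0 1) v \<le> 1"
  proof -
    let ?F = "\<lambda>u z. ennreal (\<bar>u (fst z) - u (snd z)\<bar> powr p * kern s p (fst z - snd z))"
    define X where "X = (\<integral>\<^sup>+z. ?F u z \<partial>(lebesgue_on B \<Otimes>\<^sub>M lebesgue_on B))"
    have "AE x in lebesgue_on B. g x = u x"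
      using gu' BL by (subst AE_restrict_space_iff) auto
    then have ae: "AE z in lebesgue_on B \<Otimes>\<^sub>M lebesgue_on B. g (fst z) = u (fst z) \<and> g (snd z) = u (snd z)"
      by (rule AE_pair_components[OF sigma_finite_lebesgue_on[OF BL]])
    have Fm: "?F g \<in> borel_measurable borel" by measurable
    have "X = (\<integral>\<^sup>+z. ?F g z \<partial>(lebesgue_on B \<Otimes>\<^sub>M lebesgue_on B))"
      unfolding X_def by (rule nn_integral_cong_AE) (use ae in eventually_elim, simp)
    also have "\<dots> = (\<integral>\<^sup>+z\<in>B \<times> B. ?F g z \<partial>lborel)" by (rule nn_integral_lebesgue_on_pair[OF Fm]) measurable
    also have "\<dots> = ennreal (R powr (real CARD('n) - s * p)) * gagliardo s p (ball 0 1) (\<lambda>x. g (x0 + R *\<^sub>R x))"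
      using gagliardo_affine[of g R p s x0 1] R by (simp add: B_def)
    also have "gagliardo s p (ball 0 1) (\<lambda>x. g (x0 + R *\<^sub>R x)) = ennreal (M powr p) * gagliardo s p (ball 0 1) v"
      unfolding v_def by (rule gagliardo_divide[OF _ M]) measurable
    finally have X1: "X = ennreal (R powr (real CARD('n) - s * p) * M powr p) * gagliardo s p (ball 0 1) v"
      by (simp add: ennreal_mult' mult.assoc)
    have fs: "frac_seminorm s p B u = epowr X (1 / p)"
      by (simp add: frac_seminorm_def X_def kern_eq_divide case_prod_beta')
    define c where "c = R powr (s - real CARD('n) / p)"
    have c: "0 < c" using R by (simp add: c_def)
    have "ennreal (1 / c) * (ennreal c * epowr X (1 / p)) \<le> ennreal (1 / c) * ennreal M"
      using gag by (intro mult_left_mono) (simp_all add: c_def fs[symmetric] B_def)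
    moreover have "ennreal (1 / c) * (ennreal c * epowr X (1 / p)) = epowr X (1 / p)"
    proof -
      have "ennreal (1 / c) * ennreal c = 1" using c by (simp add: ennreal_mult'[symmetric])
      then show ?thesis by (simp add: mult.assoc[symmetric])
    qed
    moreover have "ennreal (1 / c) * ennreal M = ennreal (M / c)" using c M by (simp add: ennreal_mult'[symmetric])
    ultimately have "epowr X (1 / p) \<le> ennreal (M / c)" by simp
    then have "X \<le> ennreal ((M / c) powr p)" using p c M by (intro epowr_le_imp) auto
    also have "(M / c) powr p = R powr (real CARD('n) - s * p) * M powr p"
    proof -
      have "c powr p = R powr (s * p - real CARD('n))"
        using p by (simp add: c_def powr_powr left_diff_distrib)
      then have "M powr p / c powr p = M powr p * R powr (- (s * p - real CARD('n)))"
        by (simp only: powr_minus divide_inverse)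
      then show ?thesis by (simp add: powr_divide mult.commute)
    qed
    finally have "ennreal (R powr (real CARD('n) - s * p) * M powr p) * gagliardo s p (ball 0 1) v
        \<le> ennreal (R powr (real CARD('n) - s * p) * M powr p) * 1" using X1 by simp
    then show ?thesis using R M by (subst (asm) ennreal_mult_le_mult_iff) auto
  qed
  have v3: "(\<integral>\<^sup>+y\<in>- ball 0 1. ennreal (\<bar>v y\<bar> powr (p - 1) * kern s p y) \<partial>lborel) \<le> 1" (is "?T \<le> 1")
  proof -
    define Y where "Y = (\<integral>\<^sup>+x\<in>- ball x0 R. ennreal (\<bar>g x\<bar> powr (p - 1) * kern s p (x - x0)) \<partial>lborel)"
    have "(\<integral>\<^sup>+x. ennreal (\<bar>u x\<bar> powr (p - 1) / norm (x - x0) powr (real CARD('n) + s * p)) \<partial>lebesgue_on (- ball x0 R))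
       = (\<integral>\<^sup>+x\<in>- ball x0 R. ennreal (\<bar>u x\<bar> powr (p - 1) * kern s p (x - x0)) \<partial>lborel)"
      by (subst nn_integral_lebesgue_on) (simp_all add: kern_eq_divide)
    also have "\<dots> = Y" unfolding Y_def
      by (rule nn_integral_cong_AE) (use gu in eventually_elim, simp)
    finally have "epowr (ennreal (R powr (s * p)) * Y) (1 / (p - 1)) \<le> ennreal M"
      using tail by (simp add: Tail_def)
    then have "ennreal (R powr (s * p)) * Y \<le> ennreal (M powr (p - 1))" using p M by (intro epowr_le_imp) auto
    moreover have "Y = ennreal (R powr (- (s * p))) * (\<integral>\<^sup>+y\<in>- ball 0 1. ennreal (\<bar>g (x0 + R *\<^sub>R y)\<bar> powr (p - 1) * kern s p y) \<partial>lborel)"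
      unfolding Y_def by (rule tail_affine[OF _ R]) measurable
    moreover have "(\<integral>\<^sup>+y\<in>- ball 0 1. ennreal (\<bar>g (x0 + R *\<^sub>R y)\<bar> powr (p - 1) * kern s p y) \<partial>lborel) = ennreal (M powr (p - 1)) * ?T"
    proof -
      have "(\<integral>\<^sup>+y\<in>- ball 0 1. ennreal (\<bar>g (x0 + R *\<^sub>R y)\<bar> powr (p - 1) * kern s p y) \<partial>lborel)
          = (\<integral>\<^sup>+y. ennreal (M powr (p - 1)) * (ennreal (\<bar>v y\<bar> powr (p - 1) * kern s p y) * indicator (- ball 0 1) y) \<partial>lborel)"
        using M by (intro nn_integral_cong) (simp add: gv abs_mult powr_mult ennreal_mult' mult.assoc)
      also have "\<dots> = ennreal (M powr (p - 1)) * ?T" by (rule nn_integral_cmult) measurable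
      finally show ?thesis .
    qed
    moreover have "ennreal (R powr (s * p)) * ennreal (R powr (- (s * p))) = 1"
      using R by (simp add: ennreal_mult'[symmetric] powr_add[symmetric])
    ultimately have "ennreal (M powr (p - 1)) * ?T \<le> ennreal (M powr (p - 1)) * 1"
      by (simp add: mult.assoc[symmetric])
    then show ?thesis using M by (subst (asm) ennreal_mult_le_mult_iff) auto
  qed
  have v4: "has_bochner_integral lborel (weak_integrand p (kern s p) v \<phi>) 0" if \<phi>: "admissible s p \<phi>" for \<phi>
  proof -
    have [measurable]: "\<phi> \<in> borel_measurable borel" using \<phi> by (simp add: admissible_def)
    define \<psi> where "\<psi> x = \<phi> ((1 / R) *\<^sub>R (x - x0))" for x
    have [measurable]: "\<psi> \<in> borel_measurable borel" unfolding \<psi>_def[abs_def] by measurable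
    have \<psi>\<phi>: "\<psi> (x0 + R *\<^sub>R x) = \<phi> x" for x using R by (simp add: \<psi>_def)
    have p0: "0 < p" using p by simp
    note test = admissible_imp_test_function[OF \<phi> p0 sp R \<Omega>, folded \<psi>_def]
    let ?L = "\<lambda>(x, y). \<bar>u x - u y\<bar> powr (p - 2) * (u x - u y) * (\<psi> x - \<psi> y) / norm (x - y) powr (real CARD('n) + s * p)"
    have weak: "has_bochner_integral (lebesgue \<Otimes>\<^sub>M lebesgue) ?L 0"
      using u test unfolding local_weak_solution_def by blast
    have ae: "AE z in lebesgue \<Otimes>\<^sub>M lebesgue. g (fst z) = u (fst z) \<and> g (snd z) = u (snd z)"
      by (rule AE_pair_components[OF sigma_finite_lebesgue gu'])
    have wm: "weak_integrand p (kern s p) g \<psi> \<in> borel_measurable borel" by measurable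
    have Lm: "?L \<in> borel_measurable (lebesgue \<Otimes>\<^sub>M lebesgue)"
      using weak by (rule borel_measurable_has_bochner_integral)
    have eq: "AE z in lebesgue \<Otimes>\<^sub>M lebesgue. ?L z = weak_integrand p (kern s p) g \<psi> z"
      using ae
    proof eventually_elim
      case (elim z)
      have "\<bar>a\<bar> powr (p - 2) * a = spow (p - 1) a" for a :: real by (simp add: spow_alt)
      then show ?case using elim by (simp add: weak_integrand_def kern_eq_divide case_prod_beta')
    qed
    have "has_bochner_integral (lebesgue \<Otimes>\<^sub>M lebesgue) (weak_integrand p (kern s p) g \<psi>) 0"
      using weak by (subst (asm) has_bochner_integral_cong_AE[OF Lm borel_measurable_lebesgue_on_pair(2)[OF wm] eq])
    then have "has_bochner_integral lborel (weak_integrand p (kern s p) g \<psi>) 0"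
      by (rule has_bochner_integral_lebesgue_pair) (rule wm)
    then have "has_bochner_integral lborel (\<lambda>z. weak_integrand p (kern s p) g \<psi> ((x0, x0) + R *\<^sub>R z)) 0"
      using R by (rule has_bochner_integral_affine_zero)
    moreover have "weak_integrand p (kern s p) g \<psi> ((x0, x0) + R *\<^sub>R z) = (M powr (p - 1) * R powr (- (real CARD('n) + s * p))) * weak_integrand p (kern s p) v \<phi> z" for z
    proof -
      have f1: "fst ((x0, x0) + R *\<^sub>R z) = x0 + R *\<^sub>R fst z" "snd ((x0, x0) + R *\<^sub>R z) = x0 + R *\<^sub>R snd z" by simp_all
      have "(x0 + R *\<^sub>R fst z) - (x0 + R *\<^sub>R snd z) = R *\<^sub>R (fst z - snd z)" by (simp add: scaleR_diff_right)
      then have k: "kern s p ((x0 + R *\<^sub>R fst z) - (x0 + R *\<^sub>R snd z)) = R powr (- (real CARD('n) + s * p)) * kern s p (fst z - snd z)"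
        by (simp only: kern_scale[OF R])
      have sM: "spow (p - 1) (M * a - M * b) = M powr (p - 1) * spow (p - 1) (a - b)" for a b
        using M by (simp add: right_diff_distrib[symmetric] spow_def sgn_mult abs_mult powr_mult)
      show ?thesis unfolding weak_integrand_def f1 k gv \<psi>\<phi> sM by (simp only: mult_ac)
    qed
    ultimately have h: "has_bochner_integral lborel (\<lambda>z. (M powr (p - 1) * R powr (- (real CARD('n) + s * p))) * weak_integrand p (kern s p) v \<phi> z) 0"
      by simp
    define c where "c = M powr (p - 1) * R powr (- (real CARD('n) + s * p))"
    have "c \<noteq> 0" using M R by (simp add: c_def)
    then have "has_bochner_integral lborel (\<lambda>z. (1 / c) * (c * weak_integrand p (kern s p) v \<phi> z)) ((1 / c) * 0)"
      using h[folded c_def] by (intro has_bochner_integral_mult_right) auto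
    then show ?thesis using \<open>c \<noteq> 0\<close> by simp
  qed
  have "normalized s p v"
    unfolding normalized_def using v1 v2 v3 v4 by simp
  then show thesis using g gu by (intro that[of g]) (simp_all add: v_def[abs_def])
qed

section \<open>Hoelder continuity of local weak solutions\<close>

text \<open>
  The set where two continuous functions differ is open, and a nonempty open set has positive
  measure.
\<close>

lemma continuous_AE_eq_imp_eq:
  fixes f g :: "real^'n \<Rightarrow> real"
  assumes S: "open S" and f: "continuous_on S f" and g: "continuous_on S g"
    and ae: "AE x in lborel. x \<in> S \<longrightarrow> f x = g x" and x: "x \<in> S"
  shows "f x = g x"
proof (rule ccontr)
  assume ne: "f x \<noteq> g x"
  have "open (S \<inter> (\<lambda>x. f x - g x) -` (- {0}))"
    by (intro continuous_open_preimage continuous_on_diff f g S) auto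
  moreover have "x \<in> S \<inter> (\<lambda>x. f x - g x) -` (- {0})" using x ne by simp
  ultimately obtain r where r: "0 < r" "ball x r \<subseteq> S \<inter> (\<lambda>x. f x - g x) -` (- {0})"
    by (meson openE)
  have "AE y in lborel. y \<notin> ball x r"
    using ae by eventually_elim (use r in auto)
  then have "emeasure lborel (ball x r) = 0"
    by (subst (asm) AE_iff_measurable[of "ball x r"]) auto
  moreover have "0 < unit_ball_vol CARD('n) * r powr CARD('n)" using r(1) by simp
  ultimately show False using r(1) emeasure_ball_dim[of r x] by simp
qed

lemma AE_lborel_affine:
  fixes P :: "'a::euclidean_space \<Rightarrow> bool"
  assumes P: "AE x in lborel. P x" and c: "0 < c"
  shows "AE x in lborel. P (t + c *\<^sub>R x)"
proof -
  obtain N where N: "{x \<in> space lborel. \<not> P x} \<subseteq> N" "emeasure lborel N = 0" "N \<in> sets lborel"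
    using P by (rule AE_E)
  then have [measurable]: "N \<in> sets borel" by simp
  have "(\<integral>\<^sup>+x. indicator N x \<partial>lborel) = ennreal (c ^ DIM('a)) * (\<integral>\<^sup>+x. indicator N (t + c *\<^sub>R x) \<partial>lborel)"
    by (rule nn_integral_affine[OF _ c]) measurable
  moreover have "(\<integral>\<^sup>+x. indicator N x \<partial>(lborel :: 'a measure)) = 0" using N by auto
  ultimately have "(\<integral>\<^sup>+x. indicator N (t + c *\<^sub>R x) \<partial>(lborel :: 'a measure)) = 0" using c by auto
  then have "AE x in (lborel :: 'a measure). indicator N (t + c *\<^sub>R x) = (0 :: ennreal)"
    by (subst (asm) nn_integral_0_iff_AE) auto
  then show ?thesis by eventually_elim (use N in \<open>auto simp: indicator_def split: if_splits\<close>)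
qed

definition holder_bracket :: "real \<Rightarrow> real \<Rightarrow> (real^'n \<Rightarrow> real) \<Rightarrow> real^'n \<Rightarrow> real \<Rightarrow> ennreal" where
  "holder_bracket s p u x0 R = ennreal (R powr (s - real CARD('n) / p)) * frac_seminorm s p (ball x0 R) u
     + Linf_norm (ball x0 R) u + Tail s p u x0 R"

text \<open>
  The bracket is bounded by an arbitrary positive \<open>M\<close> instead of being used directly, as it may vanish
  and then cannot serve as a normalizing factor.
\<close>

lemma local_holder_estimate:
  fixes s p \<gamma> :: real
  assumes p: "2 < p" and s: "0 < s" "s * p \<le> p - 2" and \<gamma>: "0 < \<gamma>" "\<gamma> < s * p / (p - 2)"
  obtains C where "1 \<le> C"
    "\<And>\<Omega> (u :: real^'n \<Rightarrow> real) x0 R M. open \<Omega> \<Longrightarrow> bounded \<Omega> \<Longrightarrow> local_weak_solution s p \<Omega> u \<Longrightarrow> 0 < R \<Longrightarrow> cball x0 R \<subseteq> \<Omega> \<Longrightarrow> 0 < M \<Longrightarrow>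
      holder_bracket s p u x0 R \<le> ennreal M \<Longrightarrow>
      \<exists>v. (\<forall>x\<in>ball x0 (R / 2). \<forall>y\<in>ball x0 (R / 2). \<bar>v x - v y\<bar> \<le> C / R powr \<gamma> * M * norm (x - y) powr \<gamma>)
        \<and> (AE x in lborel. x \<in> ball x0 (R / 2) \<longrightarrow> v x = u x)"
proof -
  obtain C where C: "0 \<le> C"
    "\<And>u :: real^'n \<Rightarrow> real. normalized s p u \<Longrightarrow>
       \<exists>v. (\<forall>x y. norm x < 1 / 2 \<longrightarrow> norm y < 1 / 2 \<longrightarrow> \<bar>v x - v y\<bar> \<le> C * norm (x - y) powr \<gamma>)
         \<and> (AE x in lborel. norm x < 1 / 2 \<longrightarrow> v x = u x)"
    by (rule normalized_regularity[OF p s \<gamma>, where 'n='n]) (rule that)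
  show thesis
  proof (rule that[of "max 1 C"])
    fix \<Omega> and u :: "real^'n \<Rightarrow> real" and x0 R M
    assume \<Omega>: "open \<Omega>" "bounded \<Omega>" and u: "local_weak_solution s p \<Omega> u" and R: "0 < R" "cball x0 R \<subseteq> \<Omega>" and M: "0 < M"
      and b: "holder_bracket s p u x0 R \<le> ennreal M"
    have le: "a \<le> ennreal M" "b \<le> ennreal M" "c \<le> ennreal M" if "a + b + c \<le> ennreal M" for a b c
      using that by (meson add_increasing2 add_increasing order_refl order_trans zero_le)+
    obtain g where g: "g \<in> borel_measurable borel" "AE x in lborel. g x = u x" "normalized s p (\<lambda>x. g (x0 + R *\<^sub>R x) / M)"
      using normalized_rescaling[OF p s(1) \<Omega> R(2) u R(1) M le[OF b[unfolded holder_bracket_def]]] by blast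
    obtain w where w: "\<And>x y. norm x < 1 / 2 \<Longrightarrow> norm y < 1 / 2 \<Longrightarrow> \<bar>w x - w y\<bar> \<le> C * norm (x - y) powr \<gamma>"
      "AE x in lborel. norm x < 1 / 2 \<longrightarrow> w x = g (x0 + R *\<^sub>R x) / M"
      using C(2)[OF g(3)] by blast
    define T where "T x = - (1 / R) *\<^sub>R x0 + (1 / R) *\<^sub>R x" for x
    have Tinv: "x0 + R *\<^sub>R T x = x" for x using R by (simp add: T_def scaleR_add_right scaleR_diff_right)
    have Tdiff: "norm (T x - T y) = norm (x - y) / R" for x y
    proof -
      have "T x - T y = (1 / R) *\<^sub>R (x - y)" by (simp add: T_def scaleR_diff_right)
      then show ?thesis using R by simp
    qed
    have Tball: "norm (T x) < 1 / 2" if "x \<in> ball x0 (R / 2)" for x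
    proof -
      have "T x0 = 0" by (simp add: T_def)
      then have "norm (T x) = norm (x - x0) / R" using Tdiff[of x x0] by simp
      also have "\<dots> < 1 / 2" using that R by (simp add: dist_norm norm_minus_commute field_simps)
      finally show ?thesis .
    qed
    show "\<exists>v. (\<forall>x\<in>ball x0 (R / 2). \<forall>y\<in>ball x0 (R / 2). \<bar>v x - v y\<bar> \<le> max 1 C / R powr \<gamma> * M * norm (x - y) powr \<gamma>)
        \<and> (AE x in lborel. x \<in> ball x0 (R / 2) \<longrightarrow> v x = u x)"
    proof (intro exI[of _ "\<lambda>x. M * w (T x)"] conjI ballI)
      fix x y assume xy: "x \<in> ball x0 (R / 2)" "y \<in> ball x0 (R / 2)"
      have "\<bar>M * w (T x) - M * w (T y)\<bar> = M * \<bar>w (T x) - w (T y)\<bar>"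
        using M by (simp add: right_diff_distrib[symmetric] abs_mult)
      also have "\<dots> \<le> M * (C * norm (T x - T y) powr \<gamma>)"
        using M by (intro mult_left_mono w(1) Tball xy) auto
      also have "\<dots> \<le> M * (max 1 C * norm (T x - T y) powr \<gamma>)"
        using M by (intro mult_left_mono mult_right_mono) auto
      also have "\<dots> = max 1 C / R powr \<gamma> * M * norm (x - y) powr \<gamma>"
        by (simp add: Tdiff powr_divide)
      finally show "\<bar>M * w (T x) - M * w (T y)\<bar> \<le> max 1 C / R powr \<gamma> * M * norm (x - y) powr \<gamma>" .
    next
      have "AE x in lborel. norm (T x) < 1 / 2 \<longrightarrow> w (T x) = g (x0 + R *\<^sub>R T x) / M"
        unfolding T_def using R by (intro AE_lborel_affine[OF w(2)]) simp
      then show "AE x in lborel. x \<in> ball x0 (R / 2) \<longrightarrow> M * w (T x) = u x"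
        using g(2)
      proof eventually_elim
        case (elim x)
        then show ?case using Tball[of x] M by (simp add: Tinv)
      qed
    qed
  qed simp
qed

text \<open>
  Outside the ball \<open>1 + \<bar>x\<bar>\<close> is at most a constant multiple of \<open>\<bar>x - x0\<bar>\<close>, so the weight in the tail space
  dominates the one in the tail.
\<close>

lemma Tail_finite:
  fixes u :: "real^'n \<Rightarrow> real" and s p :: real
  assumes u: "u \<in> tail_space s p" and R: "0 < R" and sp: "0 < s * p"
  shows "Tail s p u x0 R < top"
proof -
  define m where "m = real CARD('n) + s * p"
  have m: "0 < m" using sp by (simp add: m_def add_nonneg_pos)
  define k where "k = 1 + (1 + norm x0) / R"
  have k: "0 < k" using R by (simp add: k_def add_pos_nonneg)
  have [measurable]: "u \<in> borel_measurable lebesgue" using u by (simp add: tail_space_def)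
  have [measurable]: "(\<lambda>x. norm x) \<in> borel_measurable (lebesgue :: (real^'n) measure)"
    by (intro measurable_completion) simp
  have fin: "(\<integral>\<^sup>+x. ennreal (\<bar>u x\<bar> powr (p - 1) / (1 + norm x) powr m) \<partial>lebesgue) < top"
    using u by (simp add: tail_space_def m_def)
  have pt: "ennreal (\<bar>u x\<bar> powr (p - 1) / norm (x - x0) powr m) * indicator (- ball x0 R) x
      \<le> ennreal (k powr m) * ennreal (\<bar>u x\<bar> powr (p - 1) / (1 + norm x) powr m)" for x
  proof (cases "x \<in> ball x0 R")
    case False
    then have d: "R \<le> norm (x - x0)" by (simp add: dist_norm norm_minus_commute)
    have "1 + norm x0 \<le> (1 + norm x0) / R * norm (x - x0)"
      using d R mult_left_mono[OF d, of "(1 + norm x0) / R"] by (simp add: add_nonneg_nonneg)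
    moreover have "norm x \<le> norm x0 + norm (x - x0)" using norm_triangle_ineq[of x0 "x - x0"] by simp
    ultimately have "1 + norm x \<le> k * norm (x - x0)" by (simp add: k_def algebra_simps)
    then have "(1 + norm x) powr m \<le> (k * norm (x - x0)) powr m" using m by (intro powr_mono2) auto
    also have "\<dots> = k powr m * norm (x - x0) powr m" by (rule powr_mult)
    finally have le: "(1 + norm x) powr m \<le> k powr m * norm (x - x0) powr m" .
    have pos: "0 < (1 + norm x) powr m" "0 < norm (x - x0) powr m" using d R by (auto simp: add_pos_nonneg less_imp_neq[symmetric])
    have "1 / norm (x - x0) powr m \<le> k powr m / (1 + norm x) powr m"
      using le pos by (simp add: field_simps)
    then have "\<bar>u x\<bar> powr (p - 1) * (1 / norm (x - x0) powr m) \<le> \<bar>u x\<bar> powr (p - 1) * (k powr m / (1 + norm x) powr m)"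
      by (rule mult_left_mono) simp
    then have "\<bar>u x\<bar> powr (p - 1) / norm (x - x0) powr m \<le> k powr m * (\<bar>u x\<bar> powr (p - 1) / (1 + norm x) powr m)"
      by (simp add: mult_ac)
    then show ?thesis using False by (simp add: ennreal_mult'[symmetric] ennreal_leI)
  qed simp
  have "(\<integral>\<^sup>+x. ennreal (\<bar>u x\<bar> powr (p - 1) / norm (x - x0) powr m) \<partial>lebesgue_on (- ball x0 R))
      = (\<integral>\<^sup>+x. ennreal (\<bar>u x\<bar> powr (p - 1) / norm (x - x0) powr m) * indicator (- ball x0 R) x \<partial>lebesgue)"
    by (rule nn_integral_restrict_space) simp
  also have "\<dots> \<le> (\<integral>\<^sup>+x. ennreal (k powr m) * ennreal (\<bar>u x\<bar> powr (p - 1) / (1 + norm x) powr m) \<partial>lebesgue)"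
    by (rule nn_integral_mono) (rule pt)
  also have "\<dots> = ennreal (k powr m) * (\<integral>\<^sup>+x. ennreal (\<bar>u x\<bar> powr (p - 1) / (1 + norm x) powr m) \<partial>lebesgue)"
    by (rule nn_integral_cmult) measurable
  also have "\<dots> < top" using fin by (simp add: ennreal_mult_less_top)
  finally show ?thesis unfolding Tail_def m_def by (intro epowr_less_top) (simp add: ennreal_mult_less_top)
qed

text \<open>
  Around each point of \<open>\<Omega>\<close> there is a Hoelder continuous representative. On overlaps two of them
  coincide by \<open>continuous_AE_eq_imp_eq\<close>, so together they define one function on \<open>\<Omega>\<close>; by the Lindelof
  property it equals \<open>u\<close> almost everywhere. On a compact ball a finite subcover
  gives uniform constants for points that are close to each other, and boundedness settles the other
  pairs.
\<close>

lemma holder_loc_membership: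
  fixes s p \<gamma> :: real and u :: "real^'n \<Rightarrow> real"
  assumes p: "2 < p" and s: "0 < s" "s * p \<le> p - 2" and \<gamma>: "0 < \<gamma>" "\<gamma> < s * p / (p - 2)"
    and \<Omega>: "open \<Omega>" "bounded \<Omega>" and Linf: "u \<in> Linf_loc \<Omega>" and u: "local_weak_solution s p \<Omega> u"
  shows "u \<in> holder_loc \<gamma> \<Omega>"
proof -
  have sp: "0 < s * p" using s p by simp
  have us: "u \<in> frac_Sobolev_loc s p \<Omega>" "u \<in> tail_space s p" using u by (auto simp: local_weak_solution_def)
  obtain C where C: "1 \<le> C"
    "\<And>\<Omega> (u :: real^'n \<Rightarrow> real) x0 R M. open \<Omega> \<Longrightarrow> bounded \<Omega> \<Longrightarrow> local_weak_solution s p \<Omega> u \<Longrightarrow> 0 < R \<Longrightarrow> cball x0 R \<subseteq> \<Omega> \<Longrightarrow> 0 < M \<Longrightarrow>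
      holder_bracket s p u x0 R \<le> ennreal M \<Longrightarrow>
      \<exists>v. (\<forall>x\<in>ball x0 (R / 2). \<forall>y\<in>ball x0 (R / 2). \<bar>v x - v y\<bar> \<le> C / R powr \<gamma> * M * norm (x - y) powr \<gamma>)
        \<and> (AE x in lborel. x \<in> ball x0 (R / 2) \<longrightarrow> v x = u x)"
    by (rule local_holder_estimate[OF p s \<gamma>, where 'n='n]) (rule that)
  have loc: "\<exists>r K v. 0 < r \<and> 0 \<le> K \<and> (\<forall>x\<in>ball x0 r. \<forall>y\<in>ball x0 r. \<bar>v x - v y\<bar> \<le> K * norm (x - y) powr \<gamma>)
      \<and> (AE x in lborel. x \<in> ball x0 r \<longrightarrow> v x = u x)" if x0: "x0 \<in> \<Omega>" for x0
  proof -
    obtain R where R: "0 < R" "cball x0 R \<subseteq> \<Omega>" using \<Omega>(1) x0 open_contains_cball by blast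
    define b where "b = holder_bracket s p u x0 R"
    have "frac_seminorm s p (ball x0 R) u < top"
      using us(1) R by (auto simp: frac_Sobolev_loc_def frac_Sobolev_def)
    moreover have "Linf_norm (ball x0 R) u < top" using Linf R by (auto simp: Linf_loc_def)
    ultimately have "b < top" unfolding b_def holder_bracket_def using Tail_finite[OF us(2) R(1) sp] by (simp add: ennreal_mult_less_top)
    then have "b = ennreal (enn2real b)" by simp
    define M where "M = enn2real b + 1"
    note \<open>b = ennreal (enn2real b)\<close>
    also have "ennreal (enn2real b) \<le> ennreal M" unfolding M_def by (intro ennreal_leI) simp
    finally have b: "b \<le> ennreal M" .
    have M: "0 < M" by (simp add: M_def add_nonneg_pos)
    obtain v where "\<forall>x\<in>ball x0 (R / 2). \<forall>y\<in>ball x0 (R / 2). \<bar>v x - v y\<bar> \<le> C / R powr \<gamma> * M * norm (x - y) powr \<gamma>"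
        "AE x in lborel. x \<in> ball x0 (R / 2) \<longrightarrow> v x = u x"
      using C(2)[OF \<Omega> u R M b[unfolded b_def]] by blast
    then show ?thesis
      using R C(1) M by (intro exI[of _ "R / 2"] exI[of _ "C / R powr \<gamma> * M"] exI[of _ v]) auto
  qed
  define P where "P x0 t \<longleftrightarrow> (case t of (r, K, v) \<Rightarrow> 0 < r \<and> 0 \<le> K
      \<and> (\<forall>x\<in>ball x0 r. \<forall>y\<in>ball x0 r. \<bar>v x - v y\<bar> \<le> K * norm (x - y) powr \<gamma>)
      \<and> (AE x in lborel. x \<in> ball x0 r \<longrightarrow> v x = u x))" for x0 :: "real^'n" and t :: "real \<times> real \<times> (real^'n \<Rightarrow> real)"
  have "\<forall>x0\<in>\<Omega>. \<exists>t. P x0 t"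
  proof
    fix x0 assume "x0 \<in> \<Omega>"
    from loc[OF this] obtain r K v where "0 < r \<and> 0 \<le> K \<and> (\<forall>x\<in>ball x0 r. \<forall>y\<in>ball x0 r. \<bar>v x - v y\<bar> \<le> K * norm (x - y) powr \<gamma>)
      \<and> (AE x in lborel. x \<in> ball x0 r \<longrightarrow> v x = u x)" by (elim exE)
    then have "P x0 (r, K, v)" unfolding P_def prod.case .
    then show "\<exists>t. P x0 t" by (rule exI)
  qed
  then obtain f where f: "\<And>x0. x0 \<in> \<Omega> \<Longrightarrow> P x0 (f x0)" by (elim bchoice[THEN exE]) blast
  define r where "r x0 = fst (f x0)" for x0
  define K where "K x0 = fst (snd (f x0))" for x0
  define V where "V x0 = snd (snd (f x0))" for x0
  have "P x0 (r x0, K x0, V x0)" if "x0 \<in> \<Omega>" for x0 using f[OF that] by (simp add: r_def K_def V_def)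
  then have loc: "\<And>x0. x0 \<in> \<Omega> \<Longrightarrow> 0 < r x0" "\<And>x0. x0 \<in> \<Omega> \<Longrightarrow> 0 \<le> K x0"
    "\<And>x0 x y. x0 \<in> \<Omega> \<Longrightarrow> x \<in> ball x0 (r x0) \<Longrightarrow> y \<in> ball x0 (r x0) \<Longrightarrow> \<bar>V x0 x - V x0 y\<bar> \<le> K x0 * norm (x - y) powr \<gamma>"
    "\<And>x0. x0 \<in> \<Omega> \<Longrightarrow> AE x in lborel. x \<in> ball x0 (r x0) \<longrightarrow> V x0 x = u x"
    by (simp_all add: P_def)
  \<comment> \<open>every local representative is evaluated at its own centre\<close>
  define v where "v x = V x x" for x
  have cont: "continuous_on (ball x0 (r x0)) (V x0)" if "x0 \<in> \<Omega>" for x0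
    by (rule holder_bound_imp_continuous_on[OF \<gamma>(1) loc(3)[OF that]])
  have vV: "v x = V x0 x" if "x0 \<in> \<Omega>" "x \<in> \<Omega>" "x \<in> ball x0 (r x0)" for x0 x
  proof -
    define S where "S = ball x0 (r x0) \<inter> ball x (r x)"
    have "V x x = V x0 x"
    proof (rule continuous_AE_eq_imp_eq[of S "V x" "V x0" x])
      show "continuous_on S (V x)" "continuous_on S (V x0)"
        unfolding S_def by (rule continuous_on_subset[OF cont]; use that in auto)+
      show "AE y in lborel. y \<in> S \<longrightarrow> V x y = V x0 y"
        using loc(4)[OF that(1)] loc(4)[OF that(2)] by eventually_elim (auto simp: S_def)
      show "x \<in> S" using that loc(1)[OF that(2)] by (simp add: S_def)
    qed (auto simp: S_def)
    then show ?thesis by (simp add: v_def)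
  qed
  have ae: "AE x in lborel. x \<in> \<Omega> \<longrightarrow> v x = u x"
  proof -
    obtain F where F: "F \<subseteq> (\<lambda>x0. ball x0 (r x0)) ` \<Omega>" "countable F" "\<Union>F = (\<Union>x0\<in>\<Omega>. ball x0 (r x0))"
      using Lindelof[of "(\<lambda>x0. ball x0 (r x0)) ` \<Omega>"] by auto
    have "AE x in lborel. \<forall>S\<in>F. x \<in> S \<and> x \<in> \<Omega> \<longrightarrow> v x = u x"
    proof (rule AE_ball_countable[OF _, THEN iffD2])
      show "countable F" by (rule F(2))
      show "\<forall>S\<in>F. AE x in lborel. x \<in> S \<and> x \<in> \<Omega> \<longrightarrow> v x = u x"
      proof
        fix S assume "S \<in> F"
        then obtain x0 where x0: "x0 \<in> \<Omega>" "S = ball x0 (r x0)" using F(1) by auto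
        show "AE x in lborel. x \<in> S \<and> x \<in> \<Omega> \<longrightarrow> v x = u x"
          using loc(4)[OF x0(1)] by eventually_elim (use vV[OF x0(1)] x0(2) in auto)
      qed
    qed
    then show ?thesis
    proof eventually_elim
      case (elim x)
      show ?case
      proof
        assume x: "x \<in> \<Omega>"
        have "x \<in> ball x (r x)" using loc(1)[OF x] by simp
        then have "x \<in> \<Union>F" unfolding F(3) using x by blast
        then show "v x = u x" using elim x by auto
      qed
    qed
  qed
  have semi: "holder_seminorm \<gamma> (cball x1 r1) v < top" if "cball x1 r1 \<subseteq> \<Omega>" for x1 r1
  proof -
    define Q where "Q = cball x1 r1"
    have Q: "compact Q" "Q \<subseteq> \<Omega>" using that by (auto simp: Q_def)
    have cover: "Q \<subseteq> (\<Union>x0\<in>Q. ball x0 (r x0))"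
    proof
      fix x assume x: "x \<in> Q"
      then have "x \<in> ball x (r x)" using Q(2) loc(1) by auto
      then show "x \<in> (\<Union>x0\<in>Q. ball x0 (r x0))" using x by blast
    qed
    obtain D where D: "D \<subseteq> Q" "finite D" "Q \<subseteq> (\<Union>x0\<in>D. ball x0 (r x0))"
      using compactE_image[OF Q(1) _ cover] by auto
    obtain e where e: "0 < e" "\<And>x. x \<in> Q \<Longrightarrow> \<exists>G\<in>(\<lambda>x0. ball x0 (r x0)) ` D. ball x e \<subseteq> G"
      using Heine_Borel_lemma[OF Q(1), of "(\<lambda>x0. ball x0 (r x0)) ` D"] D(3) by auto
    define K0 where "K0 = (\<Sum>x0\<in>D. K x0)"
    define S0 where "S0 = (\<Sum>x0\<in>D. \<bar>v x0\<bar> + K x0 * r x0 powr \<gamma>)"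
    have D\<Omega>: "x0 \<in> \<Omega>" if "x0 \<in> D" for x0 using that D Q by blast
    have K0: "K x0 \<le> K0" if "x0 \<in> D" for x0
      unfolding K0_def using D(2) that loc(2) D\<Omega> by (intro member_le_sum) auto
    have S0: "\<bar>v x\<bar> \<le> S0" if x: "x \<in> Q" for x
    proof -
      obtain x0 where x0: "x0 \<in> D" "x \<in> ball x0 (r x0)" using D(3) x by blast
      have r0: "0 < r x0" by (rule loc(1)[OF D\<Omega>[OF x0(1)]])
      have "\<bar>v x - v x0\<bar> = \<bar>V x0 x - V x0 x0\<bar>"
      proof -
        have "x \<in> \<Omega>" "x0 \<in> \<Omega>" "x0 \<in> ball x0 (r x0)" using x x0 Q r0 D\<Omega> by auto
        then show ?thesis using vV[OF _ _ x0(2)] vV[of x0 x0] by simp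
      qed
      also have "\<dots> \<le> K x0 * norm (x - x0) powr \<gamma>" using x0 r0 D\<Omega> by (intro loc(3)) auto
      also have "\<dots> \<le> K x0 * r x0 powr \<gamma>"
        using x0 \<gamma> loc(2)[OF D\<Omega>[OF x0(1)]] by (intro mult_left_mono powr_mono2) (auto simp: dist_norm norm_minus_commute)
      finally have "\<bar>v x\<bar> \<le> \<bar>v x0\<bar> + K x0 * r x0 powr \<gamma>" by linarith
      also have "\<dots> \<le> S0" unfolding S0_def using D(2) x0 loc(2) D\<Omega> by (intro member_le_sum) auto
      finally show ?thesis .
    qed
    have "ennreal (\<bar>v x - v y\<bar> / norm (x - y) powr \<gamma>) \<le> ennreal (K0 + 2 * S0 / e powr \<gamma>)"
      if xy: "x \<in> Q" "y \<in> Q" "x \<noteq> y" for x y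
    proof (rule ennreal_leI)
      have nz: "0 < norm (x - y) powr \<gamma>" using xy by simp
      have K00: "0 \<le> K0" unfolding K0_def using loc(2) D\<Omega> by (intro sum_nonneg) auto
      have S00: "0 \<le> S0" using S0[OF xy(1)] by linarith
      show "\<bar>v x - v y\<bar> / norm (x - y) powr \<gamma> \<le> K0 + 2 * S0 / e powr \<gamma>"
      proof (cases "norm (x - y) < e")
        case True
        obtain x0 where x0: "x0 \<in> D" "ball x e \<subseteq> ball x0 (r x0)" using e(2)[OF xy(1)] by auto
        have in0: "x \<in> ball x0 (r x0)" "y \<in> ball x0 (r x0)"
          using x0 True e(1) by (auto simp: dist_norm subset_iff)
        have "\<bar>v x - v y\<bar> = \<bar>V x0 x - V x0 y\<bar>"
        proof -
          have "x \<in> \<Omega>" "y \<in> \<Omega>" using xy Q by auto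
          then show ?thesis using vV[OF D\<Omega>[OF x0(1)] _ in0(1)] vV[OF D\<Omega>[OF x0(1)] _ in0(2)] by simp
        qed
        also have "\<dots> \<le> K x0 * norm (x - y) powr \<gamma>" by (rule loc(3)[OF D\<Omega>[OF x0(1)] in0])
        also have "\<dots> \<le> K0 * norm (x - y) powr \<gamma>" using K0[OF x0(1)] by (rule mult_right_mono) simp
        finally have "\<bar>v x - v y\<bar> / norm (x - y) powr \<gamma> \<le> K0" using nz by (simp add: pos_divide_le_eq)
        moreover have "0 \<le> 2 * S0 / e powr \<gamma>" using S00 by simp
        ultimately show ?thesis by linarith
      next
        case False
        then have "e powr \<gamma> \<le> norm (x - y) powr \<gamma>" using e(1) \<gamma> by (intro powr_mono2) auto
        moreover have "\<bar>v x - v y\<bar> \<le> 2 * S0" using S0[OF xy(1)] S0[OF xy(2)] by linarith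
        ultimately have "\<bar>v x - v y\<bar> / norm (x - y) powr \<gamma> \<le> 2 * S0 / e powr \<gamma>"
          using S00 e(1) by (intro frac_le) auto
        then show ?thesis using K00 by linarith
      qed
    qed
    then have "holder_seminorm \<gamma> (cball x1 r1) v \<le> ennreal (K0 + 2 * S0 / e powr \<gamma>)"
      unfolding holder_seminorm_def Q_def by (intro SUP_least) auto
    then show ?thesis by (rule le_less_trans) simp
  qed
  have "AE x in lebesgue. x \<in> \<Omega> \<longrightarrow> v x = u x" using ae by (rule AE_completion)
  then show ?thesis unfolding holder_loc_def using semi by blast
qed

text \<open>
  The bracket is approximated from above by positive numbers \<open>M\<close>. For each of them the local
  representative coincides with the given continuous one.
\<close>

lemma holder_seminorm_estimate:
  fixes s p \<gamma> :: real
  assumes p: "2 < p" and s: "0 < s" "s * p \<le> p - 2" and \<gamma>: "0 < \<gamma>" "\<gamma> < s * p / (p - 2)"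
  obtains C where "1 \<le> C"
    "\<And>\<Omega> (u :: real^'n \<Rightarrow> real) v x0 R. open \<Omega> \<Longrightarrow> bounded \<Omega> \<Longrightarrow> local_weak_solution s p \<Omega> u \<Longrightarrow>
      continuous_rep \<Omega> u v \<Longrightarrow> 0 < R \<Longrightarrow> cball x0 R \<subseteq> \<Omega> \<Longrightarrow>
      holder_seminorm \<gamma> (ball x0 (R / 2)) v \<le> ennreal (C / R powr \<gamma>) *
        holder_bracket s p u x0 R"
proof -
  obtain C where C: "1 \<le> C"
    "\<And>\<Omega> (u :: real^'n \<Rightarrow> real) x0 R M. open \<Omega> \<Longrightarrow> bounded \<Omega> \<Longrightarrow> local_weak_solution s p \<Omega> u \<Longrightarrow> 0 < R \<Longrightarrow> cball x0 R \<subseteq> \<Omega> \<Longrightarrow> 0 < M \<Longrightarrow>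
      holder_bracket s p u x0 R \<le> ennreal M \<Longrightarrow>
      \<exists>v. (\<forall>x\<in>ball x0 (R / 2). \<forall>y\<in>ball x0 (R / 2). \<bar>v x - v y\<bar> \<le> C / R powr \<gamma> * M * norm (x - y) powr \<gamma>)
        \<and> (AE x in lborel. x \<in> ball x0 (R / 2) \<longrightarrow> v x = u x)"
    by (rule local_holder_estimate[OF p s \<gamma>, where 'n='n]) (rule that)
  show thesis
  proof (rule that[OF C(1)])
    fix \<Omega> and u v :: "real^'n \<Rightarrow> real" and x0 R
    assume \<Omega>: "open \<Omega>" "bounded \<Omega>" and u: "local_weak_solution s p \<Omega> u" and v: "continuous_rep \<Omega> u v"
      and R: "0 < R" "cball x0 R \<subseteq> \<Omega>"
    define b where "b = holder_bracket s p u x0 R"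
    define k where "k = C / R powr \<gamma>"
    have k: "0 < k" using C(1) R by (simp add: k_def)
    have "holder_seminorm \<gamma> (ball x0 (R / 2)) v \<le> ennreal k * b"
    proof (cases "b = top")
      case True
      then show ?thesis using k by (simp add: ennreal_mult_top)
    next
      case False
      then obtain m where m: "0 \<le> m" "b = ennreal m" by (cases b) auto
      have sub: "ball x0 (R / 2) \<subseteq> \<Omega>" 
      proof -
        have "ball x0 (R / 2) \<subseteq> cball x0 R" using R(1) by (intro order_trans[OF ball_subset_cball] subset_cball) simp
        then show ?thesis using R(2) by blast
      qed
      have "ennreal (\<bar>v x - v y\<bar> / norm (x - y) powr \<gamma>) \<le> ennreal (k * m)"
        if xy: "x \<in> ball x0 (R / 2)" "y \<in> ball x0 (R / 2)" "x \<noteq> y" for x y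
      proof (rule ennreal_leI)
        have nz: "0 < norm (x - y) powr \<gamma>" using xy by simp
        have "\<bar>v x - v y\<bar> / norm (x - y) powr \<gamma> \<le> k * m + \<epsilon>" if \<epsilon>: "0 < \<epsilon>" for \<epsilon>
        proof -
          define M where "M = m + \<epsilon> / k"
          have "0 < \<epsilon> / k" using \<epsilon> k by simp
          then have M: "0 < M" "m \<le> M" using m(1) unfolding M_def by linarith+
          have "b \<le> ennreal M" using m M by (simp add: ennreal_leI)
          then obtain w where w: "\<And>x y. x \<in> ball x0 (R / 2) \<Longrightarrow> y \<in> ball x0 (R / 2) \<Longrightarrow> \<bar>w x - w y\<bar> \<le> k * M * norm (x - y) powr \<gamma>"
              "AE x in lborel. x \<in> ball x0 (R / 2) \<longrightarrow> w x = u x"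
            using C(2)[OF \<Omega> u R M(1)] unfolding b_def k_def by blast
          have eq: "w z = v z" if "z \<in> ball x0 (R / 2)" for z
          proof (rule continuous_AE_eq_imp_eq[OF open_ball _ _ _ that])
            show "continuous_on (ball x0 (R / 2)) w" by (rule holder_bound_imp_continuous_on[OF \<gamma>(1) w(1)])
            show "continuous_on (ball x0 (R / 2)) v"
              using v sub unfolding continuous_rep_def by (meson continuous_on_subset)
            have "AE x in lborel. x \<in> \<Omega> \<longrightarrow> v x = u x" using v by (simp add: continuous_rep_def AE_completion_iff)
            then show "AE x in lborel. x \<in> ball x0 (R / 2) \<longrightarrow> w x = v x"
              using w(2) by eventually_elim (use sub in auto)
          qed
          have "\<bar>v x - v y\<bar> \<le> k * M * norm (x - y) powr \<gamma>" using w(1)[OF xy(1,2)] eq xy by simp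
          then have "\<bar>v x - v y\<bar> / norm (x - y) powr \<gamma> \<le> k * M" using nz by (simp add: pos_divide_le_eq)
          also have "\<dots> = k * m + \<epsilon>" using k by (simp add: M_def distrib_left)
          finally show ?thesis .
        qed
        then show "\<bar>v x - v y\<bar> / norm (x - y) powr \<gamma> \<le> k * m" by (rule field_le_epsilon)
      qed
      then have "holder_seminorm \<gamma> (ball x0 (R / 2)) v \<le> ennreal (k * m)"
        unfolding holder_seminorm_def by (intro SUP_least) auto
      also have "\<dots> = ennreal k * b" using k m by (simp add: ennreal_mult)
      finally show ?thesis .
    qed
    then show "holder_seminorm \<gamma> (ball x0 (R / 2)) v \<le> ennreal (C / R powr \<gamma>) *
        holder_bracket s p u x0 R"
      by (simp add: k_def b_def)
  qed
qed

theorem theorem1p2: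
  fixes p s :: real
  assumes "CARD('n::finite) \<ge> 2" and "p > 2" and "0 < s" and "s \<le> (p - 2) / p"
  shows "(\<forall>(\<Omega> :: (real^'n) set) u.
            open \<Omega> \<and> bounded \<Omega> \<and> u \<in> Linf_loc \<Omega> \<and> local_weak_solution s p \<Omega> u \<longrightarrow>
            (\<forall>\<gamma>. 0 < \<gamma> \<and> \<gamma> < s * p / (p - 2) \<longrightarrow> u \<in> holder_loc \<gamma> \<Omega>)) \<and>
         (\<forall>\<gamma>. 0 < \<gamma> \<and> \<gamma> < s * p / (p - 2) \<longrightarrow>
            (\<exists>C::real. C \<ge> 1 \<and>
               (\<forall>(\<Omega> :: (real^'n) set) u v x\<^sub>o R.
                  open \<Omega> \<and> bounded \<Omega> \<and> u \<in> Linf_loc \<Omega> \<and> local_weak_solution s p \<Omega> u \<and>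
                  continuous_rep \<Omega> u v \<and> 0 < R \<and> cball x\<^sub>o R \<subseteq> \<Omega> \<longrightarrow>
                  holder_seminorm \<gamma> (ball x\<^sub>o (R / 2)) v
                    \<le> ennreal (C / R powr \<gamma>) *
                       (ennreal (R powr (s - real CARD('n) / p)) * frac_seminorm s p (ball x\<^sub>o R) u
                        + Linf_norm (ball x\<^sub>o R) u + Tail s p u x\<^sub>o R))))"
proof -
  have sp: "s * p \<le> p - 2" using assms(2,4) by (simp add: le_divide_eq)
  show ?thesis
  proof (intro conjI allI impI)
    fix \<Omega> :: "(real^'n) set" and u and \<gamma> :: real
    assume "open \<Omega> \<and> bounded \<Omega> \<and> u \<in> Linf_loc \<Omega> \<and> local_weak_solution s p \<Omega> u" "0 < \<gamma> \<and> \<gamma> < s * p / (p - 2)"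
    then show "u \<in> holder_loc \<gamma> \<Omega>"
      using holder_loc_membership[OF assms(2,3) sp] by blast
  next
    fix \<gamma> :: real assume \<gamma>: "0 < \<gamma> \<and> \<gamma> < s * p / (p - 2)"
    obtain C where C: "1 \<le> C"
      "\<And>\<Omega> (u :: real^'n \<Rightarrow> real) v x0 R. open \<Omega> \<Longrightarrow> bounded \<Omega> \<Longrightarrow> local_weak_solution s p \<Omega> u \<Longrightarrow>
        continuous_rep \<Omega> u v \<Longrightarrow> 0 < R \<Longrightarrow> cball x0 R \<subseteq> \<Omega> \<Longrightarrow>
        holder_seminorm \<gamma> (ball x0 (R / 2)) v \<le> ennreal (C / R powr \<gamma>) *
          holder_bracket s p u x0 R"
      by (rule holder_seminorm_estimate[OF assms(2,3) sp \<gamma>[THEN conjunct1] \<gamma>[THEN conjunct2], where 'n='n]) (rule that)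
    show "\<exists>C::real. C \<ge> 1 \<and>
               (\<forall>(\<Omega> :: (real^'n) set) u v x\<^sub>o R.
                  open \<Omega> \<and> bounded \<Omega> \<and> u \<in> Linf_loc \<Omega> \<and> local_weak_solution s p \<Omega> u \<and>
                  continuous_rep \<Omega> u v \<and> 0 < R \<and> cball x\<^sub>o R \<subseteq> \<Omega> \<longrightarrow>
                  holder_seminorm \<gamma> (ball x\<^sub>o (R / 2)) v
                    \<le> ennreal (C / R powr \<gamma>) *
                       (ennreal (R powr (s - real CARD('n) / p)) * frac_seminorm s p (ball x\<^sub>o R) u
                        + Linf_norm (ball x\<^sub>o R) u + Tail s p u x\<^sub>o R))"
      using C(1) by (intro exI[of _ C] conjI allI impI C(2)[unfolded holder_bracket_def]) auto
  qed
qed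

end
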